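(* Let $l$ be a positive integer, $m$ a nonnegative integer and $n=2l+m$. Assume that each triple of commuting nilpotent $n\times n$ matrices over $\mathbb{F}$ whose linear span contains either a matrix of rank at least $l+1$ or a matrix of rank $l$ with nonzero square belongs to $\overline{R(3,n)}$. Let $(A,B,C)\in N(3,n)$ be a triple such that the Jordan canonical form of $A$ has $l$ Jordan blocks of order $2$ and $m$ zero Jordan blocks (i.e. nilpotent Jordan blocks of order $1$). Then $(A,B,C)\in \overline{R(3,n)}$.
   Context: $\mathbb{F}$ is an algebraically closed field of arbitrary characteristic. $N(3,n)\subseteq M_n(\mathbb{F})^3$ is the set of all triples of pairwise commuting nilpotent $n\times n$ matrices. A matrix is 1-regular if each of its eigenspaces is at most 1-dimensional (so a nilpotent $n\times n$ matrix is 1-regular iff its Jordan form is a single block of order $n$). $R(3,n)$ is the set of all $(A_1,A_2,A_3)\in N(3,n)$ such that the linear span of $A_1,A_2,A_3$ contains a 1-regular matrix. $\overline{S}$ denotes the closure of $S$ in the Zariski topology. *)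

theory Defs
  imports
    "Jordan_Normal_Form.DL_Rank"
    "Jordan_Normal_Form.Jordan_Normal_Form_Uniqueness"
    "HOL-Analysis.Abstract_Topology"
begin

type_synonym 'a mat_triple = "'a mat \<times> 'a mat \<times> 'a mat"

definition mat_triples :: "nat \<Rightarrow> 'a mat_triple set" where
  "mat_triples n = carrier_mat n n \<times> carrier_mat n n \<times> carrier_mat n n"


(* Functions given by polynomials in the 3 * n^2 matrix entries. *)
inductive_set polyfuns :: "nat \<Rightarrow> ('a::field mat_triple \<Rightarrow> 'a) set" for n :: nat where
  const: "(\<lambda>_. c) \<in> polyfuns n"
| entry1: "i < n \<Longrightarrow> j < n \<Longrightarrow> (\<lambda>(X, Y, Z). X $$ (i, j)) \<in> polyfuns n"
| entry2: "i < n \<Longrightarrow> j < n \<Longrightarrow> (\<lambda>(X, Y, Z). Y $$ (i, j)) \<in> polyfuns n"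
| entry3: "i < n \<Longrightarrow> j < n \<Longrightarrow> (\<lambda>(X, Y, Z). Z $$ (i, j)) \<in> polyfuns n"
| add: "f \<in> polyfuns n \<Longrightarrow> g \<in> polyfuns n \<Longrightarrow> (\<lambda>T. f T + g T) \<in> polyfuns n"
| mult: "f \<in> polyfuns n \<Longrightarrow> g \<in> polyfuns n \<Longrightarrow> (\<lambda>T. f T * g T) \<in> polyfuns n"

definition zero_locus :: "nat \<Rightarrow> ('a::field mat_triple \<Rightarrow> 'a) set \<Rightarrow> 'a mat_triple set" where
  "zero_locus n P = {T \<in> mat_triples n. \<forall>p\<in>P. p T = 0}"

definition zariski_open :: "nat \<Rightarrow> 'a::field mat_triple set \<Rightarrow> bool" where
  "zariski_open n U \<longleftrightarrow> (\<exists>P \<subseteq> polyfuns n. U = mat_triples n - zero_locus n P)"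

definition zariski_topology :: "nat \<Rightarrow> 'a::field mat_triple topology" where
  "zariski_topology n = topology (zariski_open n)"

lemma istopology_zariski_open: "istopology (zariski_open n :: 'a::field mat_triple set \<Rightarrow> bool)"
  unfolding istopology_def
proof (intro conjI allI impI)
  fix S T :: "'a mat_triple set"
  assume "zariski_open n S" "zariski_open n T"
  then obtain P Q where P: "P \<subseteq> polyfuns n" "S = mat_triples n - zero_locus n P"
    and Q: "Q \<subseteq> polyfuns n" "T = mat_triples n - zero_locus n Q"
    unfolding zariski_open_def by blast
  define R where "R = (\<lambda>(p, q) x. p x * q x :: 'a) ` (P \<times> Q)"
  have "R \<subseteq> polyfuns n"
    using P(1) Q(1) by (auto simp: R_def intro!: polyfuns.mult)
  moreover have "S \<inter> T = mat_triples n - zero_locus n R"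
    unfolding P(2) Q(2) R_def zero_locus_def by fastforce
  ultimately show "zariski_open n (S \<inter> T)"
    unfolding zariski_open_def by blast
next
  fix K :: "'a mat_triple set set"
  assume "\<forall>U\<in>K. zariski_open n U"
  then obtain P where P: "\<And>U. U \<in> K \<Longrightarrow> P U \<subseteq> polyfuns n"
    "\<And>U. U \<in> K \<Longrightarrow> U = mat_triples n - zero_locus n (P U)"
    unfolding zariski_open_def by metis
  have "(\<Union>U\<in>K. P U) \<subseteq> polyfuns n"
    using P(1) by blast
  moreover have "\<Union>K = (\<Union>U\<in>K. mat_triples n - zero_locus n (P U))"
    using P(2) by auto
  then have "\<Union>K = mat_triples n - zero_locus n (\<Union>U\<in>K. P U)"
    unfolding zero_locus_def by auto
  ultimately show "zariski_open n (\<Union>K)"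
    unfolding zariski_open_def by blast
qed

lemma openin_zariski_topology: "openin (zariski_topology n) U \<longleftrightarrow> zariski_open n U"
  unfolding zariski_topology_def using istopology_zariski_open topology_inverse' by metis

lemma topspace_zariski_topology:
  "topspace (zariski_topology n) = (mat_triples n :: 'a::field mat_triple set)"
proof
  show "topspace (zariski_topology n) \<subseteq> (mat_triples n :: 'a mat_triple set)"
    using openin_topspace[of "zariski_topology n"]
    unfolding openin_zariski_topology zariski_open_def by blast
  have "zariski_open n (mat_triples n :: 'a mat_triple set)"
    unfolding zariski_open_def zero_locus_def
    by (rule exI[of _ "{\<lambda>_. 1}"]) (auto intro: polyfuns.const)
  then show "(mat_triples n :: 'a mat_triple set) \<subseteq> topspace (zariski_topology n)"
    by (simp add: openin_subset openin_zariski_topology)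
qed

lemma closedin_zariski_topology:
  fixes F :: "'a::field mat_triple set"
  shows "closedin (zariski_topology n) F \<longleftrightarrow> (\<exists>P \<subseteq> polyfuns n. F = zero_locus n P)"
proof -
  have "zero_locus n P \<subseteq> mat_triples n" for P :: "('a mat_triple \<Rightarrow> 'a) set"
    by (auto simp: zero_locus_def)
  then show ?thesis
    unfolding closedin_def openin_zariski_topology topspace_zariski_topology zariski_open_def
    by (metis double_diff order_refl)
qed


definition nilpotent_mat :: "'a::field mat \<Rightarrow> bool" where
  "nilpotent_mat A \<longleftrightarrow> (\<exists>k. A ^\<^sub>m k = 0\<^sub>m (dim_row A) (dim_row A))"

(* char_matrix A e is A - e * 1, so its kernel is the eigenspace of A for e
   (trivial if e is not an eigenvalue). *)
definition one_regular :: "'a::field mat \<Rightarrow> bool" where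
  "one_regular A \<longleftrightarrow> (\<forall>e. kernel_dim (char_matrix A e) \<le> 1)"

definition triple_span :: "'a::field mat_triple \<Rightarrow> 'a mat set" where
  "triple_span = (\<lambda>(A, B, C). {a \<cdot>\<^sub>m A + b \<cdot>\<^sub>m B + c \<cdot>\<^sub>m C | a b c. True})"

definition N3 :: "nat \<Rightarrow> 'a::field mat_triple set" where
  "N3 n = {(A, B, C) \<in> mat_triples n.
     nilpotent_mat A \<and> nilpotent_mat B \<and> nilpotent_mat C \<and>
     A * B = B * A \<and> A * C = C * A \<and> B * C = C * B}"

definition R3 :: "nat \<Rightarrow> 'a::field mat_triple set" where
  "R3 n = {T \<in> N3 n. \<exists>M \<in> triple_span T. one_regular M}"

end

theory Submission
  imports Defs
begin

text \<open>
  The closure is closed along lines of triples, so it suffices to find a line through \<open>(A, B, C)\<close> in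
  \<open>N(3, n)\<close> along which the span generically contains a matrix of rank at least \<open>l + 1\<close>, or both a matrix of
  rank \<open>l\<close> and one with nonzero square (a generic combination of the two then has both properties).

  Put \<open>A\<close> in the form with an identity block in the upper right corner. If no line works, then all
  squares in the span vanish. Adding \<open>A W A\<close> to \<open>C\<close> forces \<open>A B = A C = 0\<close>; adding \<open>R A\<close> or \<open>A R\<close> shows
  that \<open>B\<close> and \<open>C\<close> have the same kernel in \<open>ker A\<close> and the same cokernel; a common kernel vector
  outside \<open>im A\<close> together with such a covector gives a further line. Hence, up to reflection in the antidiagonal,
  the images of \<open>B\<close> and \<open>C\<close> lie in \<open>im A\<close>. In this situation:

  \<^item> if \<open>m > 0\<close>, one adds \<open>u1 v\<^sup>T\<close>, \<open>u2 v\<^sup>T\<close>, \<open>u3 v\<^sup>T\<close> to \<open>A\<close>, \<open>B\<close>, \<open>C\<close>, where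
    \<open>A u2 = B u1\<close>, \<open>A u3 = C u1\<close>, \<open>B u3 = C u2\<close> and \<open>v\<close> annihilates all \<open>ui\<close>; letting \<open>v\<close> vary in a suitable
    plane, this is a square linear system whose determinant is a binary cubic form in \<open>v\<close>, so it has a
    nontrivial zero;

  \<^item> if \<open>m = 0\<close>, the corner blocks \<open>b\<close>, \<open>c\<close> of \<open>B\<close>, \<open>C\<close> are arbitrary. The discriminant of \<open>x b + y c\<close> is a
    binary form of positive degree (if \<open>l > 1\<close>), so some combination has a repeated eigenvalue and commutes with a
    nonzero nilpotent \<open>N\<close>. One then puts \<open>t N\<close> on the diagonal blocks of another member of the span.
\<close>

section \<open>Polynomial functions of one variable\<close>

text \<open>The obstacle throughout is that a whole line must stay in \<open>N3\<close>: three
  commutation relations and nilpotency have to survive together. As long as \<open>A\<close> is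
  kept, its rank certificate is kept, and only a nonzero square has to be produced; hence most steps
  perturb one other matrix by some \<open>X\<close> commuting with the remaining two.
  \<open>A\<close> itself moves only where the rank rises to \<open>l + 1\<close>, and for
  \<open>m > 0\<close>, where all products among \<open>A\<close>, \<open>B\<close>,
  \<open>C\<close> vanish and commutation becomes linear in the \<open>ui\<close>. The count there:
  \<open>l + 3\<close> unknowns against \<open>l\<close> equations from \<open>B u3 = C u2\<close>
  and three from \<open>v\<close>; only these three involve \<open>v\<close>, whence a cubic.

  Of the closure, only the two properties in \<open>admissible\<close> are used. Preimages under
  linear substitutions inherit them, so exchanging \<open>B\<close> and \<open>C\<close>, shearing,
  conjugating and reflecting are all free.

  Arbitrary characteristic forbids dividing by 2: the corner arguments conclude proportionality
  instead of vanishing, and anticommutators are tested at entries where a single term survives. For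
  \<open>l = 1\<close>, \<open>m = 0\<close> there is no nonzero nilpotent 1 x 1 matrix to use, but
  then \<open>A\<close> is already 1-regular.\<close>

definition polyfn :: "('a::comm_ring_1 \<Rightarrow> 'a) \<Rightarrow> bool" where
  "polyfn f \<longleftrightarrow> (\<exists>p. \<forall>x. f x = poly p x)"

lemma polyfn_const [intro, simp]: "polyfn (\<lambda>_. c)"
  unfolding polyfn_def by (rule exI[of _ "[:c:]"]) simp

lemma polyfn_id [intro, simp]: "polyfn (\<lambda>x. x)"
  unfolding polyfn_def by (rule exI[of _ "[:0, 1:]"]) simp

lemma polyfn_add [intro]: "polyfn f \<Longrightarrow> polyfn g \<Longrightarrow> polyfn (\<lambda>x. f x + g x)"
  unfolding polyfn_def by (metis poly_add)

lemma polyfn_mult [intro]: "polyfn f \<Longrightarrow> polyfn g \<Longrightarrow> polyfn (\<lambda>x. f x * g x)"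
  unfolding polyfn_def by (metis poly_mult)

lemma polyfn_diff [intro]: "polyfn f \<Longrightarrow> polyfn g \<Longrightarrow> polyfn (\<lambda>x. f x - g x)"
  unfolding polyfn_def by (metis poly_diff)

lemma polyfn_sum [intro]: "(\<And>i. i \<in> I \<Longrightarrow> polyfn (f i)) \<Longrightarrow> polyfn (\<lambda>x. \<Sum>i\<in>I. f i x)"
  by (induction I rule: infinite_finite_induct) auto

lemma polyfn_prod [intro]: "(\<And>i. i \<in> I \<Longrightarrow> polyfn (f i)) \<Longrightarrow> polyfn (\<lambda>x. \<Prod>i\<in>I. f i x)"
  by (induction I rule: infinite_finite_induct) auto

lemma polyfn_power [intro]: "polyfn f \<Longrightarrow> polyfn (\<lambda>x. f x ^ k)"
  by (induction k) auto

lemma polyfn_if: "polyfn f \<Longrightarrow> polyfn g \<Longrightarrow> polyfn (\<lambda>x. if b then f x else g x)"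
  by (cases b) simp_all

lemma finite_zeros_polyfn:
  fixes f :: "'a::idom \<Rightarrow> 'a"
  assumes "polyfn f" and "f a \<noteq> 0"
  shows "finite {x. f x = 0}"
proof -
  obtain p where p: "\<And>x. f x = poly p x"
    using assms(1) unfolding polyfn_def by blast
  with assms(2) have "p \<noteq> 0" by auto
  then show ?thesis
    using poly_roots_finite[of p] p by simp
qed

text \<open>A finite field is not algebraically closed: the product of all \<open>x - a\<close>,
  increased by 1, is a polynomial of positive degree with constant value 1.\<close>

lemma infinite_UNIV_alg_closed: "infinite (UNIV :: 'a::alg_closed_field set)"
proof
  assume fin: "finite (UNIV :: 'a set)"
  define p :: "'a poly" where "p = (\<Prod>a\<in>UNIV. [:-a, 1:]) + 1"
  have "degree (\<Prod>a\<in>(UNIV :: 'a set). [:-a, 1:]) = card (UNIV :: 'a set)"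
    by (subst degree_prod_eq_sum_degree) auto
  moreover have "card (UNIV :: 'a set) > 0"
    using fin by (simp add: card_gt_0_iff)
  ultimately have "degree p > 0"
    unfolding p_def by (subst degree_add_eq_left) auto
  then obtain x where "poly p x = 0"
    using alg_closed_imp_poly_has_root by blast
  moreover have "poly p x = 1"
    using fin by (simp add: p_def poly_prod)
  ultimately show False by simp
qed

lemma polyfn_eq_at:
  fixes f :: "'a::alg_closed_field \<Rightarrow> 'a"
  assumes "polyfn f" and "infinite {x. f x = 0}"
  shows "f a = 0"
  using finite_zeros_polyfn[OF assms(1)] assms(2) by blast

lemma infinite_cofinite_alg_closed:
  fixes S :: "'a::alg_closed_field set"
  assumes "finite S" and "- S \<subseteq> T"
  shows "infinite T"
  using assms infinite_UNIV_alg_closed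
  by (metis Compl_eq_Diff_UNIV Diff_infinite_finite finite_subset)

text \<open>Either the dehomogenization \<open>f (r, 1)\<close> has a root, or it is a nonzero constant, in which
  case homogeneity forces \<open>f (1, 0) = 0\<close>.\<close>

lemma homogeneous_zero:
  fixes f :: "'a::alg_closed_field \<Rightarrow> 'a \<Rightarrow> 'a"
  assumes hom: "\<And>c x y. f (c * x) (c * y) = c ^ d * f x y" and "d > 0"
    and pr: "polyfn (\<lambda>r. f r 1)" and ps: "polyfn (\<lambda>s. f 1 s)"
  obtains x y where "x \<noteq> 0 \<or> y \<noteq> 0" and "f x y = 0"
proof (cases "\<exists>r. f r 1 = 0")
  case True
  then show ?thesis using that by (metis one_neq_zero)
next
  case False
  obtain p where p: "\<And>r. f r 1 = poly p r"
    using pr unfolding polyfn_def by blast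
  have "degree p = 0"
    using alg_closed_imp_poly_has_root[of p] False p by auto
  then obtain a where "p = [:a:]"
    by (rule degree_eq_zeroE)
  then obtain c where c: "\<And>r. f r 1 = c"
    using p by simp
  have *: "f 1 s - c * s ^ d = 0" if "s \<noteq> 0" for s
    using hom[of s "1 / s" 1] that c[of "1 / s"] by (simp add: mult.commute)
  have "infinite {s. f 1 s - c * s ^ d = 0}"
    by (rule infinite_cofinite_alg_closed[of "{0}"]) (use * in auto)
  moreover have "polyfn (\<lambda>s. f 1 s - c * s ^ d)"
    using ps by (intro polyfn_diff polyfn_mult polyfn_power) auto
  ultimately have "f 1 0 - c * 0 ^ d = 0"
    using polyfn_eq_at by blast
  then show ?thesis
    using that[of 1 0] \<open>d > 0\<close> by simp
qed

section \<open>Matrices whose entries are polynomial in one parameter\<close>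

definition polymat :: "nat \<Rightarrow> nat \<Rightarrow> ('a::comm_ring_1 \<Rightarrow> 'a mat) \<Rightarrow> bool" where
  "polymat r c F \<longleftrightarrow> (\<forall>x. F x \<in> carrier_mat r c) \<and>
     (\<forall>i<r. \<forall>j<c. polyfn (\<lambda>x. F x $$ (i, j)))"

lemma polymat_carrier: "polymat r c F \<Longrightarrow> F x \<in> carrier_mat r c"
  by (simp add: polymat_def)

lemma polymat_index: "polymat r c F \<Longrightarrow> i < r \<Longrightarrow> j < c \<Longrightarrow> polyfn (\<lambda>x. F x $$ (i, j))"
  by (simp add: polymat_def)

lemma polymat_const: "A \<in> carrier_mat r c \<Longrightarrow> polymat r c (\<lambda>_. A)"
  by (simp add: polymat_def)

lemma polymat_add:
  assumes "polymat r c F" and "polymat r c G"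
  shows "polymat r c (\<lambda>x. F x + G x)"
  unfolding polymat_def
proof (intro conjI allI impI)
  fix x show "F x + G x \<in> carrier_mat r c"
    using assms polymat_carrier by (metis add_carrier_mat)
next
  fix i j assume ij: "i < r" "j < c"
  have "(F x + G x) $$ (i, j) = F x $$ (i, j) + G x $$ (i, j)" for x
    using assms(2)[THEN polymat_carrier, of x] ij by simp
  then show "polyfn (\<lambda>x. (F x + G x) $$ (i, j))"
    using polyfn_add[OF polymat_index[OF assms(1) ij] polymat_index[OF assms(2) ij]] by simp
qed

lemma polymat_smult:
  assumes "polyfn f" and "polymat r c F"
  shows "polymat r c (\<lambda>x. f x \<cdot>\<^sub>m F x)"
  unfolding polymat_def
proof (intro conjI allI impI)
  fix x show "f x \<cdot>\<^sub>m F x \<in> carrier_mat r c"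
    using assms(2) polymat_carrier by (metis smult_carrier_mat)
next
  fix i j assume ij: "i < r" "j < c"
  have "(f x \<cdot>\<^sub>m F x) $$ (i, j) = f x * F x $$ (i, j)" for x
    using assms(2)[THEN polymat_carrier, of x] ij by simp
  then show "polyfn (\<lambda>x. (f x \<cdot>\<^sub>m F x) $$ (i, j))"
    using polyfn_mult[OF assms(1) polymat_index[OF assms(2) ij]] by simp
qed

lemma index_mult_sum:
  "A \<in> carrier_mat r k \<Longrightarrow> B \<in> carrier_mat k c \<Longrightarrow> i < r \<Longrightarrow> j < c \<Longrightarrow>
     (A * B) $$ (i, j) = (\<Sum>t<k. A $$ (i, t) * B $$ (t, j))"
  by (auto simp: scalar_prod_def atLeast0LessThan intro!: sum.cong)

lemma polymat_mult:
  assumes "polymat r k F" and "polymat k c G"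
  shows "polymat r c (\<lambda>x. F x * G x)"
  unfolding polymat_def
proof (intro conjI allI impI)
  fix x show "F x * G x \<in> carrier_mat r c"
    using assms polymat_carrier by (metis mult_carrier_mat)
next
  fix i j assume ij: "i < r" "j < c"
  have "polyfn (\<lambda>x. \<Sum>t<k. F x $$ (i, t) * G x $$ (t, j))"
    using assms ij by (intro polyfn_sum polyfn_mult) (auto intro: polymat_index)
  then show "polyfn (\<lambda>x. (F x * G x) $$ (i, j))"
    using index_mult_sum[OF polymat_carrier[OF assms(1)] polymat_carrier[OF assms(2)] ij] by simp
qed

lemma polymat_pow:
  assumes "polymat r r F"
  shows "polymat r r (\<lambda>x. F x ^\<^sub>m k)"
proof (induction k)
  case 0
  have "F x ^\<^sub>m 0 = 1\<^sub>m r" for x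
    using polymat_carrier[OF assms, of x] by auto
  then show ?case by (simp add: polymat_const)
next
  case (Suc k)
  then show ?case using polymat_mult[OF Suc assms] by simp
qed

lemma polyfn_det:
  assumes "polymat r r F"
  shows "polyfn (\<lambda>x. det (F x))"
proof -
  have "polyfn (\<lambda>x. \<Sum>p | p permutes {0..<r}. signof p * (\<Prod>i = 0..<r. F x $$ (i, p i)))"
    by (intro polyfn_sum polyfn_mult polyfn_prod polyfn_const polymat_index[OF assms])
      (auto simp: permutes_in_image[of _ "{0..<r}", simplified] dest: permutes_in_image)
  then show ?thesis
    using det_def'[OF polymat_carrier[OF assms]] by simp
qed

lemma polymat_mat:
  "(\<And>i j. i < r \<Longrightarrow> j < c \<Longrightarrow> polyfn (\<lambda>x. f x i j)) \<Longrightarrow>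
    polymat r c (\<lambda>x. mat r c (\<lambda>(i, j). f x i j))"
  by (simp add: polymat_def)

lemma polymat_line:
  "A \<in> carrier_mat r c \<Longrightarrow> X \<in> carrier_mat r c \<Longrightarrow> polymat r c (\<lambda>t. A + t \<cdot>\<^sub>m X)"
  by (intro polymat_add polymat_smult polymat_const) auto

lemma polymat_nonzero_finite:
  fixes F :: "'a::idom \<Rightarrow> 'a mat"
  assumes "polymat r c F" and "F a \<noteq> 0\<^sub>m r c"
  shows "finite {x. F x = 0\<^sub>m r c}"
proof -
  obtain i j where ij: "i < r" "j < c" "F a $$ (i, j) \<noteq> 0"
    using assms polymat_carrier[OF assms(1), of a] by (force intro!: eq_matI)
  have "finite {x. F x $$ (i, j) = 0}"
    using finite_zeros_polyfn[OF polymat_index[OF assms(1) ij(1,2)]] ij(3) by blast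
  then show ?thesis
    by (rule finite_subset[rotated]) (use ij in auto)
qed

section \<open>Rank certificates\<close>

text \<open>A lower bound for the rank in the form of one nonvanishing determinant. Along a
  polynomial family with fixed \<open>P\<close> and \<open>Q\<close> it fails for finitely many
  parameters only, and it is easily carried through similarity and transposition.\<close>

definition rank_ge :: "nat \<Rightarrow> nat \<Rightarrow> 'a::field mat \<Rightarrow> bool" where
  "rank_ge n k M \<longleftrightarrow> (\<exists>P\<in>carrier_mat k n. \<exists>Q\<in>carrier_mat n k. det (P * M * Q) \<noteq> 0)"

text \<open>Invertibility of \<open>P * M * Q\<close> makes \<open>M * Q\<close> injective, so its
  \<open>k\<close> columns are independent, and they lie in the column space of
  \<open>M\<close>.\<close>

lemma rank_ge_imp_rank:
  fixes M :: "'a::field mat"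
  assumes "rank_ge n k M" and M: "M \<in> carrier_mat n n"
  shows "vec_space.rank n M \<ge> k"
proof -
  interpret vec_space "TYPE('a)" n .
  obtain P Q where P: "P \<in> carrier_mat k n" and Q: "Q \<in> carrier_mat n k"
    and det: "det (P * M * Q) \<noteq> 0"
    using assms(1) unfolding rank_ge_def by blast
  let ?B = "M * Q"
  have B: "?B \<in> carrier_mat n k" using M Q by simp
  have PB: "P * ?B = P * M * Q" using assoc_mult_mat[OF P M Q] by simp
  have inj: "v = 0\<^sub>v k" if v: "v \<in> carrier_vec k" and "?B *\<^sub>v v = 0\<^sub>v n" for v
  proof (rule ccontr)
    assume "v \<noteq> 0\<^sub>v k"
    moreover have "(P * M * Q) *\<^sub>v v = 0\<^sub>v k"
      using assoc_mult_mat_vec[OF P B v] \<open>?B *\<^sub>v v = 0\<^sub>v n\<close> P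
      by (auto simp flip: PB intro!: eq_vecI)
    moreover have "P * M * Q \<in> carrier_mat k k" using P M Q by simp
    ultimately show False
      using det det_0_iff_vec_prod_zero_field v by blast
  qed
  have dist: "distinct (cols ?B)"
  proof (rule ccontr)
    assume "\<not> distinct (cols ?B)"
    then obtain i j where ij: "i < k" "j < k" "i \<noteq> j" "col ?B i = col ?B j"
      using B by (auto simp: distinct_conv_nth)
    have "?B *\<^sub>v (unit_vec k i - unit_vec k j) = 0\<^sub>v n"
    proof -
      have "?B *\<^sub>v unit_vec k t = col ?B t" if "t < k" for t
        using B that by (auto intro!: eq_vecI)
      then show ?thesis
        using B ij by (subst mult_minus_distrib_mat_vec[OF B]) auto
    qed
    then have "unit_vec k i - unit_vec k j = (0\<^sub>v k :: 'a vec)"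
      by (intro inj) auto
    then have "(unit_vec k i - unit_vec k j) $ i = (0\<^sub>v k :: 'a vec) $ i" by simp
    then show False using ij by simp
  qed
  have "lin_indpt (set (cols ?B))"
    using lin_depE[OF B _ dist] inj by metis
  then have "rank ?B = k"
    by (rule lin_indpt_full_rank[OF B dist])
  moreover have "rank ?B \<le> rank M"
  proof -
    have sub: "set (cols ?B) \<subseteq> span (set (cols M))"
    proof
      fix x assume "x \<in> set (cols ?B)"
      then obtain i where i: "i < k" "x = col ?B i"
        using B by (metis carrier_matD(2) cols_length cols_nth in_set_conv_nth)
      have "x = M *\<^sub>v col Q i"
        unfolding i(2) by (rule col_mult2[OF M Q i(1)])
      moreover have "M *\<^sub>v col Q i \<in> col_space M"
        using M Q i by (subst col_space_eq[OF M]) (auto intro!: bexI[of _ "col Q i"])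
      ultimately show "x \<in> span (set (cols M))" by (simp add: col_space_def)
    qed
    let ?U = "span (set (cols M))" and ?W = "span (set (cols ?B))"
    have carr: "set (cols M) \<subseteq> carrier_vec n" "set (cols ?B) \<subseteq> carrier_vec n"
      using cols_dim[of M] cols_dim[of ?B] M B by auto
    have U: "VectorSpace.subspace class_ring ?U V" and W: "VectorSpace.subspace class_ring ?W V"
      using carr by (auto intro: span_is_subspace)
    have "?W \<subseteq> ?U"
      using sub carr by (simp add: span_is_subset U[unfolded VectorSpace.subspace_def])
    then have "VectorSpace.subspace class_ring ?W (vs ?U)"
      by (rule nested_subspaces[OF U W])
    then show ?thesis
      unfolding rank_def
      using vectorspace.subspace_dim[OF subspace_is_vs[OF U]]
        fin_dim_span_cols[OF M] fin_dim_span_cols[OF B] by auto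
  qed
  ultimately show ?thesis by simp
qed

section \<open>Nilpotent matrices in a commutant\<close>

definition outer :: "'a::comm_ring_1 vec \<Rightarrow> 'a vec \<Rightarrow> 'a mat" where
  "outer u v = mat (dim_vec u) (dim_vec v) (\<lambda>(i, j). u $ i * v $ j)"

lemma outer_carrier [simp]: "u \<in> carrier_vec r \<Longrightarrow> v \<in> carrier_vec c \<Longrightarrow> outer u v \<in> carrier_mat r c"
  by (auto simp: outer_def)

lemma outer_index [simp]: "i < dim_vec u \<Longrightarrow> j < dim_vec v \<Longrightarrow> outer u v $$ (i, j) = u $ i * v $ j"
  by (simp add: outer_def)

lemma outer_dim [simp]: "dim_row (outer u v) = dim_vec u" "dim_col (outer u v) = dim_vec v"
  by (simp_all add: outer_def)

lemma mult_outer: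
  "A \<in> carrier_mat r k \<Longrightarrow> u \<in> carrier_vec k \<Longrightarrow> A * outer u v = outer (A *\<^sub>v u) v"
  by (intro eq_matI) (auto simp: scalar_prod_def sum_distrib_left sum_distrib_right mult_ac)

lemma outer_mult:
  "A \<in> carrier_mat k c \<Longrightarrow> v \<in> carrier_vec k \<Longrightarrow> outer u v * A = outer u (A\<^sup>T *\<^sub>v v)"
  by (intro eq_matI) (auto simp: scalar_prod_def sum_distrib_left sum_distrib_right mult_ac)

lemma outer_mult_outer:
  "v \<in> carrier_vec k \<Longrightarrow> w \<in> carrier_vec k \<Longrightarrow> outer u v * outer w z = (v \<bullet> w) \<cdot>\<^sub>m outer u z"
  by (intro eq_matI) (auto simp: scalar_prod_def sum_distrib_left sum_distrib_right mult_ac)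

lemma outer_zero [simp]:
  "outer (0\<^sub>v r) v = 0\<^sub>m r (dim_vec v)" "outer u (0\<^sub>v c) = 0\<^sub>m (dim_vec u) c"
  by (auto intro!: eq_matI simp: outer_def)

lemma outer_smult [simp]: "outer (a \<cdot>\<^sub>v u) v = a \<cdot>\<^sub>m outer u v" "outer u (a \<cdot>\<^sub>v v) = a \<cdot>\<^sub>m outer u v"
  by (auto intro!: eq_matI simp: outer_def)

lemma outer_nonzero:
  fixes u v :: "'a::idom vec"
  assumes "u \<in> carrier_vec r" "v \<in> carrier_vec c" "u \<noteq> 0\<^sub>v r" "v \<noteq> 0\<^sub>v c"
  shows "outer u v \<noteq> 0\<^sub>m r c"
proof
  assume 0: "outer u v = 0\<^sub>m r c"
  obtain i where i: "i < r" "u $ i \<noteq> 0"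
    using assms by (metis carrier_vecD eq_vecI index_zero_vec)
  obtain j where j: "j < c" "v $ j \<noteq> 0"
    using assms by (metis carrier_vecD eq_vecI index_zero_vec)
  have "outer u v $$ (i, j) = 0" using 0 i j by simp
  then show False using i j assms by simp
qed

lemma conj_mult:
  fixes P :: "'a::semiring_1 mat"
  assumes "P \<in> carrier_mat n n" "Q \<in> carrier_mat n n" "X \<in> carrier_mat n n" "Y \<in> carrier_mat n n"
    and QP: "Q * P = 1\<^sub>m n"
  shows "(P * X * Q) * (P * Y * Q) = P * (X * Y) * Q"
proof -
  have "(P * X * Q) * (P * Y * Q) = P * X * (Q * P) * Y * Q"
    using assms(1-4) by (simp add: assoc_mult_mat[of _ n n _ n _ n])
  then show ?thesis
    using assms by (simp add: assoc_mult_mat[of _ n n _ n _ n])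
qed

text \<open>The working substitute for a repeated eigenvalue: the proof needs only the nilpotent
  \<open>N\<close> in the centralizer, never the eigenvalue itself.\<close>

definition commutes_nilpotent :: "nat \<Rightarrow> 'a::field mat \<Rightarrow> bool" where
  "commutes_nilpotent l M \<longleftrightarrow> (\<exists>N\<in>carrier_mat l l. N \<noteq> 0\<^sub>m l l \<and> (\<exists>k. N ^\<^sub>m k = 0\<^sub>m l l) \<and> M * N = N * M)"

lemma commutes_nilpotent_similar:
  assumes "similar_mat M M'" and M: "M \<in> carrier_mat l l" and "commutes_nilpotent l M'"
  shows "commutes_nilpotent l M"
proof -
  obtain P Q where wit: "similar_mat_wit M M' P Q"
    using assms(1) unfolding similar_mat_def by blast
  note w = similar_mat_witD2[OF M wit]
  obtain N k where N: "N \<in> carrier_mat l l" "N \<noteq> 0\<^sub>m l l" "N ^\<^sub>m k = 0\<^sub>m l l" "M' * N = N * M'"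
    using assms(3) unfolding commutes_nilpotent_def by blast
  have P: "P \<in> carrier_mat l l" and Q: "Q \<in> carrier_mat l l" and M': "M' \<in> carrier_mat l l"
    and PQ: "P * Q = 1\<^sub>m l" and QP: "Q * P = 1\<^sub>m l" and MP: "M = P * M' * Q"
    using w by auto
  let ?N = "P * N * Q"
  have "similar_mat_wit ?N N P Q"
    by (rule similar_mat_witI[OF PQ QP]) (use P Q N in auto)
  then have pow: "?N ^\<^sub>m k = 0\<^sub>m l l"
    using similar_mat_wit_pow_id[of ?N N P Q k] N P Q by simp
  note conj = conj_mult[OF P Q _ _ QP]
  have "M * ?N = ?N * M"
    unfolding MP using conj N M' by simp
  moreover have "?N \<noteq> 0\<^sub>m l l"
  proof
    assume 0: "?N = 0\<^sub>m l l"
    have "N = Q * P * N * (Q * P)" using QP N by simp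
    also have "\<dots> = Q * ?N * P"
      using N P Q by (simp add: assoc_mult_mat[of _ l l _ l _ l])
    also have "\<dots> = 0\<^sub>m l l" using 0 P Q by simp
    finally show False using N by simp
  qed
  ultimately show ?thesis
    unfolding commutes_nilpotent_def using pow P Q N by (intro bexI[of _ ?N]) auto
qed

text \<open>When a right and a left eigenvector pair to 1, the space is the direct sum of the line
  of \<open>u\<close> and the kernel of \<open>v\<close>, and \<open>M\<close> preserves both
  summands.\<close>

lemma deflation:
  fixes M :: "'a::field mat"
  assumes M: "M \<in> carrier_mat (Suc l) (Suc l)"
    and u: "u \<in> carrier_vec (Suc l)" "M *\<^sub>v u = e \<cdot>\<^sub>v u"
    and v: "v \<in> carrier_vec (Suc l)" "M\<^sup>T *\<^sub>v v = e \<cdot>\<^sub>v v"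
    and vu: "v \<bullet> u = 1"
  obtains M' where "M' \<in> carrier_mat l l"
    "similar_mat M (four_block_mat (mat 1 1 (\<lambda>_. e)) (0\<^sub>m 1 l) (0\<^sub>m l 1) M')"
proof -
  let ?n = "Suc l"
  have "u \<noteq> 0\<^sub>v ?n" using vu v by auto
  then obtain p where p: "p < ?n" "u $ p \<noteq> 0"
    using u by (metis carrier_vecD eq_vecI index_zero_vec)
  \<comment> \<open>On nonzero indices \<open>\<sigma>\<close> enumerates all positions except
    \<open>p\<close>; index 0 is reserved for the eigenvectors.\<close>
  define \<sigma> where "\<sigma> c = (if c = p then 0 else c)" for c :: nat
  have \<sigma>: "\<sigma> c < ?n" "\<sigma> c \<noteq> p" if "c < ?n" "c \<noteq> 0" for c
    using that p by (auto simp: \<sigma>_def)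
  have \<sigma>_inj: "\<sigma> c = \<sigma> c' \<longleftrightarrow> c = c'" if "c \<noteq> 0" "c' \<noteq> 0" for c c'
    using that by (auto simp: \<sigma>_def)
  \<comment> \<open>Dual bases adapted to the splitting: for nonzero indices, the columns
    \<open>sc\<close> are unit vectors projected to the kernel of \<open>v\<close> along
    \<open>u\<close>, and the rows \<open>tr\<close> are coordinate functionals corrected at
    \<open>p\<close> so that they annihilate \<open>u\<close>.\<close>
  define tr where "tr r = (if r = 0 then v else unit_vec ?n (\<sigma> r) - (u $ \<sigma> r / u $ p) \<cdot>\<^sub>v unit_vec ?n p)" for r
  define sc where "sc c = (if c = 0 then u else unit_vec ?n (\<sigma> c) - (v $ \<sigma> c) \<cdot>\<^sub>v u)" for c
  have tr_c: "tr r \<in> carrier_vec ?n" and sc_c: "sc r \<in> carrier_vec ?n" for r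
    using u v by (auto simp: tr_def sc_def)
  have prod: "tr r \<bullet> sc c = (if r = c then 1 else 0)" if r: "r < ?n" and c: "c < ?n" for r c
  proof -
    have up: "unit_vec ?n i \<bullet> x = x $ i" "x \<bullet> unit_vec ?n i = x $ i"
      if "i < ?n" "x \<in> carrier_vec ?n" for i and x :: "'a vec"
      using that by auto
    consider "r = 0" "c = 0" | "r = 0" "c \<noteq> 0" | "r \<noteq> 0" "c = 0" | "r \<noteq> 0" "c \<noteq> 0" by blast
    then show ?thesis
    proof cases
      case 1
      then show ?thesis by (simp add: tr_def sc_def vu)
    next
      case 2
      then have "tr r \<bullet> sc c = v \<bullet> unit_vec ?n (\<sigma> c) - v $ \<sigma> c * (v \<bullet> u)"
        using u v by (simp add: tr_def sc_def scalar_prod_minus_distrib[of _ ?n])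
      then show ?thesis using 2 \<sigma>[OF c] v vu by simp
    next
      case 3
      then have "tr r \<bullet> sc c = u $ \<sigma> r - u $ \<sigma> r / u $ p * u $ p"
        using u p \<sigma>[OF r] by (simp add: tr_def sc_def minus_scalar_prod_distrib[of _ ?n])
      then show ?thesis using 3 p by simp
    next
      case 4
      have "tr r \<bullet> sc c = (unit_vec ?n (\<sigma> c) $ \<sigma> r - v $ \<sigma> c * u $ \<sigma> r)
          - u $ \<sigma> r / u $ p * (unit_vec ?n (\<sigma> c) $ p - v $ \<sigma> c * u $ p)"
        using 4 u v p \<sigma>[OF r 4(1)] \<sigma>[OF c 4(2)]
        by (simp add: tr_def sc_def minus_scalar_prod_distrib[of _ ?n] scalar_prod_minus_distrib[of _ ?n])
      then show ?thesis
        using 4 p \<sigma>[OF r 4(1)] \<sigma>[OF c 4(2)] \<sigma>_inj[OF 4] by (auto simp: field_simps)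
    qed
  qed
  define T where "T = mat ?n ?n (\<lambda>(i, j). tr i $ j)"
  define S where "S = mat ?n ?n (\<lambda>(i, j). sc j $ i)"
  have T: "T \<in> carrier_mat ?n ?n" and S: "S \<in> carrier_mat ?n ?n"
    by (auto simp: T_def S_def)
  have rowT: "row T i = tr i" if "i < ?n" for i
    using that tr_c[of i] by (auto simp: T_def intro!: eq_vecI)
  have colS: "col S i = sc i" if "i < ?n" for i
    using that sc_c[of i] by (auto simp: S_def intro!: eq_vecI)
  have TS: "T * S = 1\<^sub>m ?n"
    by (intro eq_matI) (use T S in \<open>auto simp: rowT colS prod\<close>)
  have ST: "S * T = 1\<^sub>m ?n"
    using mat_mult_left_right_inverse[OF T S TS] .
  define B where "B = T * M * S"
  have B: "B \<in> carrier_mat ?n ?n" using T M S by (simp add: B_def)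
  have "M = S * T * M * (S * T)" using ST M by simp
  also have "\<dots> = S * B * T"
    using T M S by (simp add: B_def assoc_mult_mat[of _ ?n ?n _ ?n _ ?n])
  finally have sim: "similar_mat M B"
    using similar_matI[of M B S T ?n] M B S T ST TS by blast
  have B_index: "B $$ (i, j) = tr i \<bullet> (M *\<^sub>v sc j)" if "i < ?n" "j < ?n" for i j
  proof -
    have "B = T * (M * S)" using T M S by (simp add: B_def)
    then have "B $$ (i, j) = row T i \<bullet> col (M * S) j"
      using T M S that by (simp del: col_mult2 col_mult)
    then show ?thesis
      unfolding rowT[OF that(1)] col_mult2[OF M S that(2)] colS[OF that(2)] .
  qed
  have B0: "B $$ (i, 0) = (if i = 0 then e else 0)" if "i < ?n" for i
  proof -
    have "B $$ (i, 0) = e * (tr i \<bullet> sc 0)"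
      using that B_index[of i 0] u tr_c[of i] by (simp add: sc_def)
    then show ?thesis using prod[of i 0] that by simp
  qed
  have B0': "B $$ (0, j) = (if j = 0 then e else 0)" if "j < ?n" for j
  proof -
    have "B $$ (0, j) = v \<bullet> (M *\<^sub>v sc j)"
      using that B_index[of 0 j] by (simp add: tr_def)
    also have "\<dots> = (M\<^sup>T *\<^sub>v v) \<bullet> sc j"
      using transpose_vec_mult_scalar[OF M sc_c v(1)] by simp
    also have "\<dots> = e * (tr 0 \<bullet> sc j)"
      using v sc_c[of j] by (simp add: tr_def)
    finally show ?thesis using prod[of 0 j] that by auto
  qed
  define M' where "M' = mat l l (\<lambda>(i, j). B $$ (Suc i, Suc j))"
  have "B = four_block_mat (mat 1 1 (\<lambda>_. e)) (0\<^sub>m 1 l) (0\<^sub>m l 1) M'"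
  proof (intro eq_matI)
    fix i j assume "i < dim_row (four_block_mat (mat 1 1 (\<lambda>_. e)) (0\<^sub>m 1 l) (0\<^sub>m l 1) M')"
      "j < dim_col (four_block_mat (mat 1 1 (\<lambda>_. e)) (0\<^sub>m 1 l) (0\<^sub>m l 1) M')"
    then have "i < ?n" "j < ?n" by (auto simp: M'_def)
    then show "B $$ (i, j) = four_block_mat (mat 1 1 (\<lambda>_. e)) (0\<^sub>m 1 l) (0\<^sub>m l 1) M' $$ (i, j)"
      using B0[of i] B0'[of j] by (auto simp: M'_def)
  qed (use B in \<open>auto simp: M'_def\<close>)
  then show thesis
    using that[of M'] sim by (simp add: M'_def)
qed

text \<open>By induction on \<open>l\<close>, splitting off one eigenvalue at a time. The process
  stops early if a left and a right eigenvector are orthogonal, or at the end if two diagonal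
  entries agree; both situations yield a rank one nilpotent in the centralizer.\<close>

lemma commutes_nilpotent_or_diagonalizable:
  fixes M :: "'a::alg_closed_field mat"
  assumes "M \<in> carrier_mat l l"
  shows "commutes_nilpotent l M \<or> (\<exists>d. inj_on d {..<l} \<and> similar_mat M (mat_diag l d))"
  using assms
proof (induction l arbitrary: M)
  case 0
  have "M = mat_diag 0 (\<lambda>_. 0)" using 0 by (auto simp: mat_diag_def)
  then show ?case
    using similar_mat_refl[OF 0] by (intro disjI2 exI[of _ "\<lambda>_. 0"]) simp
next
  case (Suc l)
  let ?n = "Suc l"
  have M: "M \<in> carrier_mat ?n ?n" by fact
  have "degree (char_poly M) > 0"
    using degree_monic_char_poly[OF M] by simp
  then obtain e where "poly (char_poly M) e = 0"
    using alg_closed_imp_poly_has_root by blast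
  then have "eigenvalue M e" and "eigenvalue M\<^sup>T e"
    using eigenvalue_root_char_poly[OF M] eigenvalue_root_char_poly[of "M\<^sup>T" ?n e]
      char_poly_transpose_mat[OF M] M by auto
  then obtain u v where u: "u \<in> carrier_vec ?n" "u \<noteq> 0\<^sub>v ?n" "M *\<^sub>v u = e \<cdot>\<^sub>v u"
    and v: "v \<in> carrier_vec ?n" "v \<noteq> 0\<^sub>v ?n" "M\<^sup>T *\<^sub>v v = e \<cdot>\<^sub>v v"
    using M unfolding eigenvalue_def eigenvector_def by auto
  show ?case
  proof (cases "v \<bullet> u = 0")
    case True
    \<comment> \<open>Both \<open>M * ?N\<close> and \<open>?N * M\<close> equal \<open>e\<close>
      times \<open>?N\<close>, and orthogonality of \<open>v\<close> and \<open>u\<close> makes the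
      square vanish.\<close>
    let ?N = "outer u v"
    have "?N * ?N = 0\<^sub>m ?n ?n"
      using True u v by (auto simp: outer_mult_outer[of _ ?n] intro!: eq_matI)
    then have "?N ^\<^sub>m 2 = 0\<^sub>m ?n ?n"
      using u v by (simp add: numeral_2_eq_2)
    moreover have "M * ?N = ?N * M"
      using M u v by (simp add: mult_outer[of _ ?n ?n] outer_mult[of _ ?n ?n])
    ultimately have "commutes_nilpotent ?n M"
      unfolding commutes_nilpotent_def
      using u v outer_nonzero[of u ?n v ?n] by (intro bexI[of _ ?N]) auto
    then show ?thesis by simp
  next
    case False
    define w where "w = (1 / (v \<bullet> u)) \<cdot>\<^sub>v v"
    have w: "w \<in> carrier_vec ?n" "M\<^sup>T *\<^sub>v w = e \<cdot>\<^sub>v w" "w \<bullet> u = 1"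
      using v u False M by (auto simp: w_def mult_mat_vec[of _ ?n ?n] smult_smult_assoc mult.commute)
    let ?F = "\<lambda>X. four_block_mat (mat 1 1 (\<lambda>_. e)) (0\<^sub>m 1 l) (0\<^sub>m l 1) X"
    obtain M' where M': "M' \<in> carrier_mat l l" and sim: "similar_mat M (?F M')"
      using deflation[OF M u(1,3) w] by blast
    from Suc.IH[OF M'] show ?thesis
    proof
      assume "commutes_nilpotent l M'"
      then obtain N k where N: "N \<in> carrier_mat l l" "N \<noteq> 0\<^sub>m l l" "N ^\<^sub>m k = 0\<^sub>m l l" "M' * N = N * M'"
        unfolding commutes_nilpotent_def by blast
      let ?N = "four_block_mat (0\<^sub>m 1 1) (0\<^sub>m 1 l) (0\<^sub>m l 1) N"
      have "N ^\<^sub>m Suc k = 0\<^sub>m l l" using N by simp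
      moreover have "(0\<^sub>m 1 1 :: 'a mat) ^\<^sub>m Suc k = 0\<^sub>m 1 1"
        by (simp add: right_mult_zero_mat[of _ 1 1])
      ultimately have "?N ^\<^sub>m Suc k = 0\<^sub>m ?n ?n"
        using N(1) by (subst pow_four_block_mat[of _ 1 _ l]) (auto simp del: pow_mat.simps intro!: eq_matI)
      moreover have "?F M' * ?N = ?N * ?F M'"
        using N M' by (subst (1 2) mult_four_block_mat[of _ 1 1 _ l _ l _ _ 1 _ l]) auto
      moreover have "?N \<noteq> 0\<^sub>m ?n ?n"
      proof
        assume 0: "?N = 0\<^sub>m ?n ?n"
        have "N = 0\<^sub>m l l"
        proof (rule eq_matI)
          fix i j assume "i < dim_row (0\<^sub>m l l :: 'a mat)" "j < dim_col (0\<^sub>m l l :: 'a mat)"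
          then show "N $$ (i, j) = 0\<^sub>m l l $$ (i, j)"
            using arg_cong[OF 0, of "\<lambda>X. X $$ (Suc i, Suc j)"] N by simp
        qed (use N in auto)
        then show False using N by simp
      qed
      moreover have "?N \<in> carrier_mat ?n ?n" using N by auto
      ultimately have "commutes_nilpotent ?n (?F M')"
        unfolding commutes_nilpotent_def by blast
      then show ?thesis using commutes_nilpotent_similar[OF sim M] by blast
    next
      assume "\<exists>d. inj_on d {..<l} \<and> similar_mat M' (mat_diag l d)"
      then obtain d' where "similar_mat M' (mat_diag l d')" by blast
      then have sim': "similar_mat (?F M') (?F (mat_diag l d'))"
        by (intro similar_mat_four_block_0_0 similar_mat_refl[of _ 1] M') auto
      define d where "d i = (case i of 0 \<Rightarrow> e | Suc i \<Rightarrow> d' i)" for i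
      have "?F (mat_diag l d') = mat_diag ?n d"
        by (auto intro!: eq_matI simp: mat_diag_def d_def split: nat.splits)
      then have sim'': "similar_mat M (mat_diag ?n d)"
        using similar_mat_trans[OF sim sim'] by simp
      show ?thesis
      proof (cases "inj_on d {..<?n}")
        case True
        then show ?thesis using sim'' by blast
      next
        case False
        then obtain i j where ij: "i < ?n" "j < ?n" "i \<noteq> j" "d i = d j"
          by (auto simp: inj_on_def)
        \<comment> \<open>A matrix unit between two positions with equal diagonal entries commutes
          with the diagonal matrix; it is nilpotent since \<open>i\<close> and \<open>j\<close>
          differ.\<close>
        let ?N = "outer (unit_vec ?n i) (unit_vec ?n j) :: 'a mat"
        have N: "?N \<in> carrier_mat ?n ?n" by simp
        have "?N * ?N = 0\<^sub>m ?n ?n"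
          using ij by (auto simp: outer_mult_outer[of _ ?n] intro!: eq_matI)
        then have "?N ^\<^sub>m 2 = 0\<^sub>m ?n ?n"
          by (simp add: numeral_2_eq_2)
        moreover have "?N \<noteq> 0\<^sub>m ?n ?n"
          using ij by (intro outer_nonzero) auto
        moreover have "mat_diag ?n d * ?N = ?N * mat_diag ?n d"
          unfolding mat_diag_mult_left[OF N] mat_diag_mult_right[OF N]
          using ij by (auto intro!: eq_matI)
        ultimately have "commutes_nilpotent ?n (mat_diag ?n d)"
          unfolding commutes_nilpotent_def using N by blast
        then show ?thesis using commutes_nilpotent_similar[OF sim'' M] by blast
      qed
    qed
  qed
qed

section \<open>The discriminant as a determinant of traces\<close>

lemma det_scale_rows_cols:
  "det (mat n n (\<lambda>(i, j). a i * b j * F i j)) =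
    (\<Prod>i<n. a i) * (\<Prod>j<n. b j) * det (mat n n (\<lambda>(i, j). F i j))"
proof -
  have "det (mat n n (\<lambda>(i, j). a i * b j * F i j)) =
      (\<Sum>p | p permutes {0..<n}. signof p * (\<Prod>i = 0..<n. a i * b (p i) * F i (p i)))"
    by (subst det_def'[of _ n]) (auto intro!: sum.cong prod.cong dest: permutes_in_image)
  also have "\<dots> = (\<Sum>p | p permutes {0..<n}.
      (\<Prod>i<n. a i) * (\<Prod>j<n. b j) * (signof p * (\<Prod>i = 0..<n. F i (p i))))"
  proof (intro sum.cong refl)
    fix p assume "p \<in> {p. p permutes {0..<n}}"
    then have "(\<Prod>i = 0..<n. b (p i)) = (\<Prod>j = 0..<n. b j)"
      by (intro prod.permute[of p "{0..<n}" b, unfolded comp_def, symmetric]) simp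
    then show "signof p * (\<Prod>i = 0..<n. a i * b (p i) * F i (p i)) =
        (\<Prod>i<n. a i) * (\<Prod>j<n. b j) * (signof p * (\<Prod>i = 0..<n. F i (p i)))"
      by (simp add: prod.distrib atLeast0LessThan mult_ac)
  qed
  also have "\<dots> = (\<Prod>i<n. a i) * (\<Prod>j<n. b j) * det (mat n n (\<lambda>(i, j). F i j))"
    by (subst det_def'[of _ n]) (auto simp: sum_distrib_left dest: permutes_in_image intro!: sum.cong prod.cong)
  finally show ?thesis .
qed

definition tr :: "'a::comm_ring_1 mat \<Rightarrow> 'a" where
  "tr M = (\<Sum>i<dim_row M. M $$ (i, i))"

lemma tr_mult_comm:
  assumes "A \<in> carrier_mat r c" and "B \<in> carrier_mat c r"
  shows "tr (A * B) = tr (B * A)"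
proof -
  have "tr (A * B) = (\<Sum>i<r. \<Sum>k<c. A $$ (i, k) * B $$ (k, i))"
    unfolding tr_def using assms index_mult_sum[OF assms] by auto
  also have "\<dots> = (\<Sum>k<c. \<Sum>i<r. B $$ (k, i) * A $$ (i, k))"
    by (subst sum.swap) (simp add: mult.commute)
  also have "\<dots> = tr (B * A)"
    unfolding tr_def using assms index_mult_sum[OF assms(2,1)] by auto
  finally show ?thesis .
qed

lemma tr_similar:
  assumes "similar_mat_wit A B P Q" and "A \<in> carrier_mat n n"
  shows "tr A = tr B"
proof -
  note w = similar_mat_witD2[OF assms(2,1)]
  have "tr A = tr (P * (B * Q))"
    using w by (simp add: assoc_mult_mat[of _ n n _ n _ n])
  also have "\<dots> = tr ((B * Q) * P)"
    using w by (intro tr_mult_comm) auto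
  also have "\<dots> = tr B"
    using w by (simp add: assoc_mult_mat[of _ n n _ n _ n])
  finally show ?thesis .
qed

text \<open>The Gram matrix of \<open>1, M, ..., M ^ (l - 1)\<close> under the trace form. For
  diagonalizable \<open>M\<close> it is the transposed Vandermonde matrix of the eigenvalues times
  the Vandermonde matrix, so its determinant is the discriminant of the characteristic polynomial.
  In this form, homogeneity and polynomial dependence on \<open>M\<close> are immediate.\<close>

definition trace_gram :: "nat \<Rightarrow> 'a::comm_ring_1 mat \<Rightarrow> 'a mat" where
  "trace_gram l M = mat l l (\<lambda>(i, j). tr (M ^\<^sub>m (i + j)))"

text \<open>A kernel vector would be the coefficient list of a nonzero polynomial of degree below
  \<open>l\<close> with the \<open>l\<close> distinct roots \<open>d k\<close>.\<close>

lemma vandermonde_det_nonzero: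
  fixes d :: "nat \<Rightarrow> 'a::field"
  assumes "inj_on d {..<l}"
  shows "det (mat l l (\<lambda>(k, i). d k ^ i)) \<noteq> 0"
proof
  let ?V = "mat l l (\<lambda>(k, i). d k ^ i)"
  assume "det ?V = 0"
  then obtain c where c: "c \<in> carrier_vec l" "c \<noteq> 0\<^sub>v l" "?V *\<^sub>v c = 0\<^sub>v l"
    using det_0_iff_vec_prod_zero_field[of ?V l] by auto
  define p where "p = (\<Sum>i<l. monom (c $ i) i)"
  have coeff: "coeff p i = c $ i" if "i < l" for i
    using that by (simp add: p_def coeff_sum)
  have deg: "degree p < l" if "l > 0"
  proof -
    have "degree p \<le> l - 1"
      unfolding p_def
      by (intro degree_sum_le) (auto intro: order_trans[OF degree_monom_le])
    then show ?thesis using that by simp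
  qed
  have root: "poly p (d k) = 0" if "k < l" for k
  proof -
    have "poly p (d k) = (?V *\<^sub>v c) $ k"
      using that c(1)
      by (auto simp: p_def poly_sum poly_monom scalar_prod_def atLeast0LessThan mult.commute intro!: sum.cong)
    then show ?thesis using c(3) that by simp
  qed
  obtain i where i: "i < l" "c $ i \<noteq> 0"
    using c by (metis carrier_vecD eq_vecI index_zero_vec)
  then have "p \<noteq> 0" using coeff[of i] by auto
  have "l = card (d ` {..<l})"
    using assms by (simp add: card_image)
  also have "\<dots> \<le> card {x. poly p x = 0}"
    using root poly_roots_finite[OF \<open>p \<noteq> 0\<close>] by (intro card_mono) auto
  also have "\<dots> \<le> degree p"
    using \<open>p \<noteq> 0\<close> by (rule card_poly_roots_bound)
  finally show False using deg i by simp
qed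

lemma mat_diag_pow: "mat_diag l d ^\<^sub>m k = mat_diag l (\<lambda>i. d i ^ k)"
  by (induction k) (simp_all add: power_commutes, simp add: mat_diag_def)

text \<open>Otherwise \<open>M\<close> is similar to a diagonal matrix with distinct entries, and
  the determinant is the square of a nonzero Vandermonde determinant.\<close>

lemma commutes_nilpotent_if_trace_gram_singular:
  fixes M :: "'a::alg_closed_field mat"
  assumes M: "M \<in> carrier_mat l l" and "det (trace_gram l M) = 0"
  shows "commutes_nilpotent l M"
proof (rule ccontr)
  assume "\<not> commutes_nilpotent l M"
  then obtain d where d: "inj_on d {..<l}" "similar_mat M (mat_diag l d)"
    using commutes_nilpotent_or_diagonalizable[OF M] by blast
  then obtain P Q where wit: "similar_mat_wit M (mat_diag l d) P Q"
    unfolding similar_mat_def by blast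
  let ?V = "mat l l (\<lambda>(k, i). d k ^ i)"
  have tr: "tr (M ^\<^sub>m k) = (\<Sum>i<l. d i ^ k)" for k
  proof -
    have "tr (M ^\<^sub>m k) = tr (mat_diag l (\<lambda>i. d i ^ k))"
      using tr_similar[OF similar_mat_wit_pow[OF wit, of k], of l] M by (simp add: mat_diag_pow)
    then show ?thesis by (simp add: tr_def mat_diag_def)
  qed
  have "trace_gram l M = ?V\<^sup>T * ?V"
    unfolding trace_gram_def
    by (intro eq_matI) (auto simp: tr scalar_prod_def power_add atLeast0LessThan)
  then have "det (trace_gram l M) = det ?V * det ?V"
    by (simp add: det_mult[of _ l] det_transpose[of _ l])
  then show False
    using assms(2) vandermonde_det_nonzero[OF d(1)] by simp
qed

lemma smult_pow_mat:
  fixes M :: "'a::field mat"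
  assumes "M \<in> carrier_mat l l"
  shows "(c \<cdot>\<^sub>m M) ^\<^sub>m k = c ^ k \<cdot>\<^sub>m (M ^\<^sub>m k)"
proof (induction k)
  case 0
  then show ?case using assms by (auto intro!: eq_matI)
next
  case (Suc k)
  have "M ^\<^sub>m k \<in> carrier_mat l l" using assms by simp
  then show ?case
    using Suc assms
    by (auto simp: mult_smult_distrib[of _ l l _ l] mult_smult_assoc_mat[of _ l l _ l] intro!: eq_matI)
qed

text \<open>The discriminant of \<open>x \<cdot>\<^sub>m B + y \<cdot>\<^sub>m C\<close> is a binary
  form of degree \<open>l * (l - 1)\<close> in \<open>x\<close> and \<open>y\<close>, so over an
  algebraically closed field it has a nontrivial zero.\<close>

lemma pencil_commutes_nilpotent:
  fixes B C :: "'a::alg_closed_field mat"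
  assumes B: "B \<in> carrier_mat l l" and C: "C \<in> carrier_mat l l" and "l \<ge> 2"
  obtains x y where "x \<noteq> 0 \<or> y \<noteq> 0" and "commutes_nilpotent l (x \<cdot>\<^sub>m B + y \<cdot>\<^sub>m C)"
proof -
  define f where "f x y = det (trace_gram l (x \<cdot>\<^sub>m B + y \<cdot>\<^sub>m C))" for x y
  have poly: "polyfn (\<lambda>t. det (trace_gram l (F t)))" if F: "polymat l l F" for F :: "'a \<Rightarrow> 'a mat"
  proof (rule polyfn_det[of l])
    have "polyfn (\<lambda>t. tr (F t ^\<^sub>m k))" for k
    proof -
      have "polyfn (\<lambda>t. \<Sum>i<l. (F t ^\<^sub>m k) $$ (i, i))"
        by (intro polyfn_sum polymat_index[OF polymat_pow[OF F]]) auto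
      moreover have "dim_row (F t) = l" for t
        using polymat_carrier[OF F, of t] by auto
      ultimately show ?thesis by (simp add: tr_def)
    qed
    then show "polymat l l (\<lambda>t. trace_gram l (F t))"
      unfolding trace_gram_def by (intro polymat_mat)
  qed
  have hom: "f (c * x) (c * y) = c ^ (2 * (\<Sum>i<l. i)) * f x y" for c x y
  proof -
    let ?M = "x \<cdot>\<^sub>m B + y \<cdot>\<^sub>m C"
    have M: "?M \<in> carrier_mat l l" using B C by simp
    have cM: "(c * x) \<cdot>\<^sub>m B + (c * y) \<cdot>\<^sub>m C = c \<cdot>\<^sub>m ?M"
      using B C by (auto intro!: eq_matI simp: algebra_simps)
    have tr_smult: "tr (a \<cdot>\<^sub>m A) = a * tr A" if "A \<in> carrier_mat l l" for a and A :: "'a mat"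
      using that by (simp add: tr_def sum_distrib_left)
    \<comment> \<open>The scalar \<open>c ^ (i + j)\<close> splits into a factor for row
      \<open>i\<close> and one for column \<open>j\<close>.\<close>
    have "trace_gram l (c \<cdot>\<^sub>m ?M) = mat l l (\<lambda>(i, j). c ^ i * c ^ j * tr (?M ^\<^sub>m (i + j)))"
      unfolding trace_gram_def
      by (intro cong_mat refl) (simp add: smult_pow_mat[OF M] tr_smult[OF pow_carrier_mat[OF M]] power_add)
    then have "f (c * x) (c * y) = (\<Prod>i<l. c ^ i) * (\<Prod>i<l. c ^ i) * f x y"
      unfolding f_def cM by (simp add: det_scale_rows_cols trace_gram_def)
    also have "(\<Prod>i<l. c ^ i) * (\<Prod>i<l. c ^ i) = c ^ (2 * (\<Sum>i<l. i))"
      by (simp add: power_sum mult_2 power_add)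
    finally show ?thesis .
  qed
  \<comment> \<open>This is where \<open>l \<ge> 2\<close> enters: the index 1 occurs in the sum, so
    the form has positive degree.\<close>
  have "1 \<le> (\<Sum>i<l. i)"
    using \<open>l \<ge> 2\<close> member_le_sum[of 1 "{..<l}" "\<lambda>i. i"] by simp
  then have d: "2 * (\<Sum>i<l. i) > 0" by simp
  have pr: "polyfn (\<lambda>r. f r 1)" and ps: "polyfn (\<lambda>s. f 1 s)"
    unfolding f_def using B C
    by (auto intro!: poly polymat_add polymat_smult polymat_const)
  show thesis
    using homogeneous_zero[OF hom d pr ps] that commutes_nilpotent_if_trace_gram_singular B C
    unfolding f_def by (metis add_carrier_mat smult_carrier_mat)
qed

section \<open>Sets of triples closed along lines\<close>

lemma zero_smult_mat: "A \<in> carrier_mat r c \<Longrightarrow> (0::'a::field) \<cdot>\<^sub>m A = 0\<^sub>m r c"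
  by (auto intro!: eq_matI)

lemma one_smult_mat [simp]: "(1::'a::field) \<cdot>\<^sub>m A = A"
  by (auto intro!: eq_matI)

lemma smult_smult_mat: "(a::'a::field) \<cdot>\<^sub>m (b \<cdot>\<^sub>m A) = (a * b) \<cdot>\<^sub>m A"
  by (auto intro!: eq_matI)

lemma commute_line:
  fixes A B X :: "'a::field mat"
  assumes "A \<in> carrier_mat n n" "B \<in> carrier_mat n n" "X \<in> carrier_mat n n"
    and "A * B = B * A" "A * X = X * A"
  shows "A * (B + t \<cdot>\<^sub>m X) = (B + t \<cdot>\<^sub>m X) * A"
  using assms by (simp add: add_mult_distrib_mat[of _ n n _ _ n] mult_add_distrib_mat[of _ n n _ n]
      mult_smult_distrib[of _ n n _ n] mult_smult_assoc_mat[of _ n n _ n])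

lemma square_line:
  fixes C X :: "'a::field mat"
  assumes C: "C \<in> carrier_mat n n" and X: "X \<in> carrier_mat n n" and CC: "C * C = 0\<^sub>m n n"
  shows "(C + t \<cdot>\<^sub>m X) * (C + t \<cdot>\<^sub>m X) = t \<cdot>\<^sub>m ((C * X + X * C) + t \<cdot>\<^sub>m (X * X))"
proof -
  have "(C + t \<cdot>\<^sub>m X) * (C + t \<cdot>\<^sub>m X) = (C * C + t \<cdot>\<^sub>m (X * C)) + t \<cdot>\<^sub>m (C * X + t \<cdot>\<^sub>m (X * X))"
    using C X by (simp add: add_mult_distrib_mat[of _ n n _ _ n] mult_add_distrib_mat[of _ n n _ n]
        mult_smult_distrib[of _ n n _ n] mult_smult_assoc_mat[of _ n n _ n])
  moreover have "(0\<^sub>m n n + t \<cdot>\<^sub>m V) + t \<cdot>\<^sub>m (U + t \<cdot>\<^sub>m W) = t \<cdot>\<^sub>m ((U + V) + t \<cdot>\<^sub>m W)"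
    if "U \<in> carrier_mat n n" "V \<in> carrier_mat n n" "W \<in> carrier_mat n n" for U V W :: "'a mat"
    using that by (intro eq_matI) (auto simp: algebra_simps)
  ultimately show ?thesis
    using CC C X by (metis mult_carrier_mat)
qed

section \<open>Nilpotency of deformed matrices\<close>

lemma nilpotent_mat_iff:
  "A \<in> carrier_mat n n \<Longrightarrow> nilpotent_mat A \<longleftrightarrow> (\<exists>k. A ^\<^sub>m k = 0\<^sub>m n n)"
  by (auto simp: nilpotent_mat_def)

text \<open>The deformations are built to have a nonzero square; nilpotency is then checked on the
  square of that square.\<close>

lemma nilpotent_matI:
  assumes "A \<in> carrier_mat n n" and "(A * A) * (A * A) = 0\<^sub>m n n"
  shows "nilpotent_mat A"
proof -
  have "A ^\<^sub>m 4 = (A * A) * (A * A)"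
    using assms(1) by (simp add: numeral_eq_Suc assoc_mult_mat[of _ n n _ n _ n])
  then show ?thesis using assms nilpotent_mat_iff by metis
qed

lemma mult_pow_mat_commute:
  assumes "A \<in> carrier_mat n n" "B \<in> carrier_mat n n" "A * B = B * A"
  shows "A * B ^\<^sub>m k = B ^\<^sub>m k * A"
proof (induction k)
  case (Suc k)
  have "A * (B ^\<^sub>m k * B) = A * B ^\<^sub>m k * B"
    using assms by (simp add: assoc_mult_mat[of _ n n _ n _ n])
  also have "\<dots> = B ^\<^sub>m k * (A * B)"
    using assms Suc by (simp add: assoc_mult_mat[of _ n n _ n _ n])
  also have "\<dots> = B ^\<^sub>m k * B * A"
    using assms by (simp add: assoc_mult_mat[of _ n n _ n _ n])
  finally show ?case by simp
qed (use assms in simp)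

text \<open>Instead of expanding a power of the sum, one shows by downward induction on the
  exponents that some power of \<open>A + B\<close> annihilates
  \<open>A ^\<^sub>m i * B ^\<^sub>m j\<close>: multiplying by \<open>A + B\<close> once gives two
  such monomials of higher exponent. The case \<open>i = j = 0\<close> is the claim.\<close>

lemma nilpotent_mat_add:
  assumes A: "A \<in> carrier_mat n n" and B: "B \<in> carrier_mat n n" and AB: "A * B = B * A"
    and "nilpotent_mat A" "nilpotent_mat B"
  shows "nilpotent_mat (A + B)"
proof -
  obtain p q where p: "A ^\<^sub>m p = 0\<^sub>m n n" and q: "B ^\<^sub>m q = 0\<^sub>m n n"
    using assms nilpotent_mat_iff by metis
  note assoc = assoc_mult_mat[of _ n n _ n _ n]
  let ?S = "A + B"
  have S: "?S \<in> carrier_mat n n" using A B by simp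
  \<comment> \<open>An annihilating power may be enlarged, so the exponents \<open>k1\<close> and
    \<open>k2\<close> of the two monomials can be replaced by \<open>k1 + k2\<close>.\<close>
  have pow_le: "?S ^\<^sub>m (j + k) * X = 0\<^sub>m n n" if "?S ^\<^sub>m k * X = 0\<^sub>m n n" "X \<in> carrier_mat n n" for j k X
  proof (induction j)
    case (Suc j)
    have "?S ^\<^sub>m Suc (j + k) * X = (?S * ?S ^\<^sub>m (j + k)) * X"
      unfolding mult_pow_mat_commute[OF S S refl] by simp
    also have "\<dots> = ?S * (?S ^\<^sub>m (j + k) * X)"
      using assoc_mult_mat[OF S pow_carrier_mat[OF S] that(2)] .
    finally have "?S ^\<^sub>m Suc (j + k) * X = ?S * (?S ^\<^sub>m (j + k) * X)" .
    then show ?case using Suc right_mult_zero_mat[OF S, of n] by simp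
  qed (use that in simp)
  have "\<exists>k. ?S ^\<^sub>m k * (A ^\<^sub>m i * B ^\<^sub>m j) = 0\<^sub>m n n"
    if "i \<le> p" "j \<le> q" for i j
    using that
  proof (induction "(p - i) + (q - j)" arbitrary: i j rule: less_induct)
    case less
    consider "i = p" | "j = q" | "i < p" "j < q" using less.prems by linarith
    then show ?case
    proof cases
      case 1
      then show ?thesis using p A B S by (intro exI[of _ 0]) simp
    next
      case 2
      then show ?thesis using q A B S by (intro exI[of _ 0]) simp
    next
      case 3
      have lt: "(p - Suc i) + (q - j) < (p - i) + (q - j)" "(p - i) + (q - Suc j) < (p - i) + (q - j)"
        using 3 by linarith+
      obtain k1 where k1: "?S ^\<^sub>m k1 * (A ^\<^sub>m Suc i * B ^\<^sub>m j) = 0\<^sub>m n n"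
        using less.hyps[OF lt(1)] 3 by (auto simp del: pow_mat.simps)
      obtain k2 where k2: "?S ^\<^sub>m k2 * (A ^\<^sub>m i * B ^\<^sub>m Suc j) = 0\<^sub>m n n"
        using less.hyps[OF lt(2)] 3 by (auto simp del: pow_mat.simps)
      let ?k = "k1 + k2" and ?X = "A ^\<^sub>m Suc i * B ^\<^sub>m j" and ?Y = "A ^\<^sub>m i * B ^\<^sub>m Suc j"
      have X: "?X \<in> carrier_mat n n" and Y: "?Y \<in> carrier_mat n n" using A B by auto
      have "A * (A ^\<^sub>m i * B ^\<^sub>m j) = ?X"
        using mult_pow_mat_commute[OF A A refl, of i] A B assoc_mult_mat[OF A pow_carrier_mat[OF A, of i] pow_carrier_mat[OF B, of j]]
        by simp
      moreover have "B * (A ^\<^sub>m i * B ^\<^sub>m j) = ?Y"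
      proof -
        have "B * (A ^\<^sub>m i * B ^\<^sub>m j) = (B * A ^\<^sub>m i) * B ^\<^sub>m j"
          using assoc_mult_mat[OF B pow_carrier_mat[OF A, of i] pow_carrier_mat[OF B, of j]] by simp
        also have "\<dots> = A ^\<^sub>m i * (B * B ^\<^sub>m j)"
          unfolding mult_pow_mat_commute[OF B A AB[symmetric], of i]
          using assoc_mult_mat[OF pow_carrier_mat[OF A, of i] B pow_carrier_mat[OF B, of j]] by simp
        finally show ?thesis
          unfolding mult_pow_mat_commute[OF B B refl, of j] by simp
      qed
      ultimately have SX: "?S * (A ^\<^sub>m i * B ^\<^sub>m j) = ?X + ?Y"
        using add_mult_distrib_mat[OF A B mult_carrier_mat[OF pow_carrier_mat[OF A, of i] pow_carrier_mat[OF B, of j]]]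
        by simp
      have "?S ^\<^sub>m Suc ?k * (A ^\<^sub>m i * B ^\<^sub>m j) = ?S ^\<^sub>m ?k * (?S * (A ^\<^sub>m i * B ^\<^sub>m j))"
        using assoc[OF pow_carrier_mat[OF S, of ?k] S mult_carrier_mat[OF pow_carrier_mat[OF A, of i] pow_carrier_mat[OF B, of j]]]
        by simp
      also have "\<dots> = ?S ^\<^sub>m ?k * (?X + ?Y)"
        unfolding SX ..
      also have "\<dots> = ?S ^\<^sub>m ?k * ?X + ?S ^\<^sub>m ?k * ?Y"
        by (rule mult_add_distrib_mat[OF pow_carrier_mat[OF S] X Y])
      also have "\<dots> = 0\<^sub>m n n"
        using pow_le[OF k1 X, of k2] pow_le[OF k2 Y, of k1] by (simp add: add.commute)
      finally show ?thesis by blast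
    qed
  qed
  from this[of 0 0] obtain k where "?S ^\<^sub>m k * (A ^\<^sub>m 0 * B ^\<^sub>m 0) = 0\<^sub>m n n" by auto
  then have "?S ^\<^sub>m k = 0\<^sub>m n n" using A B S by simp
  then show ?thesis using S nilpotent_mat_iff by blast
qed

lemma nilpotent_mat_smult:
  fixes A :: "'a::field mat"
  assumes "A \<in> carrier_mat n n" "nilpotent_mat A"
  shows "nilpotent_mat (c \<cdot>\<^sub>m A)"
proof -
  obtain k where "A ^\<^sub>m k = 0\<^sub>m n n" using assms nilpotent_mat_iff by blast
  then have "(c \<cdot>\<^sub>m A) ^\<^sub>m k = 0\<^sub>m n n"
    using smult_pow_mat[OF assms(1), of c k] by simp
  then show ?thesis using assms nilpotent_mat_iff[of "c \<cdot>\<^sub>m A" n] by auto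
qed

lemma N3_iff:
  "(A, B, C) \<in> N3 n \<longleftrightarrow> A \<in> carrier_mat n n \<and> B \<in> carrier_mat n n \<and> C \<in> carrier_mat n n \<and>
     nilpotent_mat A \<and> nilpotent_mat B \<and> nilpotent_mat C \<and>
     A * B = B * A \<and> A * C = C * A \<and> B * C = C * B"
  by (auto simp: N3_def mat_triples_def)

text \<open>The assumption of the theorem on a member of the span, phrased with lower bounds only: a
  rank above \<open>l\<close> in the second alternative is covered by the first.\<close>

definition good_mat :: "nat \<Rightarrow> nat \<Rightarrow> 'a::field mat \<Rightarrow> bool" where
  "good_mat n l M \<longleftrightarrow> rank_ge n (Suc l) M \<or> rank_ge n l M \<and> M * M \<noteq> 0\<^sub>m n n"

text \<open>Abstracts the closure of \<open>R3 n\<close>: it contains every triple with a good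
  matrix in its span, and it contains the base point of a line as soon as it contains infinitely
  many points of the line.\<close>

definition admissible :: "nat \<Rightarrow> nat \<Rightarrow> 'a::field mat_triple set \<Rightarrow> bool" where
  "admissible n l K \<longleftrightarrow>
     (\<forall>T\<in>N3 n. (\<exists>M\<in>triple_span T. good_mat n l M) \<longrightarrow> T \<in> K) \<and>
     (\<forall>A\<in>carrier_mat n n. \<forall>B\<in>carrier_mat n n. \<forall>C\<in>carrier_mat n n.
      \<forall>X\<in>carrier_mat n n. \<forall>Y\<in>carrier_mat n n. \<forall>Z\<in>carrier_mat n n.
       infinite {t. (A + t \<cdot>\<^sub>m X, B + t \<cdot>\<^sub>m Y, C + t \<cdot>\<^sub>m Z) \<in> K} \<longrightarrow> (A, B, C) \<in> K)"

lemma admissible_good: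
  "admissible n l K \<Longrightarrow> T \<in> N3 n \<Longrightarrow> M \<in> triple_span T \<Longrightarrow> good_mat n l M \<Longrightarrow> T \<in> K"
  unfolding admissible_def by blast

lemma admissible_line:
  assumes "admissible n l K" "A \<in> carrier_mat n n" "B \<in> carrier_mat n n" "C \<in> carrier_mat n n"
    "X \<in> carrier_mat n n" "Y \<in> carrier_mat n n" "Z \<in> carrier_mat n n"
    and "infinite {t. (A + t \<cdot>\<^sub>m X, B + t \<cdot>\<^sub>m Y, C + t \<cdot>\<^sub>m Z) \<in> K}"
  shows "(A, B, C) \<in> K"
  using assms unfolding admissible_def by blast

lemma in_triple_span: "a \<cdot>\<^sub>m A + b \<cdot>\<^sub>m B + c \<cdot>\<^sub>m C \<in> triple_span (A, B, C)"
  unfolding triple_span_def by auto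

lemma triple_span_members:
  fixes A B C :: "'a::field mat"
  assumes "A \<in> carrier_mat n n" "B \<in> carrier_mat n n" "C \<in> carrier_mat n n"
  shows "A \<in> triple_span (A, B, C)" "B \<in> triple_span (A, B, C)" "C \<in> triple_span (A, B, C)"
  using assms in_triple_span[of 1 A 0 B 0 C] in_triple_span[of 0 A 1 B 0 C] in_triple_span[of 0 A 0 B 1 C]
  by (simp_all add: zero_smult_mat[of _ n n])

lemma triple_span_add_smult:
  fixes A B C :: "'a::field mat"
  assumes "A \<in> carrier_mat n n" "B \<in> carrier_mat n n" "C \<in> carrier_mat n n"
    and "M1 \<in> triple_span (A, B, C)" "M2 \<in> triple_span (A, B, C)"
  shows "M1 + y \<cdot>\<^sub>m M2 \<in> triple_span (A, B, C)"
proof -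
  obtain a b c where M1: "M1 = a \<cdot>\<^sub>m A + b \<cdot>\<^sub>m B + c \<cdot>\<^sub>m C"
    using assms(4) unfolding triple_span_def by auto
  obtain a' b' c' where M2: "M2 = a' \<cdot>\<^sub>m A + b' \<cdot>\<^sub>m B + c' \<cdot>\<^sub>m C"
    using assms(5) unfolding triple_span_def by auto
  have "M1 + y \<cdot>\<^sub>m M2 = (a + y * a') \<cdot>\<^sub>m A + (b + y * b') \<cdot>\<^sub>m B + (c + y * c') \<cdot>\<^sub>m C"
    unfolding M1 M2 using assms by (auto intro!: eq_matI simp: algebra_simps)
  then show ?thesis using in_triple_span by metis
qed

lemma triple_span_carrier:
  "A \<in> carrier_mat n n \<Longrightarrow> B \<in> carrier_mat n n \<Longrightarrow> C \<in> carrier_mat n n \<Longrightarrow>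
   M \<in> triple_span (A, B, C) \<Longrightarrow> M \<in> carrier_mat n n"
  unfolding triple_span_def by auto

text \<open>A generic member of the pencil of \<open>M1\<close> and \<open>M2\<close> has both
  properties, each of which fails for finitely many members only.\<close>

lemma admissible_square:
  fixes A B C :: "'a::alg_closed_field mat"
  assumes adm: "admissible n l K" and T: "(A, B, C) \<in> N3 n"
    and M1: "M1 \<in> triple_span (A, B, C)" "rank_ge n l M1"
    and M2: "M2 \<in> triple_span (A, B, C)" "M2 * M2 \<noteq> 0\<^sub>m n n"
  shows "(A, B, C) \<in> K"
proof -
  have c: "A \<in> carrier_mat n n" "B \<in> carrier_mat n n" "C \<in> carrier_mat n n"
    using T by (auto simp: N3_iff)
  have M1c: "M1 \<in> carrier_mat n n" and M2c: "M2 \<in> carrier_mat n n"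
    using triple_span_carrier c M1 M2 by blast+
  obtain P Q where P: "P \<in> carrier_mat l n" and Q: "Q \<in> carrier_mat n l" and det: "det (P * M1 * Q) \<noteq> 0"
    using M1(2) unfolding rank_ge_def by blast
  have "polyfn (\<lambda>y. det (P * (M1 + y \<cdot>\<^sub>m M2) * Q))"
    by (rule polyfn_det[OF polymat_mult[OF polymat_mult[OF polymat_const[OF P] polymat_line[OF M1c M2c]]
          polymat_const[OF Q]]])
  moreover have "det (P * (M1 + 0 \<cdot>\<^sub>m M2) * Q) \<noteq> 0"
    using det M1c M2c by (simp add: zero_smult_mat[of _ n n])
  ultimately have fin1: "finite {y. det (P * (M1 + y \<cdot>\<^sub>m M2) * Q) = 0}"
    by (rule finite_zeros_polyfn)
  have "polymat n n (\<lambda>z. (M2 + z \<cdot>\<^sub>m M1) * (M2 + z \<cdot>\<^sub>m M1))"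
    by (rule polymat_mult[OF polymat_line[OF M2c M1c] polymat_line[OF M2c M1c]])
  moreover have "(M2 + 0 \<cdot>\<^sub>m M1) * (M2 + 0 \<cdot>\<^sub>m M1) \<noteq> 0\<^sub>m n n"
    using M2 M1c M2c by (simp add: zero_smult_mat[of _ n n])
  ultimately have fin2: "finite {z. (M2 + z \<cdot>\<^sub>m M1) * (M2 + z \<cdot>\<^sub>m M1) = 0\<^sub>m n n}"
    by (rule polymat_nonzero_finite)
  define S1 where "S1 = {y. det (P * (M1 + y \<cdot>\<^sub>m M2) * Q) = 0}"
  define S2 where "S2 = {z. (M2 + z \<cdot>\<^sub>m M1) * (M2 + z \<cdot>\<^sub>m M1) = 0\<^sub>m n n}"
  have "finite ({0} \<union> S1 \<union> inverse ` S2)"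
    using fin1 fin2 by (simp add: S1_def S2_def)
  then obtain y where y: "y \<notin> {0} \<union> S1 \<union> inverse ` S2"
    using ex_new_if_finite[OF infinite_UNIV_alg_closed, of "{0} \<union> S1 \<union> inverse ` S2"] by metis
  then have "y \<noteq> 0" "y \<notin> S1" by auto
  let ?M = "M1 + y \<cdot>\<^sub>m M2" and ?M' = "M2 + inverse y \<cdot>\<^sub>m M1"
  have "inverse y \<notin> S2"
    using y imageI[of "inverse y" S2 inverse] by auto
  then have sq': "?M' * ?M' \<noteq> 0\<^sub>m n n" by (simp add: S2_def)
  have "?M' = inverse y \<cdot>\<^sub>m ?M"
    using \<open>y \<noteq> 0\<close> M1c M2c by (intro eq_matI) (auto simp: field_simps)
  moreover have "?M \<in> carrier_mat n n" using M1c M2c by simp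
  ultimately have "?M' * ?M' = (inverse y * inverse y) \<cdot>\<^sub>m (?M * ?M)"
    by (simp add: mult_smult_distrib[of _ n n _ n] mult_smult_assoc_mat[of _ n n _ n] smult_smult_mat)
  then have "?M * ?M \<noteq> 0\<^sub>m n n" using sq' by (metis smult_zero_mat)
  moreover have "rank_ge n l ?M"
    using \<open>y \<notin> S1\<close> P Q unfolding rank_ge_def S1_def by blast
  ultimately have "good_mat n l ?M" by (simp add: good_mat_def)
  then show ?thesis
    using admissible_good[OF adm T triple_span_add_smult[OF c M1(1) M2(1)]] by blast
qed

text \<open>\<open>A\<close> and \<open>B\<close> stay fixed, so the rank certificate persists along
  the line. If \<open>C\<close> has square zero, the square of
  \<open>C + t \<cdot>\<^sub>m X\<close> is \<open>t\<close> times a polynomial in \<open>t\<close>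
  with the coefficients named in \<open>nz\<close>, hence nonzero for almost all
  \<open>t\<close>.\<close>

lemma deform_third:
  fixes A B C :: "'a::alg_closed_field mat"
  assumes adm: "admissible n l K" and T: "(A, B, C) \<in> N3 n" and rk: "rank_ge n l A"
    and X: "X \<in> carrier_mat n n" and AX: "A * X = X * A" and BX: "B * X = X * B"
    and nil: "\<And>t. nilpotent_mat (C + t \<cdot>\<^sub>m X)"
    and nz: "C * X + X * C \<noteq> 0\<^sub>m n n \<or> X * X \<noteq> 0\<^sub>m n n"
  shows "(A, B, C) \<in> K"
proof (cases "C * C = 0\<^sub>m n n")
  case False
  then show ?thesis
    using admissible_square[OF adm T _ rk, of C] T triple_span_members[of A n B C] by (auto simp: N3_iff)
next
  case True
  have c: "A \<in> carrier_mat n n" "B \<in> carrier_mat n n" "C \<in> carrier_mat n n"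
    using T by (auto simp: N3_iff)
  define F where "F t = (C * X + X * C) + t \<cdot>\<^sub>m (X * X)" for t
  have "polymat n n F"
    unfolding F_def by (intro polymat_line) (use c X in auto)
  moreover have "\<exists>t. F t \<noteq> 0\<^sub>m n n"
  proof (cases "C * X + X * C = 0\<^sub>m n n")
    case True
    then have "F 1 = X * X" using X by (simp add: F_def left_add_zero_mat[of _ n n])
    then show ?thesis using nz True by metis
  next
    case False
    have "F 0 = C * X + X * C" using X c by (auto simp: F_def intro!: eq_matI)
    then show ?thesis using False by metis
  qed
  ultimately have fin: "finite {t. F t = 0\<^sub>m n n}"
    using polymat_nonzero_finite by blast
  have sq: "(C + t \<cdot>\<^sub>m X) * (C + t \<cdot>\<^sub>m X) = t \<cdot>\<^sub>m F t" for t
    unfolding F_def using square_line[OF c(3) X True] .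
  have "(A, B, C + t \<cdot>\<^sub>m X) \<in> K" if "t \<noteq> 0" "F t \<noteq> 0\<^sub>m n n" for t
  proof -
    have "t \<cdot>\<^sub>m F t \<noteq> 0\<^sub>m n n"
    proof
      assume 0: "t \<cdot>\<^sub>m F t = 0\<^sub>m n n"
      have "F t = inverse t \<cdot>\<^sub>m (t \<cdot>\<^sub>m F t)" using that(1) by (auto intro!: eq_matI)
      then show False using that(2) 0 by simp
    qed
    then have "(C + t \<cdot>\<^sub>m X) * (C + t \<cdot>\<^sub>m X) \<noteq> 0\<^sub>m n n" using sq by metis
    moreover have N: "(A, B, C + t \<cdot>\<^sub>m X) \<in> N3 n"
      using T X AX BX nil commute_line[of A n C X t] commute_line[of B n C X t] unfolding N3_iff by simp
    ultimately show ?thesis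
      using admissible_square[OF adm N _ rk, of "C + t \<cdot>\<^sub>m X"] triple_span_members[of A n B "C + t \<cdot>\<^sub>m X"] c X by auto
  qed
  moreover have "A + t \<cdot>\<^sub>m 0\<^sub>m n n = A" "B + t \<cdot>\<^sub>m 0\<^sub>m n n = B" for t
    using c by auto
  ultimately have "infinite {t. (A + t \<cdot>\<^sub>m 0\<^sub>m n n, B + t \<cdot>\<^sub>m 0\<^sub>m n n, C + t \<cdot>\<^sub>m X) \<in> K}"
    using fin by (intro infinite_cofinite_alg_closed[of "{0} \<union> {t. F t = 0\<^sub>m n n}"]) auto
  then show ?thesis
    using admissible_line[OF adm c, of "0\<^sub>m n n" "0\<^sub>m n n" X] X by simp
qed

subsection \<open>Linear substitutions\<close>

lemma N3_swap: "(A, B, C) \<in> N3 n \<Longrightarrow> (A, C, B) \<in> N3 n"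
  by (auto simp: N3_iff)

lemma N3_shear:
  fixes A B C :: "'a::field mat"
  assumes "(A, B, C) \<in> N3 n"
  shows "(A, B, C + z \<cdot>\<^sub>m B) \<in> N3 n"
proof -
  have c: "A \<in> carrier_mat n n" "B \<in> carrier_mat n n" "C \<in> carrier_mat n n"
    and com: "A * B = B * A" "A * C = C * A" "B * C = C * B"
    and nil: "nilpotent_mat B" "nilpotent_mat C"
    using assms by (auto simp: N3_iff)
  have "C * (z \<cdot>\<^sub>m B) = (z \<cdot>\<^sub>m B) * C"
    using c com by (simp add: mult_smult_distrib[of _ n n _ n] mult_smult_assoc_mat[of _ n n _ n])
  then have "nilpotent_mat (C + z \<cdot>\<^sub>m B)"
    using c nil by (intro nilpotent_mat_add[of _ n] nilpotent_mat_smult[of _ n]) auto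
  then show ?thesis
    using assms commute_line[OF c(1) c(3) c(2) com(2,1)] commute_line[OF c(2) c(3) c(2) com(3) refl]
    unfolding N3_iff by simp
qed

text \<open>Passing to a preimage of \<open>K\<close> makes a lemma proved for every admissible set
  applicable to the substituted triple. This lemma and its analogues for shears, similarities and
  reflections carry all reductions without loss of generality.\<close>

lemma admissible_swap:
  assumes "admissible n l K"
  shows "admissible n l {(A, B, C). (A, C, B) \<in> K}"
  unfolding admissible_def
proof (intro conjI ballI impI)
  fix T :: "'a mat_triple"
  assume "T \<in> N3 n" and "\<exists>M\<in>triple_span T. good_mat n l M"
  moreover obtain A B C where T: "T = (A, B, C)" by (cases T)
  moreover have "M \<in> triple_span (A, C, B)"
    if "A \<in> carrier_mat n n" "B \<in> carrier_mat n n" "C \<in> carrier_mat n n" and MT: "M \<in> triple_span (A, B, C)" for M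
  proof -
    obtain a b c where M: "M = a \<cdot>\<^sub>m A + b \<cdot>\<^sub>m B + c \<cdot>\<^sub>m C"
      using MT unfolding triple_span_def by auto
    have "M = a \<cdot>\<^sub>m A + c \<cdot>\<^sub>m C + b \<cdot>\<^sub>m B"
      unfolding M using that by (auto intro!: eq_matI)
    then show ?thesis using in_triple_span by metis
  qed
  moreover have "(A, C, B) \<in> N3 n" using calculation by (auto simp: N3_iff)
  ultimately have "(A, C, B) \<in> K"
    using admissible_good[OF assms, of "(A, C, B)"] by (auto simp: N3_iff)
  then show "T \<in> {(A, B, C). (A, C, B) \<in> K}" using T by simp
next
  fix A B C X Y Z :: "'a mat"
  assume "A \<in> carrier_mat n n" "B \<in> carrier_mat n n" "C \<in> carrier_mat n n"
    "X \<in> carrier_mat n n" "Y \<in> carrier_mat n n" "Z \<in> carrier_mat n n"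
    "infinite {t. (A + t \<cdot>\<^sub>m X, B + t \<cdot>\<^sub>m Y, C + t \<cdot>\<^sub>m Z) \<in> {(A, B, C). (A, C, B) \<in> K}}"
  then show "(A, B, C) \<in> {(A, B, C). (A, C, B) \<in> K}"
    using admissible_line[OF assms, of A C B X Z Y] by auto
qed

lemma admissible_shear:
  fixes K :: "'a::field mat_triple set"
  assumes "admissible n l K"
  shows "admissible n l {(A, B, C). (A, B, C + z \<cdot>\<^sub>m B) \<in> K}"
  unfolding admissible_def
proof (intro conjI ballI impI)
  fix T :: "'a mat_triple"
  assume "T \<in> N3 n" and ex: "\<exists>M\<in>triple_span T. good_mat n l M"
  moreover obtain A B C where T: "T = (A, B, C)" by (cases T)
  ultimately have N: "(A, B, C) \<in> N3 n" by simp
  have sp: "M \<in> triple_span (A, B, C + z \<cdot>\<^sub>m B)" if MT: "M \<in> triple_span (A, B, C)" for M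
  proof -
    obtain a b c where M: "M = a \<cdot>\<^sub>m A + b \<cdot>\<^sub>m B + c \<cdot>\<^sub>m C"
      using MT unfolding triple_span_def by auto
    have "M = a \<cdot>\<^sub>m A + (b - c * z) \<cdot>\<^sub>m B + c \<cdot>\<^sub>m (C + z \<cdot>\<^sub>m B)"
      unfolding M using N by (auto intro!: eq_matI simp: algebra_simps N3_iff)
    then show ?thesis using in_triple_span by metis
  qed
  have "(A, B, C + z \<cdot>\<^sub>m B) \<in> N3 n" by (rule N3_shear[OF N])
  then have "(A, B, C + z \<cdot>\<^sub>m B) \<in> K"
    using admissible_good[OF assms, of "(A, B, C + z \<cdot>\<^sub>m B)"] ex sp T by auto
  then show "T \<in> {(A, B, C). (A, B, C + z \<cdot>\<^sub>m B) \<in> K}" using T by simp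
next
  fix A B C X Y Z :: "'a mat"
  assume c: "A \<in> carrier_mat n n" "B \<in> carrier_mat n n" "C \<in> carrier_mat n n"
    "X \<in> carrier_mat n n" "Y \<in> carrier_mat n n" "Z \<in> carrier_mat n n"
    and inf: "infinite {t. (A + t \<cdot>\<^sub>m X, B + t \<cdot>\<^sub>m Y, C + t \<cdot>\<^sub>m Z) \<in> {(A, B, C). (A, B, C + z \<cdot>\<^sub>m B) \<in> K}}"
  have "(C + t \<cdot>\<^sub>m Z) + z \<cdot>\<^sub>m (B + t \<cdot>\<^sub>m Y) = (C + z \<cdot>\<^sub>m B) + t \<cdot>\<^sub>m (Z + z \<cdot>\<^sub>m Y)" for t
    using c by (auto intro!: eq_matI simp: algebra_simps)
  then show "(A, B, C) \<in> {(A, B, C). (A, B, C + z \<cdot>\<^sub>m B) \<in> K}"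
    using admissible_line[OF assms, of A B "C + z \<cdot>\<^sub>m B" X Y "Z + z \<cdot>\<^sub>m Y"] c inf by auto
qed

text \<open>Serves conjugation and reflection alike. The latter reverses products, so only squares
  are mentioned; \<open>sq\<close> is the contrapositive of what is needed, namely that nonzero
  squares stay nonzero.\<close>

lemma admissible_vimage:
  fixes K :: "'a::field mat_triple set" and \<psi> :: "'a mat \<Rightarrow> 'a mat"
  assumes adm: "admissible n l K"
    and carr: "\<And>M. M \<in> carrier_mat n n \<Longrightarrow> \<psi> M \<in> carrier_mat n n"
    and add: "\<And>M N. M \<in> carrier_mat n n \<Longrightarrow> N \<in> carrier_mat n n \<Longrightarrow> \<psi> (M + N) = \<psi> M + \<psi> N"
    and smult: "\<And>a M. M \<in> carrier_mat n n \<Longrightarrow> \<psi> (a \<cdot>\<^sub>m M) = a \<cdot>\<^sub>m \<psi> M"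
    and N3: "\<And>A B C. (A, B, C) \<in> N3 n \<Longrightarrow> (\<psi> A, \<psi> B, \<psi> C) \<in> N3 n"
    and sq: "\<And>M. M \<in> carrier_mat n n \<Longrightarrow> \<psi> M * \<psi> M = 0\<^sub>m n n \<Longrightarrow> M * M = 0\<^sub>m n n"
    and rk: "\<And>k M. M \<in> carrier_mat n n \<Longrightarrow> rank_ge n k M \<Longrightarrow> rank_ge n k (\<psi> M)"
  shows "admissible n l {(A, B, C). (\<psi> A, \<psi> B, \<psi> C) \<in> K}"
  unfolding admissible_def
proof (intro conjI ballI impI)
  fix T :: "'a mat_triple"
  assume "T \<in> N3 n" and "\<exists>M\<in>triple_span T. good_mat n l M"
  moreover obtain A B C where T: "T = (A, B, C)" by (cases T)
  ultimately obtain M where N: "(A, B, C) \<in> N3 n" and M: "M \<in> triple_span (A, B, C)" "good_mat n l M" by auto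
  have c: "A \<in> carrier_mat n n" "B \<in> carrier_mat n n" "C \<in> carrier_mat n n" using N by (auto simp: N3_iff)
  have Mc: "M \<in> carrier_mat n n" using triple_span_carrier[OF c M(1)] .
  obtain x y z where "M = x \<cdot>\<^sub>m A + y \<cdot>\<^sub>m B + z \<cdot>\<^sub>m C"
    using M unfolding triple_span_def by auto
  then have "\<psi> M = x \<cdot>\<^sub>m \<psi> A + y \<cdot>\<^sub>m \<psi> B + z \<cdot>\<^sub>m \<psi> C"
    using c by (simp add: add smult)
  then have "\<psi> M \<in> triple_span (\<psi> A, \<psi> B, \<psi> C)"
    using in_triple_span by metis
  moreover have "good_mat n l (\<psi> M)"
    using M(2) rk[OF Mc] sq[OF Mc] unfolding good_mat_def by blast
  moreover have "(\<psi> A, \<psi> B, \<psi> C) \<in> N3 n"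
    by (rule N3[OF N])
  ultimately show "T \<in> {(A, B, C). (\<psi> A, \<psi> B, \<psi> C) \<in> K}"
    using admissible_good[OF adm] T by blast
next
  fix A B C X Y Z :: "'a mat"
  assume c: "A \<in> carrier_mat n n" "B \<in> carrier_mat n n" "C \<in> carrier_mat n n"
    "X \<in> carrier_mat n n" "Y \<in> carrier_mat n n" "Z \<in> carrier_mat n n"
    "infinite {t. (A + t \<cdot>\<^sub>m X, B + t \<cdot>\<^sub>m Y, C + t \<cdot>\<^sub>m Z) \<in> {(A, B, C). (\<psi> A, \<psi> B, \<psi> C) \<in> K}}"
  then show "(A, B, C) \<in> {(A, B, C). (\<psi> A, \<psi> B, \<psi> C) \<in> K}"
    using admissible_line[OF adm, of "\<psi> A" "\<psi> B" "\<psi> C" "\<psi> X" "\<psi> Y" "\<psi> Z"] by (simp add: carr add smult)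
qed

text \<open>If \<open>U\<close> and \<open>V\<close> certify the rank of \<open>M\<close>, then
  \<open>U * Q\<close> and \<open>P * V\<close> certify that of the conjugate.\<close>

lemma rank_ge_similar:
  assumes P: "P \<in> carrier_mat n n" and Q: "Q \<in> carrier_mat n n" and QP: "Q * P = 1\<^sub>m n"
    and M: "M \<in> carrier_mat n n" and "rank_ge n k M"
  shows "rank_ge n k (P * M * Q)"
proof -
  obtain U V where U: "U \<in> carrier_mat k n" and V: "V \<in> carrier_mat n k" and det: "det (U * M * V) \<noteq> 0"
    using assms(5) unfolding rank_ge_def by blast
  have "Q * (P * M * Q) = (Q * P) * (M * Q)"
    using P Q M by (simp add: assoc_mult_mat[of _ n n _ n _ n])
  also have "\<dots> = M * Q" unfolding QP using M Q by simp
  finally have 1: "(U * Q) * (P * M * Q) = U * (M * Q)"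
    unfolding assoc_mult_mat[OF U Q mult_carrier_mat[OF mult_carrier_mat[OF P M] Q]] by simp
  have "Q * (P * V) = (Q * P) * V"
    using assoc_mult_mat[OF Q P V] by simp
  also have "\<dots> = V" unfolding QP using V by simp
  finally have "Q * (P * V) = V" .
  then have "(M * Q) * (P * V) = M * V"
    using assoc_mult_mat[OF M Q, of "P * V" k] P V by simp
  then have "(U * Q) * (P * M * Q) * (P * V) = U * M * V"
    unfolding 1 using assoc_mult_mat[OF U, of "M * Q" n "P * V" k] assoc_mult_mat[OF U M V] M Q P V by simp
  then have "det ((U * Q) * (P * M * Q) * (P * V)) \<noteq> 0"
    using det by simp
  then show ?thesis
    unfolding rank_ge_def using U V P Q by (intro bexI[of _ "U * Q"] bexI[of _ "P * V"]) auto
qed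

lemma N3_similar:
  fixes A B C :: "'a::field mat"
  assumes "(A, B, C) \<in> N3 n" and P: "P \<in> carrier_mat n n" and Q: "Q \<in> carrier_mat n n"
    and PQ: "P * Q = 1\<^sub>m n" and QP: "Q * P = 1\<^sub>m n"
  shows "(P * A * Q, P * B * Q, P * C * Q) \<in> N3 n"
proof -
  have c: "A \<in> carrier_mat n n" "B \<in> carrier_mat n n" "C \<in> carrier_mat n n"
    and com: "A * B = B * A" "A * C = C * A" "B * C = C * B"
    using assms(1) by (auto simp: N3_iff)
  have carr: "P * M * Q \<in> carrier_mat n n" if "M \<in> carrier_mat n n" for M :: "'a mat"
    using P Q that by simp
  have nil: "nilpotent_mat (P * M * Q)" if nilM: "nilpotent_mat M" and M: "M \<in> carrier_mat n n" for M :: "'a mat"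
  proof -
    obtain k where "M ^\<^sub>m k = 0\<^sub>m n n" using nilM nilpotent_mat_iff[OF M] by auto
    moreover have "similar_mat_wit (P * M * Q) M P Q"
      by (rule similar_mat_witI[OF PQ QP refl carr[OF M] M P Q])
    ultimately have "(P * M * Q) ^\<^sub>m k = 0\<^sub>m n n"
      using similar_mat_wit_pow_id[of "P * M * Q" M P Q k] P Q by simp
    then show ?thesis using nilpotent_mat_iff[OF carr[OF M]] by blast
  qed
  have com': "(P * M * Q) * (P * N * Q) = (P * N * Q) * (P * M * Q)"
    if M: "M \<in> carrier_mat n n" and N: "N \<in> carrier_mat n n" and MN: "M * N = N * M" for M N :: "'a mat"
    unfolding conj_mult[OF P Q M N QP] conj_mult[OF P Q N M QP] MN ..
  show ?thesis
    using assms(1) c carr com'[OF c(1,2) com(1)] com'[OF c(1,3) com(2)] com'[OF c(2,3) com(3)] nil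
    unfolding N3_iff by blast
qed

lemma admissible_similar:
  fixes K :: "'a::field mat_triple set"
  assumes adm: "admissible n l K" and P: "P \<in> carrier_mat n n" and Q: "Q \<in> carrier_mat n n"
    and PQ: "P * Q = 1\<^sub>m n" and QP: "Q * P = 1\<^sub>m n"
  shows "admissible n l {(A, B, C). (P * A * Q, P * B * Q, P * C * Q) \<in> K}"
proof (rule admissible_vimage[OF adm])
  note assoc = assoc_mult_mat[of _ n n _ n _ n]
  note conj = conj_mult[OF P Q _ _ QP]
  fix M N :: "'a mat" and a :: 'a and k :: nat
  assume M: "M \<in> carrier_mat n n"
  show "P * M * Q \<in> carrier_mat n n" using P Q M by simp
  show "P * (a \<cdot>\<^sub>m M) * Q = a \<cdot>\<^sub>m (P * M * Q)"
    using P Q M by (simp add: mult_smult_distrib[of _ n n _ n] mult_smult_assoc_mat[of _ n n _ n])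
  show "rank_ge n k (P * M * Q)" if "rank_ge n k M"
    using rank_ge_similar[OF P Q QP M that] .
  show "M * M = 0\<^sub>m n n" if "(P * M * Q) * (P * M * Q) = 0\<^sub>m n n"
  proof -
    have "M * M = (Q * P) * (M * M) * (Q * P)" unfolding QP using M by simp
    also have "\<dots> = Q * (P * (M * M) * Q) * P" using P Q M by (simp add: assoc)
    also have "\<dots> = 0\<^sub>m n n" unfolding conj[OF M M, symmetric] that using P Q by simp
    finally show ?thesis .
  qed
  assume N: "N \<in> carrier_mat n n"
  show "P * (M + N) * Q = P * M * Q + P * N * Q"
    using P Q M N by (simp add: add_mult_distrib_mat[of _ n n _ _ n] mult_add_distrib_mat[of _ n n _ n])
next
  fix A B C :: "'a mat"
  assume "(A, B, C) \<in> N3 n"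
  then show "(P * A * Q, P * B * Q, P * C * Q) \<in> N3 n"
    using N3_similar P Q PQ QP by blast
qed

section \<open>Reflection in the antidiagonal\<close>

definition reversal :: "nat \<Rightarrow> 'a::{zero,one} mat" where
  "reversal n = mat n n (\<lambda>(i, j). if j = n - Suc i then 1 else 0)"

lemma reversal_carrier [simp]: "reversal n \<in> carrier_mat n n"
  by (simp add: reversal_def)

lemma reversal_mult:
  assumes "A \<in> carrier_mat n c"
  shows "reversal n * (A :: 'a::comm_ring_1 mat) = mat n c (\<lambda>(i, j). A $$ (n - Suc i, j))"
proof (rule eq_matI)
  fix i j assume "i < dim_row (mat n c (\<lambda>(i, j). A $$ (n - Suc i, j)))" "j < dim_col (mat n c (\<lambda>(i, j). A $$ (n - Suc i, j)))"
  then have ij: "i < n" "j < c" by auto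
  have "(reversal n * A) $$ (i, j) = (\<Sum>k<n. reversal n $$ (i, k) * A $$ (k, j))"
    by (rule index_mult_sum[OF _ assms ij]) simp
  also have "\<dots> = (\<Sum>k<n. if k = n - Suc i then A $$ (k, j) else 0)"
    using ij by (intro sum.cong) (auto simp: reversal_def)
  also have "\<dots> = A $$ (n - Suc i, j)" using ij by (simp add: sum.delta)
  finally show "(reversal n * A) $$ (i, j) = mat n c (\<lambda>(i, j). A $$ (n - Suc i, j)) $$ (i, j)"
    using ij by simp
qed (use assms in \<open>auto simp: reversal_def\<close>)

lemma reversal_involution: "reversal n * reversal n = (1\<^sub>m n :: 'a::comm_ring_1 mat)"
  by (subst reversal_mult[of _ n n]) (auto simp: reversal_def intro!: eq_matI)

lemma reversal_transpose [simp]: "(reversal n)\<^sup>T = reversal n"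
  by (rule eq_matI) (auto simp: reversal_def)

lemma reversal_dim [simp]: "dim_row (reversal n) = n" "dim_col (reversal n) = n"
  by (simp_all add: reversal_def)

text \<open>Transposition alone would move the identity block of \<open>A\<close> to the lower left;
  conjugating by the reversal moves it back. The result is an anti-automorphism that exchanges
  kernels with cokernels and fixes \<open>corner_mat\<close>.\<close>

definition flip :: "nat \<Rightarrow> 'a::comm_ring_1 mat \<Rightarrow> 'a mat" where
  "flip n M = reversal n * M\<^sup>T * reversal n"

lemma flip_carrier [simp]: "M \<in> carrier_mat n n \<Longrightarrow> flip n M \<in> carrier_mat n n"
  unfolding flip_def by (intro mult_carrier_mat[of _ n n]) auto

lemma flip_dim [simp]: "dim_row (flip n M) = n" "dim_col (flip n M) = n"
  by (simp_all add: flip_def)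

lemma flip_index:
  assumes "M \<in> carrier_mat n n" "i < n" "j < n"
  shows "flip n M $$ (i, j) = M $$ (n - Suc j, n - Suc i)"
proof -
  let ?W = "reversal n :: 'a mat"
  have "?W * M\<^sup>T \<in> carrier_mat n n"
    using assms(1) by (intro mult_carrier_mat[of _ n n]) auto
  then have "flip n M = (?W * (?W * M\<^sup>T)\<^sup>T)\<^sup>T"
    using transpose_mult[of ?W n n "(?W * M\<^sup>T)\<^sup>T" n] by (simp add: flip_def)
  then show ?thesis
    using assms by (simp add: reversal_mult[of _ n n])
qed

lemma flip_mult:
  fixes A B :: "'a::comm_ring_1 mat"
  assumes A: "A \<in> carrier_mat n n" and B: "B \<in> carrier_mat n n"
  shows "flip n A * flip n B = flip n (B * A)"
proof -
  let ?W = "reversal n :: 'a mat"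
  have "flip n A * flip n B = ?W * (A\<^sup>T * B\<^sup>T) * ?W"
    unfolding flip_def using A B by (intro conj_mult[of _ n] reversal_involution) auto
  then show ?thesis
    using transpose_mult[OF B A] by (simp add: flip_def)
qed

lemma flip_eq_zero:
  assumes "M \<in> carrier_mat n n" "flip n M = 0\<^sub>m n n"
  shows "M = 0\<^sub>m n n"
proof (rule eq_matI)
  fix i j assume "i < dim_row (0\<^sub>m n n :: 'a mat)" "j < dim_col (0\<^sub>m n n :: 'a mat)"
  then show "M $$ (i, j) = 0\<^sub>m n n $$ (i, j)"
    using arg_cong[OF assms(2), of "\<lambda>X. X $$ (n - Suc j, n - Suc i)"] flip_index[OF assms(1), of "n - Suc j" "n - Suc i"]
    by simp
qed (use assms in auto)

lemma flip_pow:
  assumes "M \<in> carrier_mat n n"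
  shows "flip n M ^\<^sub>m k = flip n (M ^\<^sub>m k)"
proof (induction k)
  case 0
  have "reversal n * 1\<^sub>m n * reversal n = (1\<^sub>m n :: 'a mat)"
    by (simp add: reversal_involution)
  then show ?case using assms by (simp add: flip_def)
next
  case (Suc k)
  then show ?case
    using assms flip_mult[of "M ^\<^sub>m k" n M] mult_pow_mat_commute[OF assms assms refl, of k] by simp
qed

lemma N3_flip:
  fixes A B C :: "'a::field mat"
  assumes "(A, B, C) \<in> N3 n"
  shows "(flip n A, flip n B, flip n C) \<in> N3 n"
proof -
  have c: "A \<in> carrier_mat n n" "B \<in> carrier_mat n n" "C \<in> carrier_mat n n"
    and com: "A * B = B * A" "A * C = C * A" "B * C = C * B"
    using assms by (auto simp: N3_iff)
  have nil: "nilpotent_mat (flip n M)" if nilM: "nilpotent_mat M" and M: "M \<in> carrier_mat n n" for M :: "'a mat"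
  proof -
    obtain k where "M ^\<^sub>m k = 0\<^sub>m n n" using nilM nilpotent_mat_iff[OF M] by auto
    then have "flip n M ^\<^sub>m k = 0\<^sub>m n n" using flip_pow[OF M, of k] by (simp add: flip_def)
    then show ?thesis using nilpotent_mat_iff[OF flip_carrier[OF M]] by blast
  qed
  have com': "flip n M * flip n N = flip n N * flip n M"
    if M: "M \<in> carrier_mat n n" and N: "N \<in> carrier_mat n n" and MN: "M * N = N * M" for M N
    unfolding flip_mult[OF M N] flip_mult[OF N M] MN ..
  show ?thesis
    using c assms com'[OF c(1,2) com(1)] com'[OF c(1,3) com(2)] com'[OF c(2,3) com(3)] nil
    unfolding N3_iff by simp
qed

lemma admissible_flip:
  fixes K :: "'a::field mat_triple set"
  assumes adm: "admissible n l K"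
  shows "admissible n l {(A, B, C). (flip n A, flip n B, flip n C) \<in> K}"
proof (rule admissible_vimage[OF adm])
  fix M N :: "'a mat" and a :: 'a and k :: nat
  assume M: "M \<in> carrier_mat n n"
  show "flip n M \<in> carrier_mat n n" using M by simp
  show "flip n (a \<cdot>\<^sub>m M) = a \<cdot>\<^sub>m flip n M"
    using M flip_carrier[OF M] flip_carrier[of "a \<cdot>\<^sub>m M" n]
    by (intro eq_matI) (auto simp: flip_index)
  show "M * M = 0\<^sub>m n n" if "flip n M * flip n M = 0\<^sub>m n n"
    using that flip_eq_zero[of "M * M" n] M unfolding flip_mult[OF M M] by simp
  show "rank_ge n k (flip n M)" if rkM: "rank_ge n k M"
  proof -
    obtain P Q where P: "P \<in> carrier_mat k n" and Q: "Q \<in> carrier_mat n k" and det: "det (P * M * Q) \<noteq> 0"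
      using rkM unfolding rank_ge_def by blast
    let ?W = "reversal n :: 'a mat"
    have QT: "Q\<^sup>T \<in> carrier_mat k n" and PT: "P\<^sup>T \<in> carrier_mat n k" and MT: "M\<^sup>T \<in> carrier_mat n n"
      and W: "?W \<in> carrier_mat n n"
      using P Q M by auto
    have WW: "?W * (?W * X) = X" if "X \<in> carrier_mat n c" for X c
      using that unfolding assoc_mult_mat[OF W W that, symmetric] reversal_involution by simp
    have "?W * flip n M = ?W * (?W * (M\<^sup>T * ?W))"
      unfolding flip_def assoc_mult_mat[OF W MT W] ..
    also have "\<dots> = M\<^sup>T * ?W"
      by (rule WW[OF mult_carrier_mat[OF MT W]])
    finally have "?W * flip n M = M\<^sup>T * ?W" .
    then have 1: "(Q\<^sup>T * ?W) * flip n M = Q\<^sup>T * (M\<^sup>T * ?W)"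
      unfolding assoc_mult_mat[OF QT W flip_carrier[OF M]] by simp
    have 2: "(M\<^sup>T * ?W) * (?W * P\<^sup>T) = M\<^sup>T * P\<^sup>T"
      unfolding assoc_mult_mat[OF MT W mult_carrier_mat[OF W PT]] WW[OF PT] ..
    have "(Q\<^sup>T * ?W) * flip n M * (?W * P\<^sup>T) = Q\<^sup>T * (M\<^sup>T * P\<^sup>T)"
      unfolding 1 assoc_mult_mat[OF QT mult_carrier_mat[OF MT W] mult_carrier_mat[OF W PT]] 2 ..
    also have "\<dots> = (P * M * Q)\<^sup>T"
      using transpose_mult[OF mult_carrier_mat[OF P M] Q] transpose_mult[OF P M] by simp
    finally have "det ((Q\<^sup>T * ?W) * flip n M * (?W * P\<^sup>T)) \<noteq> 0"
      using det det_transpose[of "P * M * Q" k] P Q M by simp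
    then show ?thesis
      unfolding rank_ge_def using P Q by (intro bexI[of _ "Q\<^sup>T * ?W"] bexI[of _ "?W * P\<^sup>T"]) auto
  qed
  assume N: "N \<in> carrier_mat n n"
  show "flip n (M + N) = flip n M + flip n N"
    using M N flip_carrier[OF M] flip_carrier[OF N] flip_carrier[of "M + N" n]
    by (intro eq_matI) (auto simp: flip_index)
next
  fix A B C :: "'a mat"
  assume "(A, B, C) \<in> N3 n"
  then show "(flip n A, flip n B, flip n C) \<in> N3 n"
    by (rule N3_flip)
qed

section \<open>Reduction to common corner blocks\<close>

lemma sandwich_entry:
  fixes X Y :: "'a::field mat"
  assumes X: "X \<in> carrier_mat n n" and Y: "Y \<in> carrier_mat n n" and ijkm: "i < n" "j < n" "k < n" "m < n"
  shows "(X * outer (unit_vec n j) (unit_vec n k) * Y) $$ (i, m) = X $$ (i, j) * Y $$ (k, m)"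
proof -
  have "X * outer (unit_vec n j) (unit_vec n k) * Y = outer (X *\<^sub>v unit_vec n j) (Y\<^sup>T *\<^sub>v unit_vec n k)"
    using X Y by (simp add: mult_outer[of _ n n] outer_mult[of _ n n])
  then show ?thesis using X Y ijkm by simp
qed

text \<open>Testing on matrix units aimed at a nonzero entry of \<open>Y\<close> expresses each
  entry of \<open>X\<close> through that of \<open>Y\<close>. Proportionality is all one can expect:
  in characteristic 2 every multiple of \<open>Y\<close> satisfies the hypothesis.\<close>

lemma sandwich_symmetric_zero:
  fixes X Y :: "'a::field mat"
  assumes X: "X \<in> carrier_mat n n" and Y: "Y \<in> carrier_mat n n" and Y0: "Y \<noteq> 0\<^sub>m n n"
    and zero: "\<And>Z. Z \<in> carrier_mat n n \<Longrightarrow> X * Z * Y + Y * Z * X = 0\<^sub>m n n"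
  obtains c where "X = c \<cdot>\<^sub>m Y"
proof -
  obtain k m where km: "k < n" "m < n" "Y $$ (k, m) \<noteq> 0"
    using Y Y0 by (metis eq_matI carrier_matD index_zero_mat)
  have "X $$ (i, j) = - (X $$ (k, m) / Y $$ (k, m)) * Y $$ (i, j)" if ij: "i < n" "j < n" for i j
  proof -
    let ?Z = "outer (unit_vec n j) (unit_vec n k) :: 'a mat"
    have Z: "?Z \<in> carrier_mat n n" by simp
    have "(X * ?Z * Y + Y * ?Z * X) $$ (i, m) = 0"
      unfolding zero[OF Z] using ij km by simp
    moreover have "(X * ?Z * Y + Y * ?Z * X) $$ (i, m) = (X * ?Z * Y) $$ (i, m) + (Y * ?Z * X) $$ (i, m)"
      using X Y Z ij km by (intro index_add_mat) auto
    ultimately have "X $$ (i, j) * Y $$ (k, m) + Y $$ (i, j) * X $$ (k, m) = 0"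
      using sandwich_entry[OF X Y ij(1,2) km(1,2)] sandwich_entry[OF Y X ij(1,2) km(1,2)] by simp
    then show ?thesis using km by (simp add: field_simps add_eq_0_iff)
  qed
  then have "X = (- (X $$ (k, m) / Y $$ (k, m))) \<cdot>\<^sub>m Y"
    using X Y by (intro eq_matI) auto
  then show thesis using that by blast
qed

lemma sandwich_self_zero:
  fixes X :: "'a::field mat"
  assumes X: "X \<in> carrier_mat n n"
    and zero: "\<And>Z. Z \<in> carrier_mat n n \<Longrightarrow> X * Z * X = 0\<^sub>m n n"
  shows "X = 0\<^sub>m n n"
proof (rule eq_matI)
  fix i j assume "i < dim_row (0\<^sub>m n n :: 'a mat)" "j < dim_col (0\<^sub>m n n :: 'a mat)"
  then have ij: "i < n" "j < n" by auto
  let ?Z = "outer (unit_vec n j) (unit_vec n i) :: 'a mat"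
  have "(X * ?Z * X) $$ (i, j) = 0"
    using zero[of ?Z] ij by simp
  then show "X $$ (i, j) = 0\<^sub>m n n $$ (i, j)"
    using sandwich_entry[OF X X ij(1,2) ij(1,2)] ij by simp
qed (use X in auto)

text \<open>The square of \<open>C + t \<cdot>\<^sub>m X\<close> is \<open>t\<close> times
  \<open>C * X + X * C\<close>, and each of the four terms in the square of this anticommutator
  contains \<open>C * C\<close>, \<open>X * X\<close> or \<open>X * C * X\<close>.\<close>

lemma nilpotent_line:
  fixes C X :: "'a::field mat"
  assumes C: "C \<in> carrier_mat n n" and X: "X \<in> carrier_mat n n"
    and CC: "C * C = 0\<^sub>m n n" and XX: "X * X = 0\<^sub>m n n" and XCX: "X * C * X = 0\<^sub>m n n"
  shows "nilpotent_mat (C + t \<cdot>\<^sub>m X)"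
proof (rule nilpotent_matI[of _ n])
  let ?Y = "C * X + X * C"
  have Y: "?Y \<in> carrier_mat n n" using C X by simp
  have sq: "(C + t \<cdot>\<^sub>m X) * (C + t \<cdot>\<^sub>m X) = t \<cdot>\<^sub>m ?Y"
    using square_line[OF C X CC, of t] XX Y by simp
  have "?Y * ?Y = (C * X) * (C * X) + (X * C) * (C * X) + ((C * X) * (X * C) + (X * C) * (X * C))"
    using C X by (simp add: add_mult_distrib_mat[of _ n n _ _ n] mult_add_distrib_mat[of _ n n _ n])
  also have "(C * X) * (C * X) = C * (X * C * X)"
    using C X by (simp add: assoc_mult_mat[of _ n n _ n _ n])
  also have "(X * C) * (C * X) = X * (C * C) * X"
    using C X by (simp add: assoc_mult_mat[of _ n n _ n _ n])
  also have "(C * X) * (X * C) = C * (X * X) * C"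
    using C X by (simp add: assoc_mult_mat[of _ n n _ n _ n])
  also have "(X * C) * (X * C) = (X * C * X) * C"
    using C X by (simp add: assoc_mult_mat[of _ n n _ n _ n])
  finally have "?Y * ?Y = 0\<^sub>m n n"
    unfolding CC XX XCX using C X by simp
  then show "(C + t \<cdot>\<^sub>m X) * (C + t \<cdot>\<^sub>m X) * ((C + t \<cdot>\<^sub>m X) * (C + t \<cdot>\<^sub>m X)) = 0\<^sub>m n n"
    unfolding sq using Y by (simp add: mult_smult_distrib[of _ n n _ n] mult_smult_assoc_mat[of _ n n _ n])
qed (use C X in simp)

text \<open>\<open>A * W * A\<close> is annihilated by \<open>A\<close> on both sides because
  \<open>A\<close> has square zero, so it commutes with \<open>A\<close> for every \<open>W\<close>.
  Only commutation with \<open>B\<close> restricts \<open>W\<close>, and \<open>nz\<close> is the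
  anticommutator with \<open>C\<close>.\<close>

lemma deform_corner:
  fixes A B C :: "'a::alg_closed_field mat"
  assumes adm: "admissible n l K" and T: "(A, B, C) \<in> N3 n" and rk: "rank_ge n l A"
    and AA: "A * A = 0\<^sub>m n n" and CC: "C * C = 0\<^sub>m n n"
    and W: "W \<in> carrier_mat n n" and BX: "B * (A * W * A) = (A * W * A) * B"
    and nz: "A * C * W * A + A * W * (A * C) \<noteq> 0\<^sub>m n n"
  shows "(A, B, C) \<in> K"
proof -
  have c: "A \<in> carrier_mat n n" "B \<in> carrier_mat n n" "C \<in> carrier_mat n n" and AC: "A * C = C * A"
    using T by (auto simp: N3_iff)
  note assoc = assoc_mult_mat[of _ n n _ n _ n]
  let ?X = "A * W * A"
  have X: "?X \<in> carrier_mat n n" using c W by simp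
  have AX: "A * ?X = 0\<^sub>m n n"
  proof -
    have "A * ?X = (A * A) * W * A" using c W by (simp add: assoc)
    then show ?thesis using AA c W by simp
  qed
  have XA: "?X * A = 0\<^sub>m n n"
  proof -
    have "?X * A = A * W * (A * A)" using c W by (simp add: assoc)
    then show ?thesis using AA c W by simp
  qed
  have CX: "C * ?X = A * C * W * A"
    unfolding AC using c W by (simp add: assoc)
  have XC: "?X * C = A * W * (A * C)"
    using c W by (simp add: assoc)
  have "?X * ?X = (?X * A) * W * A" using c W by (simp add: assoc)
  then have XX: "?X * ?X = 0\<^sub>m n n" unfolding XA using c W by simp
  have "?X * C * ?X = A * W * (A * C) * ?X" unfolding XC ..
  also have "\<dots> = A * W * C * (A * ?X)" unfolding AC using c W by (simp add: assoc)
  also have "\<dots> = 0\<^sub>m n n" unfolding AX using c W by simp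
  finally have XCX: "?X * C * ?X = 0\<^sub>m n n" .
  show ?thesis
  proof (rule deform_third[OF adm T rk X _ BX])
    show "A * ?X = ?X * A" unfolding AX XA ..
    show "nilpotent_mat (C + t \<cdot>\<^sub>m ?X)" for t
      by (rule nilpotent_line[OF c(3) X CC XX XCX])
    show "C * ?X + ?X * C \<noteq> 0\<^sub>m n n \<or> ?X * ?X \<noteq> 0\<^sub>m n n"
      unfolding CX XC using nz by simp
  qed
qed

text \<open>With \<open>A * B = 0\<close> every \<open>A * Z * A\<close> commutes with
  \<open>B\<close>. If all anticommutators with \<open>C\<close> vanished, \<open>A * C\<close>
  would be a multiple \<open>d\<close> of \<open>A\<close>; then \<open>C * C = 0\<close> gives
  \<open>d * d = 0\<close>, against \<open>A * C\<close> being nonzero.\<close>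

lemma deform_corner_one:
  fixes A B C :: "'a::alg_closed_field mat"
  assumes adm: "admissible n l K" and T: "(A, B, C) \<in> N3 n" and rk: "rank_ge n l A"
    and AA: "A * A = 0\<^sub>m n n" and CC: "C * C = 0\<^sub>m n n"
    and AB: "A * B = 0\<^sub>m n n" and AC: "A * C \<noteq> 0\<^sub>m n n"
  shows "(A, B, C) \<in> K"
proof -
  have c: "A \<in> carrier_mat n n" "B \<in> carrier_mat n n" "C \<in> carrier_mat n n" and BA: "B * A = 0\<^sub>m n n"
    using T AB by (auto simp: N3_iff)
  note assoc = assoc_mult_mat[of _ n n _ n _ n]
  have A0: "A \<noteq> 0\<^sub>m n n" using AC c by auto
  have "\<exists>Z\<in>carrier_mat n n. A * C * Z * A + A * Z * (A * C) \<noteq> 0\<^sub>m n n"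
  proof (rule ccontr)
    assume "\<not> ?thesis"
    then obtain d where d: "A * C = d \<cdot>\<^sub>m A"
      using sandwich_symmetric_zero[of "A * C" n A] c A0 by (metis mult_carrier_mat)
    have "A * (C * C) = (A * C) * C" using c by (simp add: assoc)
    also have "\<dots> = (d * d) \<cdot>\<^sub>m A"
      unfolding d using c by (simp add: mult_smult_assoc_mat[of _ n n _ n] d smult_smult_mat)
    finally have "(d * d) \<cdot>\<^sub>m A = 0\<^sub>m n n" unfolding CC using c by simp
    moreover have "d \<noteq> 0" using d AC c zero_smult_mat[of A n n] by auto
    ultimately have "(inverse (d * d) * (d * d)) \<cdot>\<^sub>m A = 0\<^sub>m n n" "d * d \<noteq> 0"
      by (auto simp flip: smult_smult_mat)
    then have "1 \<cdot>\<^sub>m A = 0\<^sub>m n n" by (metis left_inverse)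
    then show False using A0 by simp
  qed
  then obtain Z where Z: "Z \<in> carrier_mat n n" "A * C * Z * A + A * Z * (A * C) \<noteq> 0\<^sub>m n n" by blast
  have "B * (A * Z * A) = B * A * Z * A" using c Z by (simp add: assoc)
  moreover have "(A * Z * A) * B = A * Z * (A * B)" using c Z by (simp add: assoc)
  ultimately have "B * (A * Z * A) = (A * Z * A) * B"
    unfolding AB BA using c Z by simp
  then show ?thesis
    using deform_corner[OF adm T rk AA CC Z(1) _ Z(2)] by blast
qed

text \<open>Here commutation with \<open>B\<close> is a genuine constraint, and \<open>W\<close> is
  chosen inside the commutant of \<open>B\<close>.\<close>

lemma deform_corner_two:
  fixes A B C :: "'a::alg_closed_field mat"
  assumes adm: "admissible n l K" and T: "(A, B, C) \<in> N3 n" and rk: "rank_ge n l A"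
    and AA: "A * A = 0\<^sub>m n n" and BB: "B * B = 0\<^sub>m n n" and CC: "C * C = 0\<^sub>m n n"
    and AC: "A * C \<noteq> 0\<^sub>m n n" and indep: "\<And>d. A * B \<noteq> d \<cdot>\<^sub>m (A * C)"
  shows "(A, B, C) \<in> K"
proof -
  have c: "A \<in> carrier_mat n n" "B \<in> carrier_mat n n" "C \<in> carrier_mat n n"
    and com: "A * B = B * A" "A * C = C * A" "B * C = C * B"
    using T by (auto simp: N3_iff)
  note assoc = assoc_mult_mat[of _ n n _ n _ n]
  \<comment> \<open>Since \<open>B * B = 0\<close>, both \<open>B * W Z\<close> and
    \<open>W Z * B\<close> equal \<open>B * Z * B\<close>.\<close>
  define W where "W Z = B * Z + Z * B" for Z
  have Wc: "W Z \<in> carrier_mat n n" if "Z \<in> carrier_mat n n" for Z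
    using that c by (simp add: W_def)
  have BX: "B * (A * W Z * A) = (A * W Z * A) * B" if Z: "Z \<in> carrier_mat n n" for Z
  proof -
    have "B * (A * W Z * A) = A * (B * W Z) * A"
    proof -
      have "B * (A * W Z * A) = (B * A) * W Z * A" using c Wc[OF Z] by (simp add: assoc)
      also have "\<dots> = A * (B * W Z) * A" unfolding com(1)[symmetric] using c Wc[OF Z] by (simp add: assoc)
      finally show ?thesis .
    qed
    moreover have "(A * W Z * A) * B = A * (W Z * B) * A"
    proof -
      have "(A * W Z * A) * B = A * W Z * (A * B)" using c Wc[OF Z] by (simp add: assoc)
      also have "\<dots> = A * (W Z * B) * A" unfolding com(1) using c Wc[OF Z] by (simp add: assoc)
      finally show ?thesis .
    qed
    moreover have "B * W Z = W Z * B"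
    proof -
      have "B * W Z = (B * B) * Z + B * Z * B"
        using c Z by (simp add: W_def mult_add_distrib_mat[of _ n n _ n] assoc)
      moreover have "W Z * B = B * Z * B + Z * (B * B)"
        using c Z by (simp add: W_def add_mult_distrib_mat[of _ n n _ _ n] assoc)
      ultimately show ?thesis unfolding BB using c Z by simp
    qed
    ultimately show ?thesis by simp
  qed
  define d where "d = A * B * C"
  define p where "p = A * B"
  define q where "q = A * C"
  have dc: "d \<in> carrier_mat n n" and pc: "p \<in> carrier_mat n n" and qc: "q \<in> carrier_mat n n"
    using c by (auto simp: d_def p_def q_def)
  have Cd: "C * d = 0\<^sub>m n n" and Bd: "B * d = 0\<^sub>m n n" and Cq: "C * q = 0\<^sub>m n n"
    and Cp: "C * p = d" and Bq: "B * q = d" and CA: "C * A = q"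
  proof -
    have "C * q = C * (C * A)" by (simp add: q_def com)
    also have "\<dots> = (C * C) * A" using c by (simp add: assoc)
    finally show Cq: "C * q = 0\<^sub>m n n" unfolding CC using c by simp
    show "C * A = q" by (simp add: q_def com)
    have "C * p = (C * A) * B" using c by (simp add: p_def assoc)
    also have "\<dots> = A * (C * B)" unfolding com(2)[symmetric] using c by (simp add: assoc)
    also have "\<dots> = d" unfolding com(3)[symmetric] d_def using c by (simp add: assoc)
    finally show Cp: "C * p = d" .
    have "B * q = (B * A) * C" using c by (simp add: q_def assoc)
    then show Bq: "B * q = d" unfolding com(1)[symmetric] d_def .
    have "C * d = (C * C) * p" using c Cp pc by (simp add: assoc)
    then show "C * d = 0\<^sub>m n n" unfolding CC using pc by simp
    have "B * d = (B * B) * q" using c Bq qc by (simp add: assoc)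
    then show "B * d = 0\<^sub>m n n" unfolding BB using qc by simp
  qed
  have "\<exists>Z\<in>carrier_mat n n. A * C * W Z * A + A * W Z * (A * C) \<noteq> 0\<^sub>m n n"
  proof (rule ccontr)
    assume neg: "\<not> ?thesis"
    \<comment> \<open>The vanishing anticommutator in terms of \<open>p\<close>, \<open>q\<close>
      and \<open>d\<close>. Left multiplication by \<open>C\<close> leaves only
      \<open>d * Z * q + q * Z * d\<close>, then multiplication by \<open>B\<close> leaves
      \<open>d * Z * d\<close>. So \<open>d = 0\<close>, and what remains of \<open>E\<close> makes
      \<open>p\<close> a multiple of \<open>q\<close>.\<close>
    have E: "d * Z * A + q * Z * p + (p * Z * q + A * Z * d) = 0\<^sub>m n n" if Z: "Z \<in> carrier_mat n n" for Z
    proof -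
      have "A * C * W Z * A = A * C * (B * Z) * A + A * C * (Z * B) * A"
        using c Z add_mult_distrib_mat[of "A * C * (B * Z)" n n "A * C * (Z * B)" A n]
        by (simp add: W_def mult_add_distrib_mat[of _ n n _ n] mult_carrier_mat[of _ n n _ n] del: assoc_mult_mat)
      moreover have "A * C * (B * Z) * A = A * (C * B) * Z * A" using c Z by (simp add: assoc)
      then have "A * C * (B * Z) * A = d * Z * A"
        unfolding com(3)[symmetric] d_def using c Z by (simp add: assoc)
      moreover have "A * C * (Z * B) * A = A * C * Z * (B * A)" using c Z by (simp add: assoc)
      then have "A * C * (Z * B) * A = q * Z * p"
        unfolding com(1)[symmetric] q_def p_def .
      ultimately have 1: "A * C * W Z * A = d * Z * A + q * Z * p" by simp
      have "A * W Z * (A * C) = A * (B * Z) * (A * C) + A * (Z * B) * (A * C)"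
        using c Z by (simp add: W_def add_mult_distrib_mat[of _ n n _ _ n] mult_add_distrib_mat[of _ n n _ n])
      moreover have "A * (B * Z) * (A * C) = p * Z * q" using c Z by (simp add: p_def q_def assoc)
      moreover have "A * (Z * B) * (A * C) = A * Z * ((B * A) * C)" using c Z by (simp add: assoc)
      then have "A * (Z * B) * (A * C) = A * Z * d"
        unfolding com(1)[symmetric] d_def .
      ultimately have 2: "A * W Z * (A * C) = p * Z * q + A * Z * d" by simp
      show ?thesis using neg Z 1 2 by auto
    qed
    have left: "M * (d * Z * A + q * Z * p + (p * Z * q + A * Z * d)) =
        (M * d) * Z * A + (M * q) * Z * p + ((M * p) * Z * q + (M * A) * Z * d)"
      if "M \<in> carrier_mat n n" "Z \<in> carrier_mat n n" for M Z
      using that c dc pc qc by (simp add: mult_add_distrib_mat[of _ n n _ n] assoc)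
    have E2: "d * Z * q + q * Z * d = 0\<^sub>m n n" if Z: "Z \<in> carrier_mat n n" for Z
    proof -
      have "C * 0\<^sub>m n n = (C * d) * Z * A + (C * q) * Z * p + ((C * p) * Z * q + (C * A) * Z * d)"
        using left[OF c(3) Z] E[OF Z] by simp
      then show ?thesis
        unfolding Cd Cq Cp CA using c Z dc pc qc by (simp add: left_mult_zero_mat[of _ n n])
    qed
    have "d * Z * d = 0\<^sub>m n n" if Z: "Z \<in> carrier_mat n n" for Z
    proof -
      have "B * (d * Z * q + q * Z * d) = (B * d) * Z * q + (B * q) * Z * d"
        using c dc qc Z by (simp add: mult_add_distrib_mat[of _ n n _ n] assoc)
      then show ?thesis
        unfolding E2[OF Z] Bd Bq using c Z dc qc by (simp add: left_mult_zero_mat[of _ n n])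
    qed
    then have "d = 0\<^sub>m n n" using sandwich_self_zero[OF dc] by blast
    then have "p * Z * q + q * Z * p = 0\<^sub>m n n" if "Z \<in> carrier_mat n n" for Z
    proof -
      have "q * Z * p + p * Z * q = 0\<^sub>m n n"
        using E[OF that] that c pc qc \<open>d = 0\<^sub>m n n\<close> by (simp add: left_mult_zero_mat[of _ n n])
      then show ?thesis
        using comm_add_mat[OF mult_carrier_mat[OF mult_carrier_mat[OF qc that] pc] mult_carrier_mat[OF mult_carrier_mat[OF pc that] qc]]
        by simp
    qed
    then obtain e where "p = e \<cdot>\<^sub>m q"
      using sandwich_symmetric_zero[OF pc qc] AC unfolding q_def by blast
    then show False using indep unfolding p_def q_def by blast
  qed
  then obtain Z where Z: "Z \<in> carrier_mat n n" and nz: "A * C * W Z * A + A * W Z * (A * C) \<noteq> 0\<^sub>m n n" by blast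
  show ?thesis
    by (rule deform_corner[OF adm T rk AA CC Wc[OF Z] BX[OF Z] nz])
qed

text \<open>If \<open>A * C\<close> is nonzero, either \<open>A * B\<close> is not a multiple of it
  and the two-matrix deformation applies, or a shear reduces to \<open>A * B = 0\<close>. Once
  \<open>A * C = 0\<close>, exchanging \<open>B\<close> and \<open>C\<close> gives
  \<open>A * B = 0\<close>.\<close>

lemma annihilates_or_deforms:
  fixes A B C :: "'a::alg_closed_field mat"
  assumes adm: "admissible n l K" and T: "(A, B, C) \<in> N3 n" and rk: "rank_ge n l A"
    and AA: "A * A = 0\<^sub>m n n" and BB: "B * B = 0\<^sub>m n n" and CC: "C * C = 0\<^sub>m n n"
    and nK: "(A, B, C) \<notin> K"
  shows "A * B = 0\<^sub>m n n" "A * C = 0\<^sub>m n n"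
proof -
  have c: "A \<in> carrier_mat n n" "B \<in> carrier_mat n n" "C \<in> carrier_mat n n"
    using T by (auto simp: N3_iff)
  show AC: "A * C = 0\<^sub>m n n"
  proof (rule ccontr)
    assume AC: "A * C \<noteq> 0\<^sub>m n n"
    have "\<exists>d. A * B = d \<cdot>\<^sub>m (A * C)"
      using deform_corner_two[OF adm T rk AA BB CC AC] nK by blast
    then obtain d where d: "A * B = d \<cdot>\<^sub>m (A * C)" by blast
    \<comment> \<open>The shear that makes \<open>A * B'\<close> vanish; the set of triples is
      changed by the inverse shear \<open>B + d \<cdot>\<^sub>m C\<close>, obtained by conjugating a
      shear of the third matrix with an exchange.\<close>
    define B' where "B' = B + (-d) \<cdot>\<^sub>m C"
    have B'c: "B' \<in> carrier_mat n n" using c by (simp add: B'_def)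
    have "(A, C, B') \<in> N3 n"
      unfolding B'_def by (rule N3_shear[OF N3_swap[OF T]])
    then have T': "(A, B', C) \<in> N3 n" by (rule N3_swap)
    have "A * B' = A * B + (-d) \<cdot>\<^sub>m (A * C)"
      using c by (simp add: B'_def mult_add_distrib_mat[of _ n n _ n] mult_smult_distrib[of _ n n _ n])
    then have AB': "A * B' = 0\<^sub>m n n"
      unfolding d using c by (intro eq_matI) auto
    have adm': "admissible n l {(A, B, C). (A, B + d \<cdot>\<^sub>m C, C) \<in> K}"
      using admissible_swap[OF admissible_shear[OF admissible_swap[OF adm], of d]] by simp
    have "(A, B', C) \<in> {(A, B, C). (A, B + d \<cdot>\<^sub>m C, C) \<in> K}"
      by (rule deform_corner_one[OF adm' T' rk AA CC AB' AC])
    moreover have "B' + d \<cdot>\<^sub>m C = B"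
      using c by (intro eq_matI) (auto simp: B'_def)
    ultimately show False using nK by simp
  qed
  show "A * B = 0\<^sub>m n n"
  proof (rule ccontr)
    assume "A * B \<noteq> 0\<^sub>m n n"
    from deform_corner_one[OF admissible_swap[OF adm] N3_swap[OF T] rk AA BB AC this]
    show False using nK by simp
  qed
qed

text \<open>\<open>R * A\<close> is annihilated from the right by \<open>A\<close>, \<open>B\<close>
  and \<open>C\<close>, and from the left by \<open>A\<close> and \<open>B\<close> through the
  choice of \<open>R\<close>. Its anticommutator with \<open>C\<close> is therefore the single
  product \<open>C * R * A\<close>.\<close>

lemma deform_right_factor:
  fixes A B C :: "'a::alg_closed_field mat"
  assumes adm: "admissible n l K" and T: "(A, B, C) \<in> N3 n" and rk: "rank_ge n l A"
    and AA: "A * A = 0\<^sub>m n n" and CC: "C * C = 0\<^sub>m n n"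
    and AB: "A * B = 0\<^sub>m n n" and AC: "A * C = 0\<^sub>m n n"
    and R: "R \<in> carrier_mat n n" and AR: "A * R = 0\<^sub>m n n" and BR: "B * R = 0\<^sub>m n n"
    and nz: "C * R * A \<noteq> 0\<^sub>m n n"
  shows "(A, B, C) \<in> K"
proof -
  have c: "A \<in> carrier_mat n n" "B \<in> carrier_mat n n" "C \<in> carrier_mat n n"
    using T by (auto simp: N3_iff)
  note assoc = assoc_mult_mat[of _ n n _ n _ n]
  let ?X = "R * A"
  have X: "?X \<in> carrier_mat n n" using R c by simp
  have kill: "M * ?X = 0\<^sub>m n n" if "M \<in> carrier_mat n n" "M * R = 0\<^sub>m n n" for M
  proof -
    have "M * ?X = (M * R) * A" using that(1) c R by (simp add: assoc)
    then show ?thesis unfolding that using c by simp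
  qed
  have kill': "?X * M = 0\<^sub>m n n" if "M \<in> carrier_mat n n" "A * M = 0\<^sub>m n n" for M
  proof -
    have "?X * M = R * (A * M)" using assoc[OF R c(1) that(1)] .
    then show ?thesis unfolding that using R by simp
  qed
  have XC: "?X * C = 0\<^sub>m n n" by (rule kill'[OF c(3) AC])
  have AX: "A * ?X = 0\<^sub>m n n" by (rule kill[OF c(1) AR])
  have XX: "?X * ?X = 0\<^sub>m n n" by (rule kill'[OF X AX])
  show ?thesis
  proof (rule deform_third[OF adm T rk X])
    show "A * ?X = ?X * A" unfolding AX kill'[OF c(1) AA] ..
    show "B * ?X = ?X * B" unfolding kill[OF c(2) BR] kill'[OF c(2) AB] ..
    show "nilpotent_mat (C + t \<cdot>\<^sub>m ?X)" for t
      by (rule nilpotent_line[OF c(3) X CC XX]) (use XC R c in simp)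
    have "C * ?X = C * R * A" using c R by (simp add: assoc)
    then show "C * ?X + ?X * C \<noteq> 0\<^sub>m n n \<or> ?X * ?X \<noteq> 0\<^sub>m n n"
      unfolding XC using nz X c R by simp
  qed
qed

text \<open>The mirror image, with \<open>A * R\<close>: now the single surviving product is
  \<open>A * (R * C)\<close>.\<close>

lemma deform_left_factor:
  fixes A B C :: "'a::alg_closed_field mat"
  assumes adm: "admissible n l K" and T: "(A, B, C) \<in> N3 n" and rk: "rank_ge n l A"
    and AA: "A * A = 0\<^sub>m n n" and CC: "C * C = 0\<^sub>m n n"
    and AB: "A * B = 0\<^sub>m n n" and AC: "A * C = 0\<^sub>m n n"
    and R: "R \<in> carrier_mat n n" and RA: "R * A = 0\<^sub>m n n" and RB: "R * B = 0\<^sub>m n n"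
    and nz: "A * (R * C) \<noteq> 0\<^sub>m n n"
  shows "(A, B, C) \<in> K"
proof -
  have c: "A \<in> carrier_mat n n" "B \<in> carrier_mat n n" "C \<in> carrier_mat n n"
    and com: "A * B = B * A" "A * C = C * A"
    using T by (auto simp: N3_iff)
  note assoc = assoc_mult_mat[of _ n n _ n _ n]
  let ?X = "A * R"
  have X: "?X \<in> carrier_mat n n" using R c by simp
  have kill: "?X * M = 0\<^sub>m n n" if "M \<in> carrier_mat n n" "R * M = 0\<^sub>m n n" for M
  proof -
    have "?X * M = A * (R * M)" using assoc[OF c(1) R that(1)] .
    then show ?thesis unfolding that using c by simp
  qed
  have kill': "M * ?X = 0\<^sub>m n n" if "M \<in> carrier_mat n n" "M * A = 0\<^sub>m n n" for M
  proof -
    have "M * ?X = (M * A) * R" using that(1) c R by (simp add: assoc)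
    then show ?thesis unfolding that using R by simp
  qed
  have CX: "C * ?X = 0\<^sub>m n n" by (rule kill'[OF c(3)]) (use AC com in simp)
  have XA: "?X * A = 0\<^sub>m n n" by (rule kill[OF c(1) RA])
  have XX: "?X * ?X = 0\<^sub>m n n" by (rule kill'[OF X XA])
  have XC: "?X * C = A * (R * C)" using assoc[OF c(1) R c(3)] .
  show ?thesis
  proof (rule deform_third[OF adm T rk X])
    show "A * ?X = ?X * A" unfolding XA kill'[OF c(1) AA] ..
    have "B * A = 0\<^sub>m n n" using AB com by simp
    then show "B * ?X = ?X * B" using kill[OF c(2) RB] kill'[OF c(2)] by simp
    have "?X * C * ?X = ?X * (C * ?X)" using assoc[OF X c(3) X] .
    then have "?X * C * ?X = 0\<^sub>m n n" unfolding CX using right_mult_zero_mat[OF X] by simp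
    then show "nilpotent_mat (C + t \<cdot>\<^sub>m ?X)" for t
      by (rule nilpotent_line[OF c(3) X CC XX])
    have "A * (R * C) \<in> carrier_mat n n" using c R by simp
    then show "C * ?X + ?X * C \<noteq> 0\<^sub>m n n \<or> ?X * ?X \<noteq> 0\<^sub>m n n"
      unfolding CX XC using nz by simp
  qed
qed

section \<open>The normal form of \<open>A\<close> and its rank certificates\<close>

definition corner_mat :: "nat \<Rightarrow> nat \<Rightarrow> 'a::{zero,one} mat" where
  "corner_mat n l = mat n n (\<lambda>(i, j). if i < l \<and> j = i + (n - l) then 1 else 0)"

lemma corner_mat_carrier [simp]: "corner_mat n l \<in> carrier_mat n n"
  by (simp add: corner_mat_def)

lemma corner_mat_dim [simp]: "dim_row (corner_mat n l) = n" "dim_col (corner_mat n l) = n"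
  by (simp_all add: corner_mat_def)

lemma mult_vec_sum:
  "M \<in> carrier_mat r n \<Longrightarrow> v \<in> carrier_vec n \<Longrightarrow> i < r \<Longrightarrow> (M *\<^sub>v v) $ i = (\<Sum>k<n. M $$ (i, k) * v $ k)"
  by (auto simp: scalar_prod_def atLeast0LessThan intro!: sum.cong)

lemma corner_mult_vec:
  fixes v :: "'a::comm_ring_1 vec"
  assumes v: "v \<in> carrier_vec n" and "l \<le> n"
  shows "corner_mat n l *\<^sub>v v = vec n (\<lambda>i. if i < l then v $ (i + (n - l)) else 0)"
proof (rule eq_vecI)
  fix i assume "i < dim_vec (vec n (\<lambda>i. if i < l then v $ (i + (n - l)) else 0))"
  then have i: "i < n" by simp
  have "(corner_mat n l *\<^sub>v v) $ i = (\<Sum>k<n. (if k = i + (n - l) then (if i < l then v $ k else 0) else 0))"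
    using i v by (subst mult_vec_sum[OF corner_mat_carrier v i]) (intro sum.cong, auto simp: corner_mat_def)
  also have "\<dots> = (if i < l then v $ (i + (n - l)) else 0)"
    using i \<open>l \<le> n\<close> by (subst sum.delta) auto
  finally show "(corner_mat n l *\<^sub>v v) $ i = vec n (\<lambda>i. if i < l then v $ (i + (n - l)) else 0) $ i"
    using i by simp
qed simp

lemma corner_transpose_mult_vec:
  fixes v :: "'a::comm_ring_1 vec"
  assumes v: "v \<in> carrier_vec n" and "l \<le> n"
  shows "(corner_mat n l)\<^sup>T *\<^sub>v v = vec n (\<lambda>j. if n - l \<le> j then v $ (j - (n - l)) else 0)"
proof (rule eq_vecI)
  fix j assume "j < dim_vec (vec n (\<lambda>j. if n - l \<le> j then v $ (j - (n - l)) else 0))"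
  then have j: "j < n" by simp
  have "((corner_mat n l)\<^sup>T *\<^sub>v v) $ j = (\<Sum>k<n. (if k = j - (n - l) then (if n - l \<le> j then v $ k else 0) else 0))"
    using j v \<open>l \<le> n\<close> by (subst mult_vec_sum[of "(corner_mat n l)\<^sup>T" n n v j]) (simp, simp, simp, intro sum.cong, auto simp: corner_mat_def)
  also have "\<dots> = (if n - l \<le> j then v $ (j - (n - l)) else 0)"
    using j \<open>l \<le> n\<close> by (subst sum.delta) auto
  finally show "((corner_mat n l)\<^sup>T *\<^sub>v v) $ j = vec n (\<lambda>j. if n - l \<le> j then v $ (j - (n - l)) else 0) $ j"
    using j by simp
qed simp

lemma mult_corner_index:
  fixes M :: "'a::comm_ring_1 mat"
  assumes M: "M \<in> carrier_mat n n" and "l \<le> n" "i < n" "j < l"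
  shows "(M * corner_mat n l) $$ (i, j + (n - l)) = M $$ (i, j)"
proof -
  have "(M * corner_mat n l) $$ (i, j + (n - l)) = (\<Sum>k<n. M $$ (i, k) * corner_mat n l $$ (k, j + (n - l)))"
    using assms by (intro index_mult_sum[OF M]) auto
  also have "\<dots> = (\<Sum>k<n. if k = j then M $$ (i, k) else 0)"
    using assms by (intro sum.cong) (auto simp: corner_mat_def)
  also have "\<dots> = M $$ (i, j)" using assms by (subst sum.delta) auto
  finally show ?thesis .
qed

lemma corner_square: "2 * l \<le> n \<Longrightarrow> corner_mat n l * corner_mat n l = (0\<^sub>m n n :: 'a::comm_ring_1 mat)"
proof (intro eq_matI)
  fix i j assume *: "2 * l \<le> n" "i < dim_row (0\<^sub>m n n :: 'a mat)" "j < dim_col (0\<^sub>m n n :: 'a mat)"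
  then have "(corner_mat n l * corner_mat n l) $$ (i, j) =
      (\<Sum>k<n. corner_mat n l $$ (i, k) * (corner_mat n l $$ (k, j) :: 'a))"
    by (intro index_mult_sum[of _ n n _ n]) auto
  also have "\<dots> = 0"
    using * by (intro sum.neutral) (auto simp: corner_mat_def)
  finally show "(corner_mat n l * corner_mat n l) $$ (i, j) = (0\<^sub>m n n :: 'a mat) $$ (i, j)"
    using * by simp
qed simp_all

lemma flip_corner: "l \<le> n \<Longrightarrow> flip n (corner_mat n l) = (corner_mat n l :: 'a::comm_ring_1 mat)"
  by (intro eq_matI) (auto simp: flip_index corner_mat_def)

text \<open>Zero-one matrices for reindexing: with injective \<open>f\<close> they cut out minors,
  and with a permutation they give a change of basis.\<close>

definition select_rows :: "nat \<Rightarrow> nat \<Rightarrow> (nat \<Rightarrow> nat) \<Rightarrow> 'a::{zero,one} mat" where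
  "select_rows k n f = mat k n (\<lambda>(i, j). if j = f i then 1 else 0)"

definition select_cols :: "nat \<Rightarrow> nat \<Rightarrow> (nat \<Rightarrow> nat) \<Rightarrow> 'a::{zero,one} mat" where
  "select_cols k n f = mat n k (\<lambda>(i, j). if i = f j then 1 else 0)"

lemma select_carrier [simp]:
  "select_rows k n f \<in> carrier_mat k n" "select_cols k n f \<in> carrier_mat n k"
  by (simp_all add: select_rows_def select_cols_def)

lemma mult_select_cols_index:
  fixes M :: "'a::comm_ring_1 mat"
  assumes M: "M \<in> carrier_mat r n" and "i < r" "j < k" "f j < n"
  shows "(M * select_cols k n f) $$ (i, j) = M $$ (i, f j)"
proof -
  have "(M * select_cols k n f) $$ (i, j) = (\<Sum>t<n. M $$ (i, t) * select_cols k n f $$ (t, j))"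
    using assms by (intro index_mult_sum[OF M]) auto
  also have "\<dots> = (\<Sum>t<n. if t = f j then M $$ (i, t) else 0)"
    using assms by (intro sum.cong) (auto simp: select_cols_def)
  also have "\<dots> = M $$ (i, f j)" using assms by (subst sum.delta) auto
  finally show ?thesis .
qed

lemma select_rows_mult_index:
  fixes M :: "'a::comm_ring_1 mat"
  assumes M: "M \<in> carrier_mat n c" and "i < k" "j < c" "f i < n"
  shows "(select_rows k n f * M) $$ (i, j) = M $$ (f i, j)"
proof -
  have "(select_rows k n f * M) $$ (i, j) = (\<Sum>t<n. select_rows k n f $$ (i, t) * M $$ (t, j))"
    using assms by (intro index_mult_sum[OF _ M]) auto
  also have "\<dots> = (\<Sum>t<n. if t = f i then M $$ (t, j) else 0)"
    using assms by (intro sum.cong) (auto simp: select_rows_def)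
  also have "\<dots> = M $$ (f i, j)" using assms by (subst sum.delta) auto
  finally show ?thesis .
qed

lemma rank_ge_upper_right:
  fixes M :: "'a::field mat"
  assumes M: "M \<in> carrier_mat n n" and l: "l \<le> n"
    and one: "\<And>i j. i < l \<Longrightarrow> j < l \<Longrightarrow> M $$ (i, j + (n - l)) = (if i = j then 1 else 0)"
  shows "rank_ge n l M"
proof -
  let ?P = "select_rows l n (\<lambda>i. i) :: 'a mat" and ?Q = "select_cols l n (\<lambda>j. j + (n - l)) :: 'a mat"
  have PM: "?P * M \<in> carrier_mat l n" using M by (intro mult_carrier_mat[of _ l n]) auto
  have "?P * M * ?Q = 1\<^sub>m l"
  proof (rule eq_matI)
    fix i j assume "i < dim_row (1\<^sub>m l :: 'a mat)" "j < dim_col (1\<^sub>m l :: 'a mat)"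
    then have ij: "i < l" "j < l" by auto
    have "(?P * M * ?Q) $$ (i, j) = (?P * M) $$ (i, j + (n - l))"
      using ij l by (intro mult_select_cols_index[OF PM]) auto
    also have "\<dots> = M $$ (i, j + (n - l))"
      using ij l by (intro select_rows_mult_index[OF M]) auto
    finally show "(?P * M * ?Q) $$ (i, j) = 1\<^sub>m l $$ (i, j)" using one ij by simp
  qed (use PM in \<open>auto simp: select_rows_def select_cols_def\<close>)
  then have "det (?P * M * ?Q) \<noteq> 0" by simp
  then show ?thesis unfolding rank_ge_def by (meson select_carrier)
qed

lemma rank_ge_corner: "l \<le> n \<Longrightarrow> rank_ge n l (corner_mat n l :: 'a::field mat)"
  by (rule rank_ge_upper_right) (auto simp: corner_mat_def)

text \<open>Subtracting multiples of row \<open>p\<close> removes the rank one summand from the first \<open>l\<close> rows, so that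
  the chosen minor becomes triangular.\<close>

lemma rank_ge_corner_plus_outer:
  fixes r q :: "'a::field vec"
  assumes r: "r \<in> carrier_vec n" and q: "q \<in> carrier_vec n" and "2 * l \<le> n"
    and p: "l \<le> p" "p < n - l" "r $ p \<noteq> 0" and s: "l \<le> s" "s < n - l" "q $ s \<noteq> 0" and "t \<noteq> 0"
  shows "rank_ge n (Suc l) (corner_mat n l + t \<cdot>\<^sub>m outer r q)"
proof -
  let ?M = "corner_mat n l + t \<cdot>\<^sub>m outer r q"
  \<comment> \<open>The minor takes rows \<open>0, ..., l - 1\<close> and \<open>p\<close>, and the
    last \<open>l\<close> columns together with \<open>s\<close>. After the row operations its
    diagonal consists of ones and the final entry \<open>t * (r $ p * q $ s)\<close>.\<close>
  define \<rho> where "\<rho> i = (if i < l then i else p)" for i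
  define \<kappa> where "\<kappa> j = (if j < l then j + (n - l) else s)" for j
  define P where "P = mat (Suc l) n (\<lambda>(i, k). (if k = \<rho> i then 1 else 0) - (if k = p then (if i < l then r $ i / r $ p else 0) else 0))"
  let ?Q = "select_cols (Suc l) n \<kappa> :: 'a mat"
  have M: "?M \<in> carrier_mat n n" using r q by simp
  have P: "P \<in> carrier_mat (Suc l) n" by (simp add: P_def)
  have PM: "P * ?M \<in> carrier_mat (Suc l) n" using P M by (rule mult_carrier_mat)
  have Mi: "?M $$ (i, j) = (if i < l \<and> j = i + (n - l) then 1 else 0) + t * (r $ i * q $ j)" if "i < n" "j < n" for i j
    using that r q by (simp add: corner_mat_def)
  have \<rho>: "\<rho> i < n" if "i < Suc l" for i using that p \<open>2 * l \<le> n\<close> by (auto simp: \<rho>_def)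
  have \<kappa>: "\<kappa> i < n" if "i < Suc l" for i using that s \<open>2 * l \<le> n\<close> by (auto simp: \<kappa>_def)
  have idx: "(P * ?M * ?Q) $$ (i, j) = ?M $$ (\<rho> i, \<kappa> j) - (if i < l then r $ i / r $ p else 0) * ?M $$ (p, \<kappa> j)"
    if ij: "i < Suc l" "j < Suc l" for i j
  proof -
    have "(P * ?M * ?Q) $$ (i, j) = (P * ?M) $$ (i, \<kappa> j)"
      using ij \<kappa> by (intro mult_select_cols_index[OF PM]) auto
    also have "\<dots> = (\<Sum>k<n. P $$ (i, k) * ?M $$ (k, \<kappa> j))"
      using ij \<kappa> by (intro index_mult_sum[OF P M]) auto
    also have "\<dots> = (\<Sum>k<n. (if k = \<rho> i then ?M $$ (k, \<kappa> j) else 0)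
        - (if k = p then (if i < l then r $ i / r $ p else 0) * ?M $$ (k, \<kappa> j) else 0))"
      using ij by (intro sum.cong) (auto simp: P_def left_diff_distrib)
    also have "\<dots> = ?M $$ (\<rho> i, \<kappa> j) - (if i < l then r $ i / r $ p else 0) * ?M $$ (p, \<kappa> j)"
      using \<rho>[OF ij(1)] p by (subst sum_subtractf, subst (1 2) sum.delta) auto
    finally show ?thesis .
  qed
  have "det (P * ?M * ?Q) = prod_list (diag_mat (P * ?M * ?Q))"
  proof (rule det_lower_triangular[of "Suc l"])
    fix i j assume ij: "i < j" "j < Suc l"
    then show "(P * ?M * ?Q) $$ (i, j) = 0"
      using p s \<rho>[of i] \<kappa>[of j] by (simp add: idx Mi) (auto simp: \<rho>_def \<kappa>_def field_simps)
  qed (use PM in \<open>auto intro: mult_carrier_mat[of _ _ n]\<close>)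
  also have "\<dots> = (\<Prod>i = 0..<Suc l. (P * ?M * ?Q) $$ (i, i))"
    unfolding prod_list_diag_prod using P by simp
  also have "\<dots> \<noteq> 0"
  proof -
    have "(P * ?M * ?Q) $$ (i, i) \<noteq> 0" if "i < Suc l" for i
      using p s \<rho>[OF that] \<kappa>[OF that] that \<open>t \<noteq> 0\<close> \<open>2 * l \<le> n\<close> by (simp add: idx Mi) (auto simp: \<rho>_def \<kappa>_def field_simps)
    then show ?thesis by simp
  qed
  finally show ?thesis
    unfolding rank_ge_def using P by (meson select_carrier)
qed

text \<open>Otherwise \<open>R = outer r e\<close> with \<open>e\<close> the first unit vector
  satisfies the conditions of \<open>deform_right_factor\<close>: \<open>C * R * A\<close> is the
  outer product of \<open>C r\<close> with the first row of the corner matrix, which is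
  nonzero.\<close>

lemma kernel_inclusion:
  fixes B C :: "'a::alg_closed_field mat"
  assumes adm: "admissible n l K" and T: "(corner_mat n l, B, C) \<in> N3 n" and l: "0 < l" "2 * l \<le> n"
    and CC: "C * C = 0\<^sub>m n n" and AB: "corner_mat n l * B = 0\<^sub>m n n" and AC: "corner_mat n l * C = 0\<^sub>m n n"
    and nK: "(corner_mat n l, B, C) \<notin> K"
    and r: "r \<in> carrier_vec n" and Jr: "corner_mat n l *\<^sub>v r = 0\<^sub>v n" and Br: "B *\<^sub>v r = 0\<^sub>v n"
  shows "C *\<^sub>v r = 0\<^sub>v n"
proof (rule ccontr)
  assume Cr: "C *\<^sub>v r \<noteq> 0\<^sub>v n"
  have c: "B \<in> carrier_mat n n" "C \<in> carrier_mat n n" using T by (auto simp: N3_iff)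
  let ?J = "corner_mat n l :: 'a mat" and ?e = "unit_vec n 0 :: 'a vec"
  let ?R = "outer r ?e"
  have R: "?R \<in> carrier_mat n n" using r by simp
  have "C * ?R * ?J = outer (C *\<^sub>v r) (?J\<^sup>T *\<^sub>v ?e)"
    using c r by (simp add: mult_outer[of _ n n] outer_mult[of _ n n])
  moreover have "?J\<^sup>T *\<^sub>v ?e \<noteq> 0\<^sub>v n"
  proof
    assume "?J\<^sup>T *\<^sub>v ?e = 0\<^sub>v n"
    then have "(?J\<^sup>T *\<^sub>v ?e) $ (n - l) = 0" using l by simp
    then show False using l by (subst (asm) corner_transpose_mult_vec) auto
  qed
  ultimately have "C * ?R * ?J \<noteq> 0\<^sub>m n n"
    using outer_nonzero[OF _ mult_mat_vec_carrier[of "?J\<^sup>T" n n ?e], of "C *\<^sub>v r" n] Cr c r by auto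
  moreover have "?J * ?R = 0\<^sub>m n n" "B * ?R = 0\<^sub>m n n"
    using Jr Br c r by (simp_all add: mult_outer[of _ n n])
  ultimately show False
    using deform_right_factor[OF adm T rank_ge_corner corner_square CC AB AC R] nK l by auto
qed

text \<open>The dual argument, with \<open>outer e q\<close>, where \<open>e\<close> is a unit
  vector that the corner matrix maps to the first one.\<close>

lemma cokernel_inclusion:
  fixes B C :: "'a::alg_closed_field mat"
  assumes adm: "admissible n l K" and T: "(corner_mat n l, B, C) \<in> N3 n" and l: "0 < l" "2 * l \<le> n"
    and CC: "C * C = 0\<^sub>m n n" and AB: "corner_mat n l * B = 0\<^sub>m n n" and AC: "corner_mat n l * C = 0\<^sub>m n n"
    and nK: "(corner_mat n l, B, C) \<notin> K"
    and q: "q \<in> carrier_vec n" and Jq: "(corner_mat n l)\<^sup>T *\<^sub>v q = 0\<^sub>v n" and Bq: "B\<^sup>T *\<^sub>v q = 0\<^sub>v n"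
  shows "C\<^sup>T *\<^sub>v q = 0\<^sub>v n"
proof (rule ccontr)
  assume Cq: "C\<^sup>T *\<^sub>v q \<noteq> 0\<^sub>v n"
  have c: "B \<in> carrier_mat n n" "C \<in> carrier_mat n n" using T by (auto simp: N3_iff)
  let ?J = "corner_mat n l :: 'a mat" and ?e = "unit_vec n (n - l) :: 'a vec"
  let ?R = "outer ?e q"
  have R: "?R \<in> carrier_mat n n" using q by simp
  have "?J * (?R * C) = outer (?J *\<^sub>v ?e) (C\<^sup>T *\<^sub>v q)"
    using c q by (simp add: mult_outer[of _ n n] outer_mult[of _ n n])
  moreover have "?J *\<^sub>v ?e \<noteq> 0\<^sub>v n"
  proof
    assume "?J *\<^sub>v ?e = 0\<^sub>v n"
    then have "(?J *\<^sub>v ?e) $ 0 = 0" using l by simp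
    then show False using l by (subst (asm) corner_mult_vec) auto
  qed
  ultimately have "?J * (?R * C) \<noteq> 0\<^sub>m n n"
    using outer_nonzero[OF mult_mat_vec_carrier[OF corner_mat_carrier unit_vec_carrier], of "C\<^sup>T *\<^sub>v q" n] Cq c q
    by auto
  moreover have "?R * ?J = 0\<^sub>m n n" "?R * B = 0\<^sub>m n n"
    using Jq Bq c q by (simp_all add: outer_mult[of _ n n])
  ultimately show False
    using deform_left_factor[OF adm T rank_ge_corner corner_square CC AB AC R] nK l by auto
qed

text \<open>If \<open>q\<close> and \<open>r\<close> are orthogonal, adding multiples of
  \<open>outer r q\<close> to \<open>A\<close> raises the rank to \<open>l + 1\<close>. Otherwise
  \<open>outer r q\<close> is not nilpotent, and a different perturbation, of \<open>C\<close>,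
  produces a nonzero square.\<close>

lemma deform_kernel_cokernel:
  fixes B C :: "'a::alg_closed_field mat"
  assumes adm: "admissible n l K" and T: "(corner_mat n l, B, C) \<in> N3 n" and l: "0 < l" "2 * l \<le> n"
    and AB: "corner_mat n l * B = 0\<^sub>m n n" and AC: "corner_mat n l * C = 0\<^sub>m n n"
    and r: "r \<in> carrier_vec n" "corner_mat n l *\<^sub>v r = 0\<^sub>v n" "B *\<^sub>v r = 0\<^sub>v n" "C *\<^sub>v r = 0\<^sub>v n"
    and q: "q \<in> carrier_vec n" "(corner_mat n l)\<^sup>T *\<^sub>v q = 0\<^sub>v n" "B\<^sup>T *\<^sub>v q = 0\<^sub>v n" "C\<^sup>T *\<^sub>v q = 0\<^sub>v n"
    and p: "l \<le> p" "p < n - l" "r $ p \<noteq> 0" and s: "l \<le> s" "s < n - l" "q $ s \<noteq> 0"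
  shows "(corner_mat n l, B, C) \<in> K"
proof -
  let ?J = "corner_mat n l :: 'a mat"
  have J: "?J \<in> carrier_mat n n" and B: "B \<in> carrier_mat n n" and C: "C \<in> carrier_mat n n"
    and com: "?J * B = B * ?J" "?J * C = C * ?J" "B * C = C * B" and nil: "nilpotent_mat C" "nilpotent_mat ?J"
    using T by (auto simp: N3_iff)
  have JJ: "?J * ?J = 0\<^sub>m n n" using l by (simp add: corner_square)
  have rk: "rank_ge n l ?J" using l by (simp add: rank_ge_corner)
  show ?thesis
  proof (cases "q \<bullet> r = 0")
    case False
    let ?u = "unit_vec n 0 :: 'a vec" and ?w = "unit_vec n (n - l) :: 'a vec"
    have Jw: "?J *\<^sub>v ?w = ?u"
      using l by (intro eq_vecI) (auto simp: corner_mult_vec simp del: index_mult_mat_vec)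
    have Ju': "?J\<^sup>T *\<^sub>v ?u = ?w"
      using l by (intro eq_vecI) (auto simp: corner_transpose_mult_vec simp del: index_mult_mat_vec)
    have Mu: "M *\<^sub>v ?u = 0\<^sub>v n" if "M \<in> carrier_mat n n" "M * ?J = 0\<^sub>m n n" for M
    proof -
      have "M *\<^sub>v ?u = (M * ?J) *\<^sub>v ?w"
        unfolding assoc_mult_mat_vec[OF that(1) J unit_vec_carrier] Jw ..
      then show ?thesis unfolding that(2) by (intro eq_vecI) auto
    qed
    have Mw: "M\<^sup>T *\<^sub>v ?w = 0\<^sub>v n" if "M \<in> carrier_mat n n" "?J * M = 0\<^sub>m n n" for M
    proof -
      have "M\<^sup>T *\<^sub>v ?w = (M\<^sup>T * ?J\<^sup>T) *\<^sub>v ?u"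
        using assoc_mult_mat_vec[of "M\<^sup>T" n n "?J\<^sup>T" n ?u] that(1) Ju' by simp
      also have "M\<^sup>T * ?J\<^sup>T = 0\<^sub>m n n"
        using transpose_mult[OF J that(1)] that(2) by simp
      finally show ?thesis by (intro eq_vecI) auto
    qed
    \<comment> \<open>The two summands are nilpotent and chained through
      \<open>q \<bullet> r\<close>: only the product of the first with the second survives in the
      square. Members of the triple annihilate \<open>?X\<close> on both sides, since
      \<open>?u\<close> lies in the image of the corner matrix and \<open>?w\<close> in that of its
      transpose.\<close>
    let ?X = "outer ?u q + outer r ?w"
    have Xc: "?X \<in> carrier_mat n n" using r q by simp
    have MX: "M * ?X = 0\<^sub>m n n" if "M \<in> carrier_mat n n" "M * ?J = 0\<^sub>m n n" "M *\<^sub>v r = 0\<^sub>v n" for M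
      using that Mu[OF that(1,2)] r q
      by (simp add: mult_add_distrib_mat[of _ n n _ n] mult_outer[of _ n n])
    have XM: "?X * M = 0\<^sub>m n n" if "M \<in> carrier_mat n n" "?J * M = 0\<^sub>m n n" "M\<^sup>T *\<^sub>v q = 0\<^sub>v n" for M
      using that Mw[OF that(1,2)] r q
      by (simp add: add_mult_distrib_mat[of _ n n _ _ n] outer_mult[of _ n n])
    have q0: "q \<bullet> ?u = 0"
    proof -
      have "((?J)\<^sup>T *\<^sub>v q) $ (n - l) = 0" using q l by simp
      then have "q $ 0 = 0" using q l by (subst (asm) corner_transpose_mult_vec) auto
      then show ?thesis using q l by simp
    qed
    have r0: "?w \<bullet> r = 0"
    proof -
      have "(?J *\<^sub>v r) $ 0 = 0" using r l by simp
      then have "r $ (n - l) = 0" using r l by (subst (asm) corner_mult_vec) auto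
      then show ?thesis using r l by simp
    qed
    have wu: "?w \<bullet> ?u = 0" using l by simp
    have XX: "?X * ?X = (q \<bullet> r) \<cdot>\<^sub>m outer ?u ?w"
    proof -
      have "?X * ?X = (outer ?u q * outer ?u q + outer r ?w * outer ?u q) + (outer ?u q * outer r ?w + outer r ?w * outer r ?w)"
        using r q by (simp add: mult_add_distrib_mat[of _ n n _ n] add_mult_distrib_mat[of _ n n _ _ n])
      also have "\<dots> = (q \<bullet> r) \<cdot>\<^sub>m outer ?u ?w"
        using r q by (simp add: outer_mult_outer[of _ n] q0 r0 wu zero_smult_mat[of _ n n])
      finally show ?thesis .
    qed
    have sq0: "?X * ?X \<noteq> 0\<^sub>m n n"
    proof -
      have "outer ((q \<bullet> r) \<cdot>\<^sub>v ?u) ?w \<noteq> 0\<^sub>m n n"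
      proof (rule outer_nonzero)
        show "(q \<bullet> r) \<cdot>\<^sub>v ?u \<noteq> 0\<^sub>v n"
        proof
          assume "(q \<bullet> r) \<cdot>\<^sub>v ?u = 0\<^sub>v n"
          then have "((q \<bullet> r) \<cdot>\<^sub>v ?u) $ 0 = 0\<^sub>v n $ 0" by simp
          then show False using False l by simp
        qed
      qed (use l in auto)
      then show ?thesis unfolding XX by simp
    qed
    have "?X * ?X * (?X * ?X) = 0\<^sub>m n n"
      unfolding XX by (simp add: mult_smult_distrib[of _ n n _ n] mult_smult_assoc_mat[of _ n n _ n]
          outer_mult_outer[of _ n] wu zero_smult_mat[of _ n n])
    then have nX: "nilpotent_mat ?X" using nilpotent_matI[OF Xc] by blast
    have CX: "C * ?X = 0\<^sub>m n n" and XC: "?X * C = 0\<^sub>m n n"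
      using MX[OF C _ r(4)] XM[OF C _ q(4)] AC com by auto
    show ?thesis
    proof (rule deform_third[OF adm T rk Xc])
      show "?J * ?X = ?X * ?J" using MX[OF J JJ r(2)] XM[OF J JJ q(2)] by simp
      show "B * ?X = ?X * B" using MX[OF B _ r(3)] XM[OF B AB q(3)] AB com by simp
      show "nilpotent_mat (C + t \<cdot>\<^sub>m ?X)" for t
      proof (rule nilpotent_mat_add[of _ n])
        show "C * (t \<cdot>\<^sub>m ?X) = (t \<cdot>\<^sub>m ?X) * C"
          using mult_smult_distrib[OF C Xc] mult_smult_assoc_mat[OF Xc C] CX XC by simp
        show "nilpotent_mat (t \<cdot>\<^sub>m ?X)" by (rule nilpotent_mat_smult[OF Xc nX])
      qed (use C Xc nil in auto)
      show "C * ?X + ?X * C \<noteq> 0\<^sub>m n n \<or> ?X * ?X \<noteq> 0\<^sub>m n n" using sq0 by blast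
    qed
  next
    case True
    let ?Z = "outer r q"
    have Z: "?Z \<in> carrier_mat n n" using r q by simp
    have MZ: "M * ?Z = 0\<^sub>m n n" if "M \<in> carrier_mat n n" "M *\<^sub>v r = 0\<^sub>v n" for M
      using that r q by (simp add: mult_outer[of _ n n])
    have ZM: "?Z * M = 0\<^sub>m n n" if "M \<in> carrier_mat n n" "M\<^sup>T *\<^sub>v q = 0\<^sub>v n" for M
      using that r q by (simp add: outer_mult[of _ n n])
    have ZZ: "?Z * ?Z = 0\<^sub>m n n"
      using True r q by (simp add: outer_mult_outer[of _ n] zero_smult_mat[of _ n n])
    have inK: "(?J + t \<cdot>\<^sub>m ?Z, B, C) \<in> K" if "t \<noteq> 0" for t
    proof -
      have "nilpotent_mat (?J + t \<cdot>\<^sub>m ?Z)"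
        by (rule nilpotent_line[OF J Z JJ ZZ]) (use ZM[OF J q(2)] r q in simp)
      moreover have "B * (?J + t \<cdot>\<^sub>m ?Z) = (?J + t \<cdot>\<^sub>m ?Z) * B"
        by (rule commute_line[OF B J Z]) (use com MZ[OF B r(3)] ZM[OF B q(3)] in auto)
      moreover have "C * (?J + t \<cdot>\<^sub>m ?Z) = (?J + t \<cdot>\<^sub>m ?Z) * C"
        by (rule commute_line[OF C J Z]) (use com MZ[OF C r(4)] ZM[OF C q(4)] in auto)
      ultimately have N: "(?J + t \<cdot>\<^sub>m ?Z, B, C) \<in> N3 n"
        using T Z unfolding N3_iff by simp
      have "?J + t \<cdot>\<^sub>m ?Z \<in> carrier_mat n n" using Z by simp
      then have "?J + t \<cdot>\<^sub>m ?Z \<in> triple_span (?J + t \<cdot>\<^sub>m ?Z, B, C)"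
        using triple_span_members(1) B C by blast
      moreover have "good_mat n l (?J + t \<cdot>\<^sub>m ?Z)"
        unfolding good_mat_def using rank_ge_corner_plus_outer[OF r(1) q(1) l(2) p s that] by blast
      ultimately show ?thesis using admissible_good[OF adm N] by blast
    qed
    have "B + t \<cdot>\<^sub>m 0\<^sub>m n n = B" "C + t \<cdot>\<^sub>m 0\<^sub>m n n = C" for t using B C by auto
    then have "infinite {t. (?J + t \<cdot>\<^sub>m ?Z, B + t \<cdot>\<^sub>m 0\<^sub>m n n, C + t \<cdot>\<^sub>m 0\<^sub>m n n) \<in> K}"
      using inK by (intro infinite_cofinite_alg_closed[of "{0}"]) auto
    then show ?thesis
      using admissible_line[OF adm J B C Z zero_carrier_mat zero_carrier_mat] by blast
  qed
qed

text \<open>Image contained in the image of \<open>corner_mat\<close>, that is, in the first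
  \<open>l\<close> coordinates, and these coordinates annihilated; for \<open>2 * l \<le> n\<close>
  this is a block of size \<open>l\<close> by \<open>n - l\<close> in the upper right
  corner.\<close>

definition corner_supported :: "nat \<Rightarrow> nat \<Rightarrow> 'a::zero mat \<Rightarrow> bool" where
  "corner_supported n l B \<longleftrightarrow> (\<forall>i<n. \<forall>j<n. l \<le> i \<or> j < l \<longrightarrow> B $$ (i, j) = 0)"

text \<open>The hypothesis \<open>ker\<close> says that the common kernel of \<open>A\<close> and
  \<open>B\<close> lies in the first \<open>l\<close> coordinates. The columns of \<open>B\<close>
  and \<open>C\<close> belong to this kernel, which bounds their rows; the columns below
  \<open>l\<close> vanish because \<open>B * A = C * A = 0\<close>.\<close>

lemma corner_supported_if_kernel:
  fixes B C :: "'a::alg_closed_field mat"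
  assumes adm: "admissible n l K" and T: "(corner_mat n l, B, C) \<in> N3 n" and l: "0 < l" "2 * l \<le> n"
    and BB: "B * B = 0\<^sub>m n n" and CC: "C * C = 0\<^sub>m n n"
    and AB: "corner_mat n l * B = 0\<^sub>m n n" and AC: "corner_mat n l * C = 0\<^sub>m n n"
    and nK: "(corner_mat n l, B, C) \<notin> K"
    and ker: "\<And>r i. r \<in> carrier_vec n \<Longrightarrow> corner_mat n l *\<^sub>v r = 0\<^sub>v n \<Longrightarrow> B *\<^sub>v r = 0\<^sub>v n \<Longrightarrow>
      l \<le> i \<Longrightarrow> i < n \<Longrightarrow> r $ i = 0"
  shows "corner_supported n l B" "corner_supported n l C" "2 * l < n \<Longrightarrow> \<exists>i<l. B $$ (i, l) \<noteq> 0"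
proof -
  let ?J = "corner_mat n l :: 'a mat"
  have J: "?J \<in> carrier_mat n n" and B: "B \<in> carrier_mat n n" and C: "C \<in> carrier_mat n n"
    and com: "?J * B = B * ?J" "?J * C = C * ?J"
    using T by (auto simp: N3_iff)
  have sup: "corner_supported n l M"
    if M: "M \<in> carrier_mat n n" and JM: "?J * M = 0\<^sub>m n n" and BM: "B * M = 0\<^sub>m n n" and MJ: "M * ?J = 0\<^sub>m n n" for M
    unfolding corner_supported_def
  proof (intro allI impI)
    fix i j assume ij: "i < n" "j < n" "l \<le> i \<or> j < l"
    show "M $$ (i, j) = 0"
    proof (cases "j < l")
      case True
      then show ?thesis
        using mult_corner_index[OF M _ ij(1), of l j] MJ l ij by simp
    next
      case False
      have col: "N *\<^sub>v col M j = 0\<^sub>v n" if "N \<in> carrier_mat n n" "N * M = 0\<^sub>m n n" for N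
      proof -
        have "N *\<^sub>v col M j = col (N * M) j"
          by (rule col_mult2[OF that(1) M ij(2), symmetric])
        then show ?thesis using that(2) ij by simp
      qed
      have "col M j $ i = 0"
        using ker[of "col M j" i] col[OF J JM] col[OF B BM] M ij False by auto
      then show ?thesis using M ij by simp
    qed
  qed
  \<comment> \<open>Kernel inclusion with \<open>B\<close> and \<open>C\<close> exchanged. It
    applies to the columns of \<open>C\<close>, as \<open>A * C = 0\<close> and
    \<open>C * C = 0\<close>.\<close>
  have BC: "B *\<^sub>v r = 0\<^sub>v n" if "r \<in> carrier_vec n" "?J *\<^sub>v r = 0\<^sub>v n" "C *\<^sub>v r = 0\<^sub>v n" for r
    using kernel_inclusion[OF admissible_swap[OF adm] N3_swap[OF T] l BB AC AB _ that] nK by simp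
  have "B * C = 0\<^sub>m n n"
  proof (rule eq_matI)
    fix i j assume "i < dim_row (0\<^sub>m n n :: 'a mat)" "j < dim_col (0\<^sub>m n n :: 'a mat)"
    then have ij: "i < n" "j < n" by auto
    have "?J *\<^sub>v col C j = col (?J * C) j" "C *\<^sub>v col C j = col (C * C) j" using C ij by auto
    then have "B *\<^sub>v col C j = 0\<^sub>v n"
      using BC[of "col C j"] AC CC C ij by simp
    moreover have "(B * C) $$ (i, j) = (B *\<^sub>v col C j) $ i" using B C ij by simp
    ultimately show "(B * C) $$ (i, j) = 0\<^sub>m n n $$ (i, j)" using ij by simp
  qed (use B C in auto)
  then show "corner_supported n l C" using sup[OF C AC] AC com by simp
  show supB: "corner_supported n l B" using sup[OF B AB BB] AB com by simp
  show "\<exists>i<l. B $$ (i, l) \<noteq> 0" if ln: "2 * l < n"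
  proof (rule ccontr)
    assume neg: "\<not> ?thesis"
    \<comment> \<open>The first coordinate of the middle block: it is in the kernel of the corner
      matrix but outside its image, so \<open>B\<close> cannot annihilate it.\<close>
    let ?r = "unit_vec n l :: 'a vec"
    have "?J *\<^sub>v ?r = 0\<^sub>v n"
      using ln by (intro eq_vecI) (auto simp: corner_mult_vec simp del: index_mult_mat_vec)
    moreover have "B *\<^sub>v ?r = 0\<^sub>v n"
    proof (rule eq_vecI)
      fix i assume i: "i < dim_vec (0\<^sub>v n :: 'a vec)"
      then have "(B *\<^sub>v ?r) $ i = B $$ (i, l)" using B ln by simp
      also have "\<dots> = 0"
        using neg supB i ln unfolding corner_supported_def by (cases "i < l") auto
      finally show "(B *\<^sub>v ?r) $ i = 0\<^sub>v n $ i" using i by simp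
    qed (use B in simp)
    ultimately have "?r $ l = 0" using ker[of ?r l] ln by simp
    then show False using ln by simp
  qed
qed

text \<open>Turns kernel vectors of the reflected matrix into cokernel vectors of the original
  one.\<close>

lemma flip_mult_vec_zero:
  fixes M :: "'a::comm_ring_1 mat"
  assumes M: "M \<in> carrier_mat n n" and r: "r \<in> carrier_vec n" and "flip n M *\<^sub>v r = 0\<^sub>v n"
  shows "M\<^sup>T *\<^sub>v (reversal n *\<^sub>v r) = 0\<^sub>v n"
proof -
  let ?W = "reversal n :: 'a mat"
  have W: "?W \<in> carrier_mat n n" by simp
  have MT: "M\<^sup>T \<in> carrier_mat n n" using M by simp
  have Wr: "?W *\<^sub>v r \<in> carrier_vec n" by (rule mult_mat_vec_carrier[OF W r])
  have MWr: "M\<^sup>T *\<^sub>v (?W *\<^sub>v r) \<in> carrier_vec n" by (rule mult_mat_vec_carrier[OF MT Wr])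
  have "flip n M *\<^sub>v r = ?W *\<^sub>v (M\<^sup>T *\<^sub>v (?W *\<^sub>v r))"
    unfolding flip_def assoc_mult_mat_vec[OF mult_carrier_mat[OF W MT] W r] assoc_mult_mat_vec[OF W MT Wr] ..
  then have "?W *\<^sub>v 0\<^sub>v n = ?W *\<^sub>v (?W *\<^sub>v (M\<^sup>T *\<^sub>v (?W *\<^sub>v r)))"
    using assms(3) by simp
  also have "\<dots> = M\<^sup>T *\<^sub>v (?W *\<^sub>v r)"
    using MWr unfolding assoc_mult_mat_vec[OF W W MWr, symmetric] reversal_involution by simp
  finally have "M\<^sup>T *\<^sub>v (?W *\<^sub>v r) = ?W *\<^sub>v 0\<^sub>v n" by simp
  also have "\<dots> = 0\<^sub>v n" by (intro eq_vecI) auto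
  finally show ?thesis .
qed

text \<open>A common kernel vector and a common cokernel vector, each with a nonzero entry in the
  middle block, cannot coexist outside \<open>K\<close>. If the first exists, the second does not,
  and this absence is the kernel condition for the reflected triple.\<close>

lemma corner_supported_or_flip:
  fixes B C :: "'a::alg_closed_field mat"
  assumes adm: "admissible n l K" and T: "(corner_mat n l, B, C) \<in> N3 n" and l: "0 < l" "2 * l \<le> n"
    and nK: "(corner_mat n l, B, C) \<notin> K"
  shows "corner_supported n l B \<and> corner_supported n l C \<and> (2 * l < n \<longrightarrow> (\<exists>i<l. B $$ (i, l) \<noteq> 0)) \<or>
    corner_supported n l (flip n B) \<and> corner_supported n l (flip n C) \<and>
      (2 * l < n \<longrightarrow> (\<exists>i<l. flip n B $$ (i, l) \<noteq> 0))"
proof -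
  let ?J = "corner_mat n l :: 'a mat"
  have J: "?J \<in> carrier_mat n n" and B: "B \<in> carrier_mat n n" and C: "C \<in> carrier_mat n n"
    using T by (auto simp: N3_iff)
  have JJ: "?J * ?J = 0\<^sub>m n n" using l by (simp add: corner_square)
  have rk: "rank_ge n l ?J" using l by (simp add: rank_ge_corner)
  have BB: "B * B = 0\<^sub>m n n" and CC: "C * C = 0\<^sub>m n n"
    using admissible_square[OF adm T _ rk] triple_span_members[OF J B C] nK by blast+
  note JB = annihilates_or_deforms(1)[OF adm T rk JJ BB CC nK]
  note JC = annihilates_or_deforms(2)[OF adm T rk JJ BB CC nK]
  show ?thesis
  proof (cases "\<exists>r i. r \<in> carrier_vec n \<and> ?J *\<^sub>v r = 0\<^sub>v n \<and> B *\<^sub>v r = 0\<^sub>v n \<and> l \<le> i \<and> i < n \<and> r $ i \<noteq> 0")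
    case False
    then show ?thesis
      using corner_supported_if_kernel[OF adm T l BB CC JB JC nK] by blast
  next
    case True
    then obtain r p where r: "r \<in> carrier_vec n" "?J *\<^sub>v r = 0\<^sub>v n" "B *\<^sub>v r = 0\<^sub>v n" and p: "l \<le> p" "p < n" "r $ p \<noteq> 0"
      by blast
    \<comment> \<open>The corner matrix annihilates \<open>r\<close>, so the last \<open>l\<close>
      entries of \<open>r\<close> are zero.\<close>
    have "p < n - l"
    proof (rule ccontr)
      assume np: "\<not> p < n - l"
      define i where "i = p - (n - l)"
      have i: "p = i + (n - l)" "i < l" using np p l by (auto simp: i_def)
      have "(?J *\<^sub>v r) $ i = 0" using r(2) i l by simp
      then show False
        using i p l r(1) by (subst (asm) corner_mult_vec) auto
    qed
    have Cr: "C *\<^sub>v r = 0\<^sub>v n"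
      using kernel_inclusion[OF adm T l CC JB JC nK r] .
    \<comment> \<open>The entries below \<open>l\<close> vanish since \<open>q\<close> is in the
      cokernel of the corner matrix; a nonzero middle entry would pair with \<open>r\<close> in
      \<open>deform_kernel_cokernel\<close>.\<close>
    have q: "q $ s = 0" if q: "q \<in> carrier_vec n" "?J\<^sup>T *\<^sub>v q = 0\<^sub>v n" "B\<^sup>T *\<^sub>v q = 0\<^sub>v n" and s: "s < n - l" for q s
    proof (cases "s < l")
      case True
      define j where "j = s + (n - l)"
      have j: "n - l \<le> j" "j < n" "j - (n - l) = s" using True l by (auto simp: j_def)
      have "(?J\<^sup>T *\<^sub>v q) $ j = 0" using q(2) j by simp
      then show ?thesis
        using j l q(1) by (subst (asm) corner_transpose_mult_vec) auto
    next
      case False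
      show ?thesis
      proof (rule ccontr)
        assume "q $ s \<noteq> 0"
        moreover have "C\<^sup>T *\<^sub>v q = 0\<^sub>v n"
          using cokernel_inclusion[OF adm T l CC JB JC nK q] .
        ultimately have "(?J, B, C) \<in> K"
          using deform_kernel_cokernel[OF adm T l JB JC r Cr q _ p(1) \<open>p < n - l\<close> p(3) _ s] False by simp
        then show False using nK by simp
      qed
    qed
    have fJ: "flip n ?J = ?J" using l by (simp add: flip_corner)
    let ?K = "{(A, B, C). (flip n A, flip n B, flip n C) \<in> K}"
    have adm': "admissible n l ?K" by (rule admissible_flip[OF adm])
    have T': "(?J, flip n B, flip n C) \<in> N3 n" using N3_flip[OF T] unfolding fJ .
    have inv: "flip n (flip n M) = M" if "M \<in> carrier_mat n n" for M :: "'a mat"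
      using that flip_carrier[OF that] by (intro eq_matI) (auto simp: flip_index)
    have nK': "(?J, flip n B, flip n C) \<notin> ?K" using nK inv[OF B] inv[OF C] by (simp add: fJ)
    have f0: "flip n (0\<^sub>m n n) = (0\<^sub>m n n :: 'a mat)" by (simp add: flip_def)
    have BB': "flip n B * flip n B = 0\<^sub>m n n" and CC': "flip n C * flip n C = 0\<^sub>m n n"
      using flip_mult[OF B B] flip_mult[OF C C] BB CC f0 by simp_all
    note JB' = annihilates_or_deforms(1)[OF adm' T' rk JJ BB' CC' nK']
    note JC' = annihilates_or_deforms(2)[OF adm' T' rk JJ BB' CC' nK']
    have ker: "r $ i = 0" if r: "r \<in> carrier_vec n" "?J *\<^sub>v r = 0\<^sub>v n" "flip n B *\<^sub>v r = 0\<^sub>v n"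
      and i: "l \<le> i" "i < n" for r i
    proof -
      let ?q = "reversal n *\<^sub>v r"
      have q_idx: "?q $ k = r $ (n - Suc k)" if "k < n" for k
      proof -
        have "?q $ k = (\<Sum>j<n. (if j = n - Suc k then r $ j else 0))"
          using that by (subst mult_vec_sum[OF reversal_carrier r(1) that])
            (intro sum.cong, auto simp: reversal_def)
        then show ?thesis using that by (simp add: sum.delta)
      qed
      have "?q \<in> carrier_vec n" by (rule mult_mat_vec_carrier[OF reversal_carrier r(1)])
      moreover have "?J\<^sup>T *\<^sub>v ?q = 0\<^sub>v n" using flip_mult_vec_zero[OF J r(1)] r(2) fJ by simp
      moreover have "B\<^sup>T *\<^sub>v ?q = 0\<^sub>v n" using flip_mult_vec_zero[OF B r(1,3)] .
      ultimately have "?q $ (n - Suc i) = 0" using q[of ?q "n - Suc i"] i l by simp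
      then show ?thesis using q_idx[of "n - Suc i"] i by simp
    qed
    show ?thesis
      using corner_supported_if_kernel[OF adm' T' l BB' CC' JB' JC' nK'] ker by blast
  qed
qed

section \<open>Corner blocks in even dimension\<close>

definition upper_block :: "nat \<Rightarrow> 'a::zero mat \<Rightarrow> 'a mat \<Rightarrow> 'a mat \<Rightarrow> 'a mat" where
  "upper_block l a b d = four_block_mat a b (0\<^sub>m l l) d"

lemma upper_block_carrier [simp]:
  "a \<in> carrier_mat l l \<Longrightarrow> d \<in> carrier_mat l l \<Longrightarrow> upper_block l a b d \<in> carrier_mat (l + l) (l + l)"
  unfolding upper_block_def by (rule four_block_carrier_mat)

lemma upper_block_mult:
  fixes a :: "'a::field mat"
  assumes "a \<in> carrier_mat l l" "b \<in> carrier_mat l l" "d \<in> carrier_mat l l"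
    "a' \<in> carrier_mat l l" "b' \<in> carrier_mat l l" "d' \<in> carrier_mat l l"
  shows "upper_block l a b d * upper_block l a' b' d' = upper_block l (a * a') (a * b' + b * d') (d * d')"
  unfolding upper_block_def using assms
  by (subst mult_four_block_mat[of _ l l _ l _ l _ _ l _ l]) (auto simp: mult_carrier_mat[of _ l l _ l])

lemma upper_block_add_smult:
  fixes a :: "'a::field mat"
  assumes "a \<in> carrier_mat l l" "b \<in> carrier_mat l l" "d \<in> carrier_mat l l"
    "a' \<in> carrier_mat l l" "b' \<in> carrier_mat l l" "d' \<in> carrier_mat l l"
  shows "upper_block l a b d + t \<cdot>\<^sub>m upper_block l a' b' d' =
    upper_block l (a + t \<cdot>\<^sub>m a') (b + t \<cdot>\<^sub>m b') (d + t \<cdot>\<^sub>m d')"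
  unfolding upper_block_def using assms by (intro eq_matI) auto

lemma upper_block_eq_iff:
  assumes "a \<in> carrier_mat l l" "b \<in> carrier_mat l l" "d \<in> carrier_mat l l"
    "a' \<in> carrier_mat l l" "b' \<in> carrier_mat l l" "d' \<in> carrier_mat l l"
    and eq: "upper_block l a b d = upper_block l a' b' d'"
  shows "b = b'"
proof (rule eq_matI)
  fix i j assume "i < dim_row b'" "j < dim_col b'"
  then show "b $$ (i, j) = b' $$ (i, j)"
    using arg_cong[OF eq, of "\<lambda>M. M $$ (i, j + l)"] assms(1-6) by (simp add: upper_block_def)
qed (use assms in auto)

lemma pow_mat_add:
  assumes M: "M \<in> carrier_mat n n"
  shows "M ^\<^sub>m (i + j) = M ^\<^sub>m i * M ^\<^sub>m j"
proof (induction j)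
  case (Suc j)
  have "M ^\<^sub>m (i + Suc j) = (M ^\<^sub>m i * M ^\<^sub>m j) * M" using Suc by simp
  also have "\<dots> = M ^\<^sub>m i * (M ^\<^sub>m j * M)"
    by (rule assoc_mult_mat[OF pow_carrier_mat[OF M] pow_carrier_mat[OF M] M])
  finally show ?case by simp
qed (use M pow_carrier_mat[OF M, of i] in simp)

text \<open>The \<open>k\<close>-th power has zero diagonal blocks, and then its square
  vanishes.\<close>

lemma nilpotent_upper_block:
  fixes a :: "'a::field mat"
  assumes a: "a \<in> carrier_mat l l" and b: "b \<in> carrier_mat l l" and "nilpotent_mat a"
  shows "nilpotent_mat (upper_block l a b a)"
proof -
  let ?M = "upper_block l a b a"
  have M: "?M \<in> carrier_mat (l + l) (l + l)" using a by simp
  obtain k where k: "a ^\<^sub>m k = 0\<^sub>m l l" using assms nilpotent_mat_iff by blast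
  have "\<exists>b'\<in>carrier_mat l l. ?M ^\<^sub>m j = upper_block l (a ^\<^sub>m j) b' (a ^\<^sub>m j)" for j
  proof (induction j)
    case 0
    have "?M ^\<^sub>m 0 = upper_block l (a ^\<^sub>m 0) (0\<^sub>m l l) (a ^\<^sub>m 0)"
      using a M by (intro eq_matI) (auto simp: upper_block_def)
    then show ?case by (intro bexI[of _ "0\<^sub>m l l"]) auto
  next
    case (Suc j)
    then obtain b' where b': "b' \<in> carrier_mat l l" "?M ^\<^sub>m j = upper_block l (a ^\<^sub>m j) b' (a ^\<^sub>m j)" by blast
    have aj: "a ^\<^sub>m j \<in> carrier_mat l l" using a by simp
    have "?M ^\<^sub>m Suc j = upper_block l (a ^\<^sub>m Suc j) (a ^\<^sub>m j * b + b' * a) (a ^\<^sub>m Suc j)"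
      using b'(2) upper_block_mult[OF aj b'(1) aj a b a] by simp
    moreover have "a ^\<^sub>m j * b + b' * a \<in> carrier_mat l l"
      using aj b'(1) a b by (simp add: mult_carrier_mat[of _ l l _ l])
    ultimately show ?case by blast
  qed
  then obtain b' where b': "b' \<in> carrier_mat l l" "?M ^\<^sub>m k = upper_block l (0\<^sub>m l l) b' (0\<^sub>m l l)"
    using k by metis
  have "?M ^\<^sub>m (k + k) = upper_block l (0\<^sub>m l l) (0\<^sub>m l l) (0\<^sub>m l l)"
    unfolding pow_mat_add[OF M] b'(2)
    using upper_block_mult[OF zero_carrier_mat b'(1) zero_carrier_mat zero_carrier_mat b'(1) zero_carrier_mat] b'(1)
    by simp
  also have "\<dots> = 0\<^sub>m (l + l) (l + l)" by (intro eq_matI) (auto simp: upper_block_def)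
  finally show ?thesis using nilpotent_mat_iff[OF M] by blast
qed

text \<open>A diagonal nilpotent matrix over a field is zero.\<close>

lemma nilpotent_nonzero_off_diagonal:
  fixes N :: "'a::field mat"
  assumes N: "N \<in> carrier_mat l l" and N0: "N \<noteq> 0\<^sub>m l l" and k: "N ^\<^sub>m k = 0\<^sub>m l l"
  obtains i j where "i < l" "j < l" "i \<noteq> j" "N $$ (i, j) \<noteq> 0"
proof -
  have "\<exists>i<l. \<exists>j<l. i \<noteq> j \<and> N $$ (i, j) \<noteq> 0"
  proof (rule ccontr)
    assume neg: "\<not> ?thesis"
    then have diag: "N = mat_diag l (\<lambda>i. N $$ (i, i))"
      using N by (intro eq_matI) (auto simp: mat_diag_def)
    have "mat_diag l (\<lambda>i. (N $$ (i, i)) ^ k) = 0\<^sub>m l l"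
      using k mat_diag_pow[of l "\<lambda>i. N $$ (i, i)" k] diag by simp
    then have "mat_diag l (\<lambda>i. (N $$ (i, i)) ^ k) $$ (i, i) = 0" if "i < l" for i
      using that by simp
    then have "N $$ (i, i) = 0" if "i < l" for i
      using that by (simp add: mat_diag_def)
    then have "N $$ (i, j) = 0" if "i < l" "j < l" for i j
      using neg that by (cases "i = j") auto
    then have "N = 0\<^sub>m l l"
      using N by (intro eq_matI) auto
    then show False using N0 by simp
  qed
  then show thesis using that by blast
qed

text \<open>Block matrices with equal diagonal blocks \<open>N\<close> commute with
  \<open>?J\<close>, and with \<open>?C\<close> because \<open>N\<close> commutes with
  \<open>c\<close>. The upper right block is free, and it is used to make the square nonzero even
  when \<open>N * N = 0\<close>. The matrix that moves is \<open>?B\<close>.\<close>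

lemma deform_even_corner:
  fixes b c :: "'a::alg_closed_field mat"
  assumes adm: "admissible (l + l) l K" and bc: "b \<in> carrier_mat l l" "c \<in> carrier_mat l l"
    and T: "(upper_block l (0\<^sub>m l l) (1\<^sub>m l) (0\<^sub>m l l), upper_block l (0\<^sub>m l l) b (0\<^sub>m l l),
      upper_block l (0\<^sub>m l l) c (0\<^sub>m l l)) \<in> N3 (l + l)"
    and rk: "rank_ge (l + l) l (upper_block l (0\<^sub>m l l) (1\<^sub>m l) (0\<^sub>m l l) :: 'a mat)" and "commutes_nilpotent l c"
  shows "(upper_block l (0\<^sub>m l l) (1\<^sub>m l) (0\<^sub>m l l), upper_block l (0\<^sub>m l l) b (0\<^sub>m l l),
      upper_block l (0\<^sub>m l l) c (0\<^sub>m l l)) \<in> K" (is "(?J, ?B, ?C) \<in> K")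
proof -
  obtain N k where N: "N \<in> carrier_mat l l" "N \<noteq> 0\<^sub>m l l" "N ^\<^sub>m k = 0\<^sub>m l l" "c * N = N * c"
    using assms(6) unfolding commutes_nilpotent_def by blast
  obtain i j where ij: "i < l" "j < l" "i \<noteq> j" "N $$ (i, j) \<noteq> 0"
    using nilpotent_nonzero_off_diagonal[OF N(1-3)] by blast
  \<comment> \<open>At the entry \<open>(j, j)\<close> the product \<open>E * N\<close> has the
    value \<open>N $$ (i, j)\<close>, while \<open>N * E\<close> contributes 0 because
    \<open>i\<close> and \<open>j\<close> differ; the anticommutator is therefore nonzero in
    characteristic 2 as well.\<close>
  define E where "E = (outer (unit_vec l j) (unit_vec l i) :: 'a mat)"
  have E: "E \<in> carrier_mat l l" by (simp add: E_def)
  let ?X = "upper_block l N E N"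
  have X: "?X \<in> carrier_mat (l + l) (l + l)" using N by simp
  note z = zero_carrier_mat[of l l] and one = one_carrier_mat[of l]
  have anti: "N * E + E * N \<noteq> 0\<^sub>m l l"
  proof
    assume "N * E + E * N = 0\<^sub>m l l"
    then have "(N * E + E * N) $$ (j, j) = 0" using ij by simp
    moreover have "N * E = outer (N *\<^sub>v unit_vec l j) (unit_vec l i)" "E * N = outer (unit_vec l j) (N\<^sup>T *\<^sub>v unit_vec l i)"
      using N by (simp_all add: E_def mult_outer[of _ l l] outer_mult[of _ l l])
    ultimately show False using ij N(1) by simp
  qed
  have swap: "(?J, ?B, ?C) \<in> K" if "(?J, ?C, ?B) \<in> {(A, B, C). (A, C, B) \<in> K}"
    using that by simp
  show ?thesis
  proof (rule swap, rule deform_third[OF admissible_swap[OF adm] N3_swap[OF T] rk X])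
    show "?J * ?X = ?X * ?J"
      using upper_block_mult[OF z one z N(1) E N(1)] upper_block_mult[OF N(1) E N(1) z one z] N(1) E by simp
    show "?C * ?X = ?X * ?C"
      using upper_block_mult[OF z bc(2) z N(1) E N(1)] upper_block_mult[OF N(1) E N(1) z bc(2) z] N(1,4) E bc by simp
    have nN: "nilpotent_mat N" using N nilpotent_mat_iff by blast
    show "nilpotent_mat (?B + t \<cdot>\<^sub>m ?X)" for t
      unfolding upper_block_add_smult[OF z bc(1) z N(1) E N(1)]
      using N(1) E bc(1) nilpotent_mat_smult[OF N(1) nN, of t] by (intro nilpotent_upper_block) auto
    have "?X * ?X = upper_block l (N * N) (N * E + E * N) (N * N)"
      by (rule upper_block_mult[OF N(1) E N(1) N(1) E N(1)])
    moreover have "upper_block l (N * N) (N * E + E * N) (N * N) \<noteq> upper_block l (0\<^sub>m l l) (0\<^sub>m l l) (0\<^sub>m l l)"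
      using upper_block_eq_iff[OF _ _ _ z z z, of "N * N" "N * E + E * N" "N * N"] anti N(1) E by auto
    moreover have "upper_block l (0\<^sub>m l l) (0\<^sub>m l l) (0\<^sub>m l l) = (0\<^sub>m (l + l) (l + l) :: 'a mat)"
      by (intro eq_matI) (auto simp: upper_block_def)
    ultimately show "?B * ?X + ?X * ?B \<noteq> 0\<^sub>m (l + l) (l + l) \<or> ?X * ?X \<noteq> 0\<^sub>m (l + l) (l + l)" by simp
  qed
qed

lemma commutes_nilpotent_smult:
  fixes M :: "'a::field mat"
  assumes M: "M \<in> carrier_mat l l" and "a \<noteq> 0" and "commutes_nilpotent l (a \<cdot>\<^sub>m M)"
  shows "commutes_nilpotent l M"
proof -
  obtain N k where N: "N \<in> carrier_mat l l" "N \<noteq> 0\<^sub>m l l" "N ^\<^sub>m k = 0\<^sub>m l l" "(a \<cdot>\<^sub>m M) * N = N * (a \<cdot>\<^sub>m M)"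
    using assms(3) unfolding commutes_nilpotent_def by blast
  have "a \<cdot>\<^sub>m (M * N) = a \<cdot>\<^sub>m (N * M)"
    using N(4) unfolding mult_smult_assoc_mat[OF M N(1)] mult_smult_distrib[OF N(1) M] .
  then have "inverse a \<cdot>\<^sub>m (a \<cdot>\<^sub>m (M * N)) = inverse a \<cdot>\<^sub>m (a \<cdot>\<^sub>m (N * M))" by simp
  then have "M * N = N * M" using \<open>a \<noteq> 0\<close> by (simp add: smult_smult_mat)
  then show ?thesis unfolding commutes_nilpotent_def using N by blast
qed

lemma corner_supported_block:
  fixes B :: "'a::field mat"
  assumes B: "B \<in> carrier_mat (l + l) (l + l)" and sup: "corner_supported (l + l) l B"
  shows "B = upper_block l (0\<^sub>m l l) (mat l l (\<lambda>(i, j). B $$ (i, j + l))) (0\<^sub>m l l)"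
  using B sup unfolding corner_supported_def upper_block_def by (intro eq_matI) auto

text \<open>A shear, or an exchange when \<open>y = 0\<close>, makes the distinguished member of the
  pencil the third matrix of the triple.\<close>

lemma even_corner_case:
  fixes B C :: "'a::alg_closed_field mat"
  assumes adm: "admissible (l + l) l K" and T: "(corner_mat (l + l) l, B, C) \<in> N3 (l + l)" and l: "l \<ge> 2"
    and sup: "corner_supported (l + l) l B" "corner_supported (l + l) l C"
  shows "(corner_mat (l + l) l, B, C) \<in> K"
proof -
  let ?n = "l + l"
  let ?U = "\<lambda>b :: 'a mat. upper_block l (0\<^sub>m l l) b (0\<^sub>m l l)"
  define b where "b = mat l l (\<lambda>(i, j). B $$ (i, j + l))"
  define c where "c = mat l l (\<lambda>(i, j). C $$ (i, j + l))"
  have b: "b \<in> carrier_mat l l" and c: "c \<in> carrier_mat l l" by (auto simp: b_def c_def)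
  have Bc: "B \<in> carrier_mat ?n ?n" and Cc: "C \<in> carrier_mat ?n ?n" using T by (auto simp: N3_iff)
  have B: "B = ?U b" and C: "C = ?U c"
    unfolding b_def c_def using corner_supported_block Bc Cc sup by blast+
  have J: "corner_mat ?n l = ?U (1\<^sub>m l)"
    by (intro eq_matI) (auto simp: corner_mat_def upper_block_def)
  have rk: "rank_ge ?n l (?U (1\<^sub>m l))" using rank_ge_corner[of l ?n, where 'a = 'a] by (simp add: J)
  note z = zero_carrier_mat[of l l]
  note T' = T[unfolded J B C]
  obtain x y where xy: "x \<noteq> 0 \<or> y \<noteq> 0" and cn: "commutes_nilpotent l (x \<cdot>\<^sub>m b + y \<cdot>\<^sub>m c)"
    using pencil_commutes_nilpotent[OF b c l] by blast
  show ?thesis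
  proof (cases "y = 0")
    case True
    then have "x \<cdot>\<^sub>m b + y \<cdot>\<^sub>m c = x \<cdot>\<^sub>m b" using b c by (simp add: zero_smult_mat[of _ l l])
    then have "commutes_nilpotent l b"
      using commutes_nilpotent_smult[OF b, of x] cn xy True by simp
    then show ?thesis
      using deform_even_corner[OF admissible_swap[OF adm] c b N3_swap[OF T'] rk] by (simp add: J B C)
  next
    case False
    define s where "s = x / y"
    let ?c = "c + s \<cdot>\<^sub>m b"
    have c': "?c \<in> carrier_mat l l" using b c by simp
    have "x \<cdot>\<^sub>m b + y \<cdot>\<^sub>m c = y \<cdot>\<^sub>m ?c"
      using b c False by (intro eq_matI) (auto simp: s_def field_simps)
    then have cn': "commutes_nilpotent l ?c"
      using commutes_nilpotent_smult[OF c' False] cn by simp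
    have Uc: "?U c + s \<cdot>\<^sub>m ?U b = ?U ?c"
      using upper_block_add_smult[OF z c z z b z, of s] by simp
    have T'': "(?U (1\<^sub>m l), ?U b, ?U ?c) \<in> N3 ?n"
      using N3_shear[OF T', of s] unfolding Uc .
    have "(?U (1\<^sub>m l), ?U b, ?U ?c) \<in> {(A, B, C). (A, B, C + (-s) \<cdot>\<^sub>m B) \<in> K}"
      by (rule deform_even_corner[OF admissible_shear[OF adm] b c' T'' rk cn'])
    moreover have "?U ?c + (-s) \<cdot>\<^sub>m ?U b = ?U c"
    proof -
      have "?c + (-s) \<cdot>\<^sub>m b = c" using b c by (intro eq_matI) auto
      then show ?thesis using upper_block_add_smult[OF z c' z z b z, of "-s"] by simp
    qed
    ultimately show ?thesis by (simp add: J B C)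
  qed
qed

section \<open>Corner blocks with a common kernel\<close>

lemma mult_line_outer:
  fixes M M' :: "'a::field mat"
  assumes M: "M \<in> carrier_mat n n" and M': "M' \<in> carrier_mat n n" and MM': "M * M' = 0\<^sub>m n n"
    and v: "v \<in> carrier_vec n" and u: "u \<in> carrier_vec n" and u': "u' \<in> carrier_vec n"
    and vM': "M'\<^sup>T *\<^sub>v v = 0\<^sub>v n" and vu': "v \<bullet> u' = 0"
  shows "(M + t \<cdot>\<^sub>m outer u v) * (M' + t \<cdot>\<^sub>m outer u' v) = t \<cdot>\<^sub>m outer (M *\<^sub>v u') v"
proof -
  have X: "outer u v \<in> carrier_mat n n" and X': "outer u' v \<in> carrier_mat n n" using u u' v by auto
  have XM': "outer u v * M' = 0\<^sub>m n n"
    using outer_mult[OF M' v, of u] vM' u v by simp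
  have XX': "outer u v * outer u' v = 0\<^sub>m n n"
    using outer_mult_outer[OF v u', of u v] vu' zero_smult_mat[OF outer_carrier[OF u v]] by simp
  have "(M + t \<cdot>\<^sub>m outer u v) * (M' + t \<cdot>\<^sub>m outer u' v) =
      (M * M' + t \<cdot>\<^sub>m (outer u v * M')) + t \<cdot>\<^sub>m (M * outer u' v + t \<cdot>\<^sub>m (outer u v * outer u' v))"
    using M M' X X' by (simp add: add_mult_distrib_mat[of _ n n _ _ n] mult_add_distrib_mat[of _ n n _ n]
        mult_smult_distrib[of _ n n _ n] mult_smult_assoc_mat[of _ n n _ n])
  also have "\<dots> = t \<cdot>\<^sub>m (M * outer u' v)"
    unfolding MM' XM' XX' using mult_carrier_mat[OF M X'] by simp
  finally show ?thesis using mult_outer[OF M u', of v] by simp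
qed

text \<open>Products of two deformed matrices collapse to
  \<open>t \<cdot>\<^sub>m outer (M *\<^sub>v w') v\<close>, because \<open>v\<close> annihilates
  the triple from the left and is orthogonal to all \<open>ui\<close>. Commutation is thus exactly
  the three vector equations, and \<open>nz\<close> gives a nonzero square of the first or second
  matrix.\<close>

lemma deform_outer:
  fixes A B C :: "'a::alg_closed_field mat"
  assumes adm: "admissible n l K"
    and A: "A \<in> carrier_mat n n" and B: "B \<in> carrier_mat n n" and C: "C \<in> carrier_mat n n"
    and prods: "\<And>M N. M \<in> {A, B, C} \<Longrightarrow> N \<in> {A, B, C} \<Longrightarrow> M * N = 0\<^sub>m n n"
    and v: "v \<in> carrier_vec n" "v \<noteq> 0\<^sub>v n" and vM: "\<And>M. M \<in> {A, B, C} \<Longrightarrow> M\<^sup>T *\<^sub>v v = 0\<^sub>v n"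
    and u: "u1 \<in> carrier_vec n" "u2 \<in> carrier_vec n" "u3 \<in> carrier_vec n"
    and vu: "v \<bullet> u1 = 0" "v \<bullet> u2 = 0" "v \<bullet> u3 = 0"
    and eqs: "A *\<^sub>v u2 = B *\<^sub>v u1" "A *\<^sub>v u3 = C *\<^sub>v u1" "B *\<^sub>v u3 = C *\<^sub>v u2"
    and nz: "A *\<^sub>v u1 \<noteq> 0\<^sub>v n \<or> B *\<^sub>v u2 \<noteq> 0\<^sub>v n"
    and rk: "\<And>t. rank_ge n l (A + t \<cdot>\<^sub>m outer u1 v)"
  shows "(A, B, C) \<in> K"
proof -
  define A' where "A' t = A + t \<cdot>\<^sub>m outer u1 v" for t
  define B' where "B' t = B + t \<cdot>\<^sub>m outer u2 v" for t
  define C' where "C' t = C + t \<cdot>\<^sub>m outer u3 v" for t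
  have carr: "A' t \<in> carrier_mat n n" "B' t \<in> carrier_mat n n" "C' t \<in> carrier_mat n n" for t
    using A B C u v by (auto simp: A'_def B'_def C'_def)
  have prod: "(M + t \<cdot>\<^sub>m outer w v) * (M' + t \<cdot>\<^sub>m outer w' v) = t \<cdot>\<^sub>m outer (M *\<^sub>v w') v"
    if "M \<in> {A, B, C}" "M' \<in> {A, B, C}" "w \<in> {u1, u2, u3}" "w' \<in> {u1, u2, u3}" for M M' w w' t
    using that A B C u vu prods[OF that(1,2)] vM[OF that(2)] v by (intro mult_line_outer[of _ n]) auto
  have nil: "nilpotent_mat (M + t \<cdot>\<^sub>m outer w v)"
    if M: "M \<in> {A, B, C}" and w: "w \<in> {u1, u2, u3}" for M w t
  proof (rule nilpotent_matI)
    have Mc: "M \<in> carrier_mat n n" and wc: "w \<in> carrier_vec n" using M w A B C u by auto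
    show "M + t \<cdot>\<^sub>m outer w v \<in> carrier_mat n n" using Mc wc v by simp
    have Mw: "M *\<^sub>v w \<in> carrier_vec n" by (rule mult_mat_vec_carrier[OF Mc wc])
    \<comment> \<open>The image of \<open>M\<close> is annihilated by \<open>v\<close>, so the
      square, a multiple of \<open>outer (M *\<^sub>v w) v\<close>, has itself square zero.\<close>
    have "v \<bullet> (M *\<^sub>v w) = 0"
      using transpose_vec_mult_scalar[OF Mc wc v(1)] vM[OF M] wc by simp
    then have "outer (M *\<^sub>v w) v * outer (M *\<^sub>v w) v = 0\<^sub>m n n"
      using outer_mult_outer[OF v(1) Mw, of "M *\<^sub>v w" v] zero_smult_mat[OF outer_carrier[OF Mw v(1)]] by simp
    then show "(M + t \<cdot>\<^sub>m outer w v) * (M + t \<cdot>\<^sub>m outer w v) * ((M + t \<cdot>\<^sub>m outer w v) * (M + t \<cdot>\<^sub>m outer w v)) = 0\<^sub>m n n"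
      unfolding prod[OF M M w w] using outer_carrier[OF Mw v(1)]
      by (simp add: mult_smult_distrib[of _ n n _ n] mult_smult_assoc_mat[of _ n n _ n])
  qed
  have N: "(A' t, B' t, C' t) \<in> N3 n" for t
    unfolding N3_iff using carr[of t] nil prod eqs unfolding A'_def B'_def C'_def by simp
  have inK: "(A' t, B' t, C' t) \<in> K" if "t \<noteq> 0" for t
  proof -
    have sq: "t \<cdot>\<^sub>m outer w v \<noteq> 0\<^sub>m n n" if "w \<in> carrier_vec n" "w \<noteq> 0\<^sub>v n" for w
    proof
      assume "t \<cdot>\<^sub>m outer w v = 0\<^sub>m n n"
      then have "inverse t \<cdot>\<^sub>m (t \<cdot>\<^sub>m outer w v) = 0\<^sub>m n n" by simp
      then have "outer w v = 0\<^sub>m n n" using \<open>t \<noteq> 0\<close> by (simp add: smult_smult_mat)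
      then show False using outer_nonzero[OF that(1) v(1) that(2) v(2)] by simp
    qed
    have "A' t * A' t \<noteq> 0\<^sub>m n n \<or> B' t * B' t \<noteq> 0\<^sub>m n n"
      using nz sq[OF mult_mat_vec_carrier[OF A u(1)]] sq[OF mult_mat_vec_carrier[OF B u(2)]]
        prod[of A A u1 u1 t] prod[of B B u2 u2 t] unfolding A'_def B'_def by auto
    then show ?thesis
      using admissible_square[OF adm N triple_span_members(1)[OF carr] _ triple_span_members(1)[OF carr]]
        admissible_square[OF adm N triple_span_members(1)[OF carr] _ triple_span_members(2)[OF carr]]
        rk[of t, folded A'_def] by blast
  qed
  have "infinite {t. (A' t, B' t, C' t) \<in> K}"
    using inK by (intro infinite_cofinite_alg_closed[of "{0}"]) auto
  then show ?thesis
    unfolding A'_def B'_def C'_def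
    by (rule admissible_line[OF adm A B C outer_carrier[OF u(1) v(1)] outer_carrier[OF u(2) v(1)]
          outer_carrier[OF u(3) v(1)]])
qed

text \<open>The shape of \<open>v\<close> and of all \<open>ui\<close>: one coordinate of the middle
  block and the last \<open>l\<close>. The zeros in the first \<open>l\<close> coordinates make
  \<open>v\<close> annihilate every corner-supported matrix from the left and keep the identity
  block of \<open>A\<close> intact.\<close>

definition corner_vec :: "nat \<Rightarrow> nat \<Rightarrow> 'a::zero \<Rightarrow> (nat \<Rightarrow> 'a) \<Rightarrow> 'a vec" where
  "corner_vec n l a x = vec n (\<lambda>i. if i = l then a else if n - l \<le> i then x (i - (n - l)) else 0)"

lemma corner_vec_carrier [simp]: "corner_vec n l a x \<in> carrier_vec n"
  by (simp add: corner_vec_def)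

lemma sum_corner_vec:
  fixes g :: "nat \<Rightarrow> 'a::comm_ring_1"
  assumes "2 * l < n"
  shows "(\<Sum>j<n. g j * corner_vec n l a x $ j) = g l * a + (\<Sum>k<l. g (k + (n - l)) * x k)"
proof -
  have "(\<Sum>j<n. g j * corner_vec n l a x $ j) =
      (\<Sum>j = 0..<n - l. g j * corner_vec n l a x $ j) + (\<Sum>j = n - l..<n. g j * corner_vec n l a x $ j)"
    using assms by (simp add: sum.atLeastLessThan_concat flip: atLeast0LessThan)
  also have "(\<Sum>j = 0..<n - l. g j * corner_vec n l a x $ j) = (\<Sum>j = 0..<n - l. if j = l then g j * a else 0)"
    by (intro sum.cong) (auto simp: corner_vec_def)
  also have "\<dots> = g l * a" using assms by (subst sum.delta) auto
  also have "(\<Sum>j = n - l..<n. g j * corner_vec n l a x $ j) =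
      (\<Sum>j = 0 + (n - l)..<l + (n - l). g j * corner_vec n l a x $ j)"
    using assms by simp
  also have "\<dots> = (\<Sum>k = 0..<l. g (k + (n - l)) * corner_vec n l a x $ (k + (n - l)))"
    by (rule sum.shift_bounds_nat_ivl)
  also have "\<dots> = (\<Sum>k<l. g (k + (n - l)) * x k)"
    using assms by (intro sum.cong) (auto simp: corner_vec_def)
  finally show ?thesis .
qed

lemma corner_supported_mult_corner_vec:
  fixes M :: "'a::comm_ring_1 mat"
  assumes M: "M \<in> carrier_mat n n" and sup: "corner_supported n l M" and l: "2 * l < n" and i: "i < n"
  shows "(M *\<^sub>v corner_vec n l a x) $ i =
    (if i < l then M $$ (i, l) * a + (\<Sum>k<l. M $$ (i, k + (n - l)) * x k) else 0)"
proof -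
  have "(M *\<^sub>v corner_vec n l a x) $ i = M $$ (i, l) * a + (\<Sum>k<l. M $$ (i, k + (n - l)) * x k)"
    using mult_vec_sum[OF M corner_vec_carrier i] sum_corner_vec[OF l, of "\<lambda>j. M $$ (i, j)"] by simp
  moreover have "M $$ (i, l) * a + (\<Sum>k<l. M $$ (i, k + (n - l)) * x k) = 0" if "\<not> i < l"
    using that sup i l unfolding corner_supported_def by (auto intro!: sum.neutral)
  ultimately show ?thesis by simp
qed

lemma corner_supported_prod:
  fixes M N :: "'a::comm_ring_1 mat"
  assumes M: "M \<in> carrier_mat n n" "corner_supported n l M" and N: "N \<in> carrier_mat n n" "corner_supported n l N"
  shows "M * N = 0\<^sub>m n n"
proof (rule eq_matI)
  fix i j assume "i < dim_row (0\<^sub>m n n :: 'a mat)" "j < dim_col (0\<^sub>m n n :: 'a mat)"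
  then have ij: "i < n" "j < n" by auto
  have "M $$ (i, k) * N $$ (k, j) = 0" if "k < n" for k
    using M(2) N(2) that ij unfolding corner_supported_def by (cases "k < l") auto
  then show "(M * N) $$ (i, j) = 0\<^sub>m n n $$ (i, j)"
    using index_mult_sum[OF M(1) N(1) ij] ij by simp
qed (use M N in auto)

text \<open>Writing the unknown triple as \<open>u1 = (a, x)\<close>, \<open>u2 = (a2, B u1)\<close>, \<open>u3 = (a3, C u1)\<close>, the first \<open>l\<close> rows
  express \<open>B u3 = C u2\<close> and the last three rows express that \<open>v = y e_l + z e_(p + (n - l))\<close> annihilates
  \<open>u1\<close>, \<open>u2\<close> and \<open>u3\<close>.\<close>

definition incidence_mat :: "nat \<Rightarrow> nat \<Rightarrow> nat \<Rightarrow> 'a::comm_ring_1 mat \<Rightarrow> 'a mat \<Rightarrow> 'a \<Rightarrow> 'a \<Rightarrow> 'a mat" where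
  "incidence_mat n l p B C y z = mat (l + 3) (l + 3) (\<lambda>(r, k).
    if r < l then
      if k < l then \<Sum>j<l. B $$ (r, j + (n - l)) * C $$ (j, k + (n - l)) - C $$ (r, j + (n - l)) * B $$ (j, k + (n - l))
      else if k = l then \<Sum>j<l. B $$ (r, j + (n - l)) * C $$ (j, l) - C $$ (r, j + (n - l)) * B $$ (j, l)
      else if k = l + 1 then - C $$ (r, l) else B $$ (r, l)
    else if r = l then if k < l then (if k = p then z else 0) else if k = l then y else 0
    else if r = l + 1 then
      if k < l then z * B $$ (p, k + (n - l)) else if k = l then z * B $$ (p, l) else if k = l + 1 then y else 0
    else
      if k < l then z * C $$ (p, k + (n - l)) else if k = l then z * C $$ (p, l) else if k = l + 2 then y else 0)"

text \<open>Only the last three rows contain \<open>y\<close> and \<open>z\<close>, and they do so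
  linearly; scaling them shows that the determinant is a cubic form.\<close>

lemma incidence_mat_singular:
  fixes B C :: "'a::alg_closed_field mat"
  obtains y z where "y \<noteq> 0 \<or> z \<noteq> 0" and "det (incidence_mat n l p B C y z) = 0"
proof -
  let ?f = "\<lambda>y z. det (incidence_mat n l p B C y z)"
  have hom: "?f (c * y) (c * z) = c ^ 3 * ?f y z" for c y z
  proof -
    let ?a = "\<lambda>r. if r < l then 1 else c"
    have "incidence_mat n l p B C (c * y) (c * z) =
        mat (l + 3) (l + 3) (\<lambda>(r, k). ?a r * 1 * incidence_mat n l p B C y z $$ (r, k))"
      unfolding incidence_mat_def by (intro eq_matI) auto
    then have "?f (c * y) (c * z) = (\<Prod>r<l + 3. ?a r) * (\<Prod>k<l + 3. 1)
        * det (mat (l + 3) (l + 3) (\<lambda>(r, k). incidence_mat n l p B C y z $$ (r, k)))"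
      by (simp only: det_scale_rows_cols)
    moreover have "mat (l + 3) (l + 3) (\<lambda>(r, k). incidence_mat n l p B C y z $$ (r, k)) = incidence_mat n l p B C y z"
      by (intro eq_matI) (auto simp: incidence_mat_def)
    moreover have "(\<Prod>r<l + 3. ?a r) = c ^ 3"
      by (simp add: numeral_3_eq_3 power3_eq_cube)
    ultimately show ?thesis by simp
  qed
  have "polyfn (\<lambda>r. ?f r 1)" "polyfn (\<lambda>s. ?f 1 s)"
    unfolding incidence_mat_def
    by (rule polyfn_det[of "l + 3"], rule polymat_mat, intro polyfn_if polyfn_mult polyfn_const polyfn_id)+
  then show thesis
    using homogeneous_zero[of ?f 3] hom that by auto
qed

text \<open>The position \<open>p\<close> is tied to a nonzero entry in column \<open>l\<close> of
  \<open>B\<close>. With \<open>v\<close> supported at \<open>l\<close> and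
  \<open>p + (n - l)\<close>, this entry guarantees that a nontrivial solution of the linear system
  yields a nonzero square.\<close>

lemma tall_corner_case:
  fixes B C :: "'a::alg_closed_field mat"
  assumes adm: "admissible n l K" and T: "(corner_mat n l, B, C) \<in> N3 n" and l: "2 * l < n"
    and sup: "corner_supported n l B" "corner_supported n l C"
    and p: "p < l" "B $$ (p, l) \<noteq> 0"
  shows "(corner_mat n l, B, C) \<in> K"
proof -
  let ?J = "corner_mat n l :: 'a mat" and ?m = "n - l"
  have J: "?J \<in> carrier_mat n n" and B: "B \<in> carrier_mat n n" and C: "C \<in> carrier_mat n n"
    using T by (auto simp: N3_iff)
  have supJ: "corner_supported n l ?J"
    using l by (auto simp: corner_supported_def corner_mat_def)
  obtain y z where yz: "y \<noteq> 0 \<or> z \<noteq> 0" and "det (incidence_mat n l p B C y z) = 0"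
    using incidence_mat_singular by blast
  then obtain w where w: "w \<in> carrier_vec (l + 3)" "w \<noteq> 0\<^sub>v (l + 3)"
    and \<Omega>w: "incidence_mat n l p B C y z *\<^sub>v w = 0\<^sub>v (l + 3)"
    using det_0_iff_vec_prod_zero_field[of "incidence_mat n l p B C y z" "l + 3"] by (auto simp: incidence_mat_def)
  define x where "x k = w $ k" for k
  define a where "a = w $ l"
  define a2 where "a2 = w $ (l + 1)"
  define a3 where "a3 = w $ (l + 2)"
  have row: "(\<Sum>k<l. incidence_mat n l p B C y z $$ (r, k) * x k) + incidence_mat n l p B C y z $$ (r, l) * a
      + incidence_mat n l p B C y z $$ (r, l + 1) * a2 + incidence_mat n l p B C y z $$ (r, l + 2) * a3 = 0"
    if "r < l + 3" for r
  proof -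
    have "incidence_mat n l p B C y z \<in> carrier_mat (l + 3) (l + 3)" by (simp add: incidence_mat_def)
    from mult_vec_sum[OF this w(1) that] have "(\<Sum>k<l + 3. incidence_mat n l p B C y z $$ (r, k) * w $ k) = 0"
      using \<Omega>w that by simp
    then show ?thesis by (simp add: numeral_3_eq_3 x_def a_def a2_def a3_def)
  qed
  define u1 where "u1 = corner_vec n l a x"
  define Bu where "Bu i = B $$ (i, l) * a + (\<Sum>k<l. B $$ (i, k + ?m) * x k)" for i
  define Cu where "Cu i = C $$ (i, l) * a + (\<Sum>k<l. C $$ (i, k + ?m) * x k)" for i
  \<comment> \<open>The corner matrix shifts the last \<open>l\<close> coordinates to the first
    \<open>l\<close>, so placing the entries of \<open>B u1\<close> and \<open>C u1\<close> there
    solves two of the three equations, with \<open>a2\<close> and \<open>a3\<close> still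
    free.\<close>
  define u2 where "u2 = corner_vec n l a2 Bu"
  define u3 where "u3 = corner_vec n l a3 Cu"
  define v where "v = corner_vec n l y (\<lambda>i. if i = p then z else 0)"
  have u: "u1 \<in> carrier_vec n" "u2 \<in> carrier_vec n" "u3 \<in> carrier_vec n" and vc: "v \<in> carrier_vec n"
    by (auto simp: u1_def u2_def u3_def v_def)
  have Bu1: "(B *\<^sub>v u1) $ i = (if i < l then Bu i else 0)" if "i < n" for i
    using corner_supported_mult_corner_vec[OF B sup(1) l that] by (simp add: u1_def Bu_def)
  have Cu1: "(C *\<^sub>v u1) $ i = (if i < l then Cu i else 0)" if "i < n" for i
    using corner_supported_mult_corner_vec[OF C sup(2) l that] by (simp add: u1_def Cu_def)
  have Jcv: "(?J *\<^sub>v corner_vec n l d f) $ i = (if i < l then f i else 0)" if "i < n" for d f i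
  proof -
    have "(?J *\<^sub>v corner_vec n l d f) $ i = (if i < l then corner_vec n l d f $ (i + ?m) else 0)"
      using that l by (subst corner_mult_vec) auto
    then show ?thesis using that l by (auto simp: corner_vec_def)
  qed
  have v_cv: "v \<bullet> corner_vec n l d f = y * d + z * f p" for d f
  proof -
    have "v \<bullet> corner_vec n l d f = (\<Sum>j<n. v $ j * corner_vec n l d f $ j)"
      by (simp add: scalar_prod_def atLeast0LessThan corner_vec_def)
    also have "\<dots> = v $ l * d + (\<Sum>k<l. v $ (k + ?m) * f k)" by (rule sum_corner_vec[OF l])
    also have "v $ l = y" using l by (simp add: v_def corner_vec_def)
    also have "(\<Sum>k<l. v $ (k + ?m) * f k) = (\<Sum>k<l. if k = p then z * f k else 0)"
      using l by (intro sum.cong) (auto simp: v_def corner_vec_def)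
    also have "\<dots> = z * f p" using p by (simp add: sum.delta)
    finally show ?thesis .
  qed
  have vu: "v \<bullet> u1 = 0" "v \<bullet> u2 = 0" "v \<bullet> u3 = 0"
  proof -
    have "(\<Sum>k<l. (if k = p then z else 0) * x k) + y * a = 0"
      using row[of l] by (simp add: incidence_mat_def)
    moreover have "(\<Sum>k<l. (if k = p then z else 0) * x k) = (\<Sum>k<l. if k = p then z * x k else 0)"
      by (intro sum.cong) auto
    ultimately show "v \<bullet> u1 = 0" using p by (simp add: u1_def v_cv sum.delta add.commute)
    have "(\<Sum>k<l. z * B $$ (p, k + ?m) * x k) + z * B $$ (p, l) * a + y * a2 = 0"
      using row[of "l + 1"] by (simp add: incidence_mat_def)
    then show "v \<bullet> u2 = 0" by (simp add: u2_def v_cv Bu_def algebra_simps sum_distrib_left)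
    have "(\<Sum>k<l. z * C $$ (p, k + ?m) * x k) + z * C $$ (p, l) * a + y * a3 = 0"
      using row[of "l + 2"] by (simp add: incidence_mat_def)
    then show "v \<bullet> u3 = 0" by (simp add: u3_def v_cv Cu_def algebra_simps sum_distrib_left)
  qed
  have eq1: "?J *\<^sub>v u2 = B *\<^sub>v u1"
    using B Jcv Bu1 by (intro eq_vecI) (simp_all add: u2_def del: index_mult_mat_vec)
  have eq2: "?J *\<^sub>v u3 = C *\<^sub>v u1"
    using C Jcv Cu1 by (intro eq_vecI) (simp_all add: u3_def del: index_mult_mat_vec)
  \<comment> \<open>The remaining equation. After substituting \<open>Bu\<close> and
    \<open>Cu\<close>, the coefficients of \<open>x\<close> are the entries of the commutator of the
    square blocks of \<open>B\<close> and \<open>C\<close>, as in the first \<open>l\<close> rows of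
    the incidence matrix.\<close>
  have BC_row: "B $$ (r, l) * a3 + (\<Sum>j<l. B $$ (r, j + ?m) * Cu j) = C $$ (r, l) * a2 + (\<Sum>j<l. C $$ (r, j + ?m) * Bu j)"
    if r: "r < l" for r
  proof -
    let ?D = "\<lambda>k. \<Sum>j<l. B $$ (r, j + ?m) * C $$ (j, k + ?m) - C $$ (r, j + ?m) * B $$ (j, k + ?m)"
    have "(\<Sum>k<l. ?D k * x k) + (\<Sum>j<l. B $$ (r, j + ?m) * C $$ (j, l) - C $$ (r, j + ?m) * B $$ (j, l)) * a
        - C $$ (r, l) * a2 + B $$ (r, l) * a3 = 0"
      using row[of r] r by (simp add: incidence_mat_def)
    moreover have "(\<Sum>k<l. ?D k * x k) = (\<Sum>j<l. \<Sum>k<l. (B $$ (r, j + ?m) * C $$ (j, k + ?m) - C $$ (r, j + ?m) * B $$ (j, k + ?m)) * x k)"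
      by (subst sum.swap) (simp add: sum_distrib_right)
    ultimately have "(\<Sum>j<l. \<Sum>k<l. (B $$ (r, j + ?m) * C $$ (j, k + ?m) - C $$ (r, j + ?m) * B $$ (j, k + ?m)) * x k)
        + (\<Sum>j<l. (B $$ (r, j + ?m) * C $$ (j, l) - C $$ (r, j + ?m) * B $$ (j, l)) * a)
        - C $$ (r, l) * a2 + B $$ (r, l) * a3 = 0"
      by (simp add: sum_distrib_right)
    moreover have "(\<Sum>j<l. B $$ (r, j + ?m) * Cu j) - (\<Sum>j<l. C $$ (r, j + ?m) * Bu j) =
        (\<Sum>j<l. \<Sum>k<l. (B $$ (r, j + ?m) * C $$ (j, k + ?m) - C $$ (r, j + ?m) * B $$ (j, k + ?m)) * x k)
        + (\<Sum>j<l. (B $$ (r, j + ?m) * C $$ (j, l) - C $$ (r, j + ?m) * B $$ (j, l)) * a)"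
      unfolding sum_subtractf[symmetric] sum.distrib[symmetric]
      by (intro sum.cong refl) (simp add: Bu_def Cu_def algebra_simps sum_subtractf sum_distrib_left)
    ultimately show ?thesis by (simp add: algebra_simps)
  qed
  have eq3: "B *\<^sub>v u3 = C *\<^sub>v u2"
    using B C corner_supported_mult_corner_vec[OF B sup(1) l] corner_supported_mult_corner_vec[OF C sup(2) l] BC_row
    by (intro eq_vecI) (simp_all add: u2_def u3_def del: index_mult_mat_vec)
  have v0: "v \<noteq> 0\<^sub>v n"
  proof
    assume v0: "v = 0\<^sub>v n"
    have "v $ l = y" "v $ (p + ?m) = z" using l p by (auto simp: v_def corner_vec_def)
    moreover have "v $ l = 0" "v $ (p + ?m) = 0" unfolding v0 using l p by auto
    ultimately show False using yz by simp
  qed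
  have vM: "M\<^sup>T *\<^sub>v v = 0\<^sub>v n" if M: "M \<in> carrier_mat n n" and supM: "corner_supported n l M" for M
  proof (rule eq_vecI)
    fix j assume "j < dim_vec (0\<^sub>v n :: 'a vec)"
    then have j: "j < n" by simp
    have MT: "M\<^sup>T \<in> carrier_mat n n" using M by simp
    have "(M\<^sup>T *\<^sub>v v) $ j = (\<Sum>i<n. M\<^sup>T $$ (j, i) * v $ i)" by (rule mult_vec_sum[OF MT vc j])
    also have "\<dots> = 0"
    proof (intro sum.neutral ballI)
      fix i assume "i \<in> {..<n}"
      then show "M\<^sup>T $$ (j, i) * v $ i = 0"
        using supM M j l unfolding corner_supported_def v_def corner_vec_def by (cases "i < l") auto
    qed
    finally show "(M\<^sup>T *\<^sub>v v) $ j = 0\<^sub>v n $ j" using j by simp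
  qed (use M in simp)
  have nz: "?J *\<^sub>v u1 \<noteq> 0\<^sub>v n \<or> B *\<^sub>v u2 \<noteq> 0\<^sub>v n"
  proof (rule ccontr)
    assume "\<not> ?thesis"
    \<comment> \<open>If both squares vanished, then \<open>x = 0\<close> by the first equation;
      orthogonality of \<open>v\<close> to \<open>u1\<close> and \<open>u2\<close> forces
      \<open>a = 0\<close>, whichever of \<open>y\<close> and \<open>z\<close> is nonzero; then
      \<open>B $$ (p, l)\<close> forces \<open>a2 = 0\<close> and, through row \<open>p\<close>,
      \<open>a3 = 0\<close>. This contradicts the choice of \<open>w\<close>.\<close>
    then have Ju: "?J *\<^sub>v u1 = 0\<^sub>v n" and Bu2: "B *\<^sub>v u2 = 0\<^sub>v n" by auto
    have x0: "x k = 0" if "k < l" for k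
      using Jcv[of k a x] Ju that l by (simp add: u1_def del: index_mult_mat_vec)
    have Bu_eq: "Bu i = B $$ (i, l) * a" and Cu_eq: "Cu i = C $$ (i, l) * a" for i
      using x0 by (simp_all add: Bu_def Cu_def)
    have "y * a = 0" using vu(1) x0[OF p(1)] by (simp add: u1_def v_cv)
    moreover have "y * a2 + z * (B $$ (p, l) * a) = 0" using vu(2) by (simp add: u2_def v_cv Bu_eq)
    ultimately have "a = 0" using yz p(2) by auto
    then have Bu0: "Bu i = 0" and Cu0: "Cu i = 0" for i using Bu_eq Cu_eq by auto
    have "(B *\<^sub>v u2) $ p = B $$ (p, l) * a2"
      using corner_supported_mult_corner_vec[OF B sup(1) l, of p a2 Bu] p l by (simp add: u2_def Bu0 del: index_mult_mat_vec)
    then have "a2 = 0" using Bu2 p l by simp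
    then have "a3 = 0" using BC_row[OF p(1)] Bu0 Cu0 p(2) by simp
    have "w $ k = 0" if kl: "k < l + 3" for k
    proof -
      consider "k < l" | "k = l" | "k = l + 1" | "k = l + 2" using kl by linarith
      then show ?thesis
        using x0 \<open>a = 0\<close> \<open>a2 = 0\<close> \<open>a3 = 0\<close> by cases (auto simp: x_def a_def a2_def a3_def)
    qed
    then have "w = 0\<^sub>v (l + 3)" using w(1) by (intro eq_vecI) auto
    then show False using w(2) by simp
  qed
  \<comment> \<open>The first \<open>l\<close> entries of \<open>u1\<close> are zero, so the
    perturbation does not touch the first \<open>l\<close> rows, and the identity minor survives for
    every \<open>t\<close>.\<close>
  have rk: "rank_ge n l (?J + t \<cdot>\<^sub>m outer u1 v)" for t
  proof (rule rank_ge_upper_right)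
    show "?J + t \<cdot>\<^sub>m outer u1 v \<in> carrier_mat n n" using u vc by simp
    fix i j assume ij: "i < l" "j < l"
    then have "u1 $ i = 0" using l by (simp add: u1_def corner_vec_def)
    then show "(?J + t \<cdot>\<^sub>m outer u1 v) $$ (i, j + ?m) = (if i = j then 1 else 0)"
      using ij l u(1) vc by (auto simp: corner_mat_def)
  qed (use l in simp)
  show ?thesis
  proof (rule deform_outer[OF adm J B C _ vc v0 _ u vu eq1 eq2 eq3 nz rk])
    fix M N assume "M \<in> {?J, B, C}" "N \<in> {?J, B, C}"
    then show "M * N = 0\<^sub>m n n"
      using corner_supported_prod J B C sup supJ by auto
  next
    fix M assume "M \<in> {?J, B, C}"
    then show "M\<^sup>T *\<^sub>v v = 0\<^sub>v n" using vM J B C sup supJ by auto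
  qed
qed

text \<open>The supported case is proved for an arbitrary admissible set, so that it applies both to
  \<open>K\<close> and, after reflection, to the preimage of \<open>K\<close>. Excluding
  \<open>n = 2\<close> leaves \<open>l \<ge> 2\<close> when there is no middle block.\<close>

lemma corner_triple_in_admissible:
  fixes B C :: "'a::alg_closed_field mat"
  assumes adm: "admissible n l K" and T: "(corner_mat n l, B, C) \<in> N3 n" and l: "0 < l" "2 * l \<le> n" and "n \<noteq> 2"
  shows "(corner_mat n l, B, C) \<in> K"
proof (rule ccontr)
  assume nK: "(corner_mat n l, B, C) \<notin> K"
  have key: "(corner_mat n l, X, Y) \<in> K'"
    if adm': "admissible n l K'" and T': "(corner_mat n l, X, Y) \<in> N3 n"
      and sup: "corner_supported n l X" "corner_supported n l Y" and ex: "2 * l < n \<longrightarrow> (\<exists>i<l. X $$ (i, l) \<noteq> 0)"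
    for K' :: "'a mat_triple set" and X Y
  proof (cases "2 * l < n")
    case True
    then show ?thesis using tall_corner_case[OF adm' T' True sup] ex by blast
  next
    case False
    then have "n = l + l" "l \<ge> 2" using l \<open>n \<noteq> 2\<close> by auto
    then show ?thesis using even_corner_case[of l K' X Y] adm' T' sup by simp
  qed
  have fJ: "flip n (corner_mat n l) = (corner_mat n l :: 'a mat)" using l by (simp add: flip_corner)
  have T': "(corner_mat n l, flip n B, flip n C) \<in> N3 n" using N3_flip[OF T] unfolding fJ .
  have inv: "flip n (flip n M) = M" if "M \<in> carrier_mat n n" for M :: "'a mat"
    using that flip_carrier[OF that] by (intro eq_matI) (auto simp: flip_index)
  have "B \<in> carrier_mat n n" "C \<in> carrier_mat n n" using T by (auto simp: N3_iff)
  then have "(corner_mat n l, flip n B, flip n C) \<notin> {(A, B, C). (flip n A, flip n B, flip n C) \<in> K}"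
    using nK inv by (simp add: fJ)
  then show False
    using corner_supported_or_flip[OF adm T l nK] key[OF adm T] key[OF admissible_flip[OF adm] T'] nK by blast
qed

section \<open>The closure of the one-regular triples\<close>

lemma polyfn_on_line:
  assumes "f \<in> polyfuns n"
    and "A \<in> carrier_mat n n" "B \<in> carrier_mat n n" "C \<in> carrier_mat n n"
    and "X \<in> carrier_mat n n" "Y \<in> carrier_mat n n" "Z \<in> carrier_mat n n"
  shows "polyfn (\<lambda>t. f (A + t \<cdot>\<^sub>m X, B + t \<cdot>\<^sub>m Y, C + t \<cdot>\<^sub>m Z))"
  using assms(1)
proof induction
  case (entry1 i j)
  then show ?case using polymat_index[OF polymat_line[OF assms(2,5)]] by simp
next
  case (entry2 i j)
  then show ?case using polymat_index[OF polymat_line[OF assms(3,6)]] by simp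
next
  case (entry3 i j)
  then show ?case using polymat_index[OF polymat_line[OF assms(4,7)]] by simp
qed (auto intro: polyfn_add polyfn_mult)

text \<open>On a line each defining polynomial becomes a polynomial in \<open>t\<close>; infinitely
  many zeros force it to vanish at \<open>t = 0\<close> too.\<close>

lemma closedin_zariski_line:
  fixes K :: "'a::alg_closed_field mat_triple set"
  assumes "closedin (zariski_topology n) K"
    and c: "A \<in> carrier_mat n n" "B \<in> carrier_mat n n" "C \<in> carrier_mat n n"
      "X \<in> carrier_mat n n" "Y \<in> carrier_mat n n" "Z \<in> carrier_mat n n"
    and inf: "infinite {t. (A + t \<cdot>\<^sub>m X, B + t \<cdot>\<^sub>m Y, C + t \<cdot>\<^sub>m Z) \<in> K}"
  shows "(A, B, C) \<in> K"
proof -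
  obtain P where P: "P \<subseteq> polyfuns n" "K = zero_locus n P"
    using assms(1) unfolding closedin_zariski_topology by blast
  have "f (A, B, C) = 0" if f: "f \<in> P" for f
  proof -
    let ?g = "\<lambda>t. f (A + t \<cdot>\<^sub>m X, B + t \<cdot>\<^sub>m Y, C + t \<cdot>\<^sub>m Z)"
    have "polyfn ?g" using polyfn_on_line[OF _ c] f P(1) by blast
    moreover have "{t. (A + t \<cdot>\<^sub>m X, B + t \<cdot>\<^sub>m Y, C + t \<cdot>\<^sub>m Z) \<in> K} \<subseteq> {t. ?g t = 0}"
      using f P(2) by (auto simp: zero_locus_def)
    then have "infinite {t. ?g t = 0}" using inf finite_subset by blast
    ultimately have "?g 0 = 0" by (rule polyfn_eq_at)
    moreover have "A + 0 \<cdot>\<^sub>m X = A" "B + 0 \<cdot>\<^sub>m Y = B" "C + 0 \<cdot>\<^sub>m Z = C"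
      using c by (simp_all add: zero_smult_mat[of _ n n])
    ultimately show ?thesis by simp
  qed
  then show ?thesis
    using c P(2) by (simp add: zero_locus_def mat_triples_def)
qed

lemma R3_subset_closure: "R3 n \<subseteq> zariski_topology n closure_of (R3 n :: 'a::field mat_triple set)"
  by (rule closure_of_subset) (auto simp: topspace_zariski_topology R3_def N3_def)

text \<open>The assumption asks for rank exactly \<open>l\<close> in its second alternative, while a
  certificate gives only a lower bound; a larger rank falls under the first alternative.\<close>

lemma admissible_closure:
  fixes l n :: nat
  assumes "\<And>T :: 'a::alg_closed_field mat_triple. T \<in> N3 n \<Longrightarrow>
      \<exists>M \<in> triple_span T. vec_space.rank n M \<ge> l + 1 \<or> (vec_space.rank n M = l \<and> M * M \<noteq> 0\<^sub>m n n) \<Longrightarrow>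
      T \<in> zariski_topology n closure_of R3 n"
  shows "admissible n l (zariski_topology n closure_of (R3 n :: 'a mat_triple set))"
  unfolding admissible_def
proof (intro conjI ballI impI)
  fix T :: "'a mat_triple"
  assume T: "T \<in> N3 n" and "\<exists>M\<in>triple_span T. good_mat n l M"
  then obtain M where M: "M \<in> triple_span T" "good_mat n l M" by blast
  obtain A B C where "T = (A, B, C)" by (cases T)
  then have "M \<in> carrier_mat n n"
    using M(1) T triple_span_carrier[of A n B C M] by (simp add: N3_iff)
  then have "vec_space.rank n M \<ge> l + 1 \<or> (vec_space.rank n M = l \<and> M * M \<noteq> 0\<^sub>m n n)"
    using M(2) rank_ge_imp_rank[of n "Suc l" M] rank_ge_imp_rank[of n l M]
    unfolding good_mat_def by fastforce
  then show "T \<in> zariski_topology n closure_of R3 n"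
    using assms[OF T] M(1) by blast
next
  fix A B C X Y Z :: "'a mat"
  assume "A \<in> carrier_mat n n" "B \<in> carrier_mat n n" "C \<in> carrier_mat n n"
    "X \<in> carrier_mat n n" "Y \<in> carrier_mat n n" "Z \<in> carrier_mat n n"
    "infinite {t. (A + t \<cdot>\<^sub>m X, B + t \<cdot>\<^sub>m Y, C + t \<cdot>\<^sub>m Z) \<in> zariski_topology n closure_of R3 n}"
  then show "(A, B, C) \<in> zariski_topology n closure_of R3 n"
    by (rule closedin_zariski_line[OF closedin_closure_of])
qed

section \<open>From the Jordan form to the corner matrix\<close>

lemma jordan_matrix_zero_blocks: "jordan_matrix (replicate m (1, 0 :: 'a::field)) = 0\<^sub>m m m"
proof (induction m)
  case 0
  then show ?case by (auto simp: jordan_matrix_def)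
next
  case (Suc m)
  have "sum_list (map fst (replicate m (1, 0 :: 'a))) = m"
    by (simp add: sum_list_replicate)
  then have "jordan_matrix (replicate (Suc m) (1, 0 :: 'a)) = four_block_mat (jordan_block 1 0) (0\<^sub>m 1 m) (0\<^sub>m m 1) (0\<^sub>m m m)"
    using jordan_matrix_Cons[of 1 "0 :: 'a" "replicate m (1, 0)"] Suc by simp
  also have "\<dots> = 0\<^sub>m (Suc m) (Suc m)"
    by (intro eq_matI) auto
  finally show ?case .
qed

lemma jordan_matrix_square_zero:
  "jordan_matrix (replicate l (2, 0) @ replicate m (1, 0 :: 'a::field)) =
    mat (2 * l + m) (2 * l + m) (\<lambda>(i, j). if j = Suc i \<and> even i \<and> i < 2 * l then 1 else 0)"
proof (induction l)
  case 0
  show ?case using jordan_matrix_zero_blocks[of m, where 'a = 'a] by (intro eq_matI) auto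
next
  case (Suc l)
  let ?n = "2 * l + m"
  have len: "sum_list (map fst (replicate l (2, 0 :: 'a) @ replicate m (1, 0))) = ?n"
    by (simp add: sum_list_replicate)
  have "jordan_matrix (replicate (Suc l) (2, 0) @ replicate m (1, 0 :: 'a)) =
      four_block_mat (jordan_block 2 0) (0\<^sub>m 2 ?n) (0\<^sub>m ?n 2)
        (mat ?n ?n (\<lambda>(i, j). if j = Suc i \<and> even i \<and> i < 2 * l then 1 else 0))"
    using jordan_matrix_Cons[of 2 "0 :: 'a" "replicate l (2, 0) @ replicate m (1, 0)"] len Suc by simp
  also have "\<dots> = mat (2 * Suc l + m) (2 * Suc l + m) (\<lambda>(i, j). if j = Suc i \<and> even i \<and> i < 2 * Suc l then 1 else 0)"
  proof (rule eq_matI)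
    fix i j
    assume "i < dim_row (mat (2 * Suc l + m) (2 * Suc l + m) (\<lambda>(i, j). if j = Suc i \<and> even i \<and> i < 2 * Suc l then 1 else (0::'a)))"
      "j < dim_col (mat (2 * Suc l + m) (2 * Suc l + m) (\<lambda>(i, j). if j = Suc i \<and> even i \<and> i < 2 * Suc l then 1 else (0::'a)))"
    then have ij: "i < ?n + 2" "j < ?n + 2" by auto
    consider "i < 2" | i' where "i = i' + 2" by (metis add.commute le_add_diff_inverse not_less)
    then show "four_block_mat (jordan_block 2 0) (0\<^sub>m 2 ?n) (0\<^sub>m ?n 2)
        (mat ?n ?n (\<lambda>(i, j). if j = Suc i \<and> even i \<and> i < 2 * l then 1 else 0)) $$ (i, j) =
        mat (2 * Suc l + m) (2 * Suc l + m) (\<lambda>(i, j). if j = Suc i \<and> even i \<and> i < 2 * Suc l then 1 else (0::'a)) $$ (i, j)"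
    proof cases
      case 1
      then have "i = 0 \<or> i = 1" by auto
      then show ?thesis using ij by auto
    next
      case 2
      then show ?thesis using ij by auto
    qed
  qed auto
  finally show ?case .
qed

text \<open>Both are partial permutation matrices with \<open>l\<close> arrows, so a reordering of
  the basis suffices.\<close>

lemma corner_mat_similar_jordan:
  assumes n: "n = 2 * l + m"
  shows "similar_mat (jordan_matrix (replicate l (2, 0) @ replicate m (1, 0 :: 'a::field))) (corner_mat n l)"
proof -
  let ?D = "jordan_matrix (replicate l (2, 0) @ replicate m (1, 0 :: 'a))"
  have D: "?D = mat n n (\<lambda>(i, j). if j = Suc i \<and> even i \<and> i < 2 * l then 1 else 0)"
    unfolding n by (rule jordan_matrix_square_zero)
  have Dc: "?D \<in> carrier_mat n n" unfolding D by simp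
  \<comment> \<open>The first \<open>l\<close> indices go to the first vectors of the blocks of
    order 2, the last \<open>l\<close> to their second vectors, and the middle ones to the zero
    blocks.\<close>
  define \<pi> where "\<pi> j = (if j < l then 2 * j else if j < n - l then j + l else 2 * (j - (n - l)) + 1)" for j
  have \<pi>: "\<pi> j < n" if "j < n" for j
    using that n by (auto simp: \<pi>_def)
  have inj: "\<pi> i = \<pi> j \<longleftrightarrow> i = j" if "i < n" "j < n" for i j
  proof
    assume eq: "\<pi> i = \<pi> j"
    \<comment> \<open>The three ranges have disjoint values: even below \<open>2 * l\<close>, at
      least \<open>2 * l\<close>, and odd below \<open>2 * l\<close>.\<close>
    have "\<pi> k = 2 * k \<and> k < l \<or> \<pi> k = k + l \<and> l \<le> k \<and> k < l + m \<or>
        \<pi> k = 2 * (k - (l + m)) + 1 \<and> l + m \<le> k \<and> \<pi> k < 2 * l" if "k < n" for k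
      using that n by (cases "k < l"; cases "k < l + m") (auto simp: \<pi>_def)
    from this[OF \<open>i < n\<close>] this[OF \<open>j < n\<close>] eq show "i = j"
      by (elim disjE conjE) (simp_all, (metis Suc_double_not_eq_double double_not_eq_Suc_double)+)
  qed simp
  let ?P = "select_rows n n \<pi> :: 'a mat" and ?Q = "select_cols n n \<pi> :: 'a mat"
  have PQ: "?P * ?Q = 1\<^sub>m n"
  proof (rule eq_matI)
    fix i j assume "i < dim_row (1\<^sub>m n :: 'a mat)" "j < dim_col (1\<^sub>m n :: 'a mat)"
    then have ij: "i < n" "j < n" by auto
    have "(?P * ?Q) $$ (i, j) = ?Q $$ (\<pi> i, j)"
      by (rule select_rows_mult_index) (use ij \<pi> in auto)
    then show "(?P * ?Q) $$ (i, j) = 1\<^sub>m n $$ (i, j)"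
      using ij \<pi> inj by (simp add: select_cols_def)
  qed (auto simp: select_rows_def select_cols_def)
  have QP: "?Q * ?P = 1\<^sub>m n"
    by (rule mat_mult_left_right_inverse[OF select_carrier(1) select_carrier(2) PQ])
  have "corner_mat n l = ?P * ?D * ?Q"
  proof (rule eq_matI)
    fix i j assume "i < dim_row (?P * ?D * ?Q)" "j < dim_col (?P * ?D * ?Q)"
    then have ij: "i < n" "j < n" by (auto simp: select_rows_def select_cols_def)
    have "(?P * ?D * ?Q) $$ (i, j) = (?P * ?D) $$ (i, \<pi> j)"
      by (rule mult_select_cols_index[OF mult_carrier_mat[OF select_carrier(1) Dc]]) (use ij \<pi> in auto)
    also have "\<dots> = ?D $$ (\<pi> i, \<pi> j)"
      by (rule select_rows_mult_index[OF Dc]) (use ij \<pi> in auto)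
    also have "\<dots> = corner_mat n l $$ (i, j)"
    proof -
      have "(\<pi> j = Suc (\<pi> i) \<and> even (\<pi> i) \<and> \<pi> i < 2 * l) \<longleftrightarrow> (i < l \<and> j = i + (n - l))"
      proof
        assume *: "\<pi> j = Suc (\<pi> i) \<and> even (\<pi> i) \<and> \<pi> i < 2 * l"
        then have "i < l" using ij n by (auto simp: \<pi>_def split: if_splits)
        moreover from this have "\<pi> j = \<pi> (i + (n - l))" using * n by (simp add: \<pi>_def)
        then have "j = i + (n - l)" using inj[of j "i + (n - l)"] ij \<open>i < l\<close> n by simp
        ultimately show "i < l \<and> j = i + (n - l)" by simp
      qed (use n in \<open>auto simp: \<pi>_def\<close>)
      then show ?thesis unfolding D using ij \<pi> by (simp add: corner_mat_def)
    qed
    finally show "corner_mat n l $$ (i, j) = (?P * ?D * ?Q) $$ (i, j)" by simp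
  qed (auto simp: select_rows_def select_cols_def)
  then have "similar_mat (corner_mat n l) ?D"
    using similar_matI[of "corner_mat n l" ?D ?P ?Q n] PQ QP Dc corner_mat_carrier select_carrier by blast
  then show ?thesis by (rule similar_mat_sym)
qed

theorem proposition22:
  fixes A B C :: "'a::alg_closed_field mat" and l m n :: nat
  assumes "l > 0" and "n = 2 * l + m"
    and "\<And>T :: 'a mat_triple. T \<in> N3 n \<Longrightarrow>
           \<exists>M \<in> triple_span T. vec_space.rank n M \<ge> l + 1 \<or>
             (vec_space.rank n M = l \<and> M * M \<noteq> 0\<^sub>m n n) \<Longrightarrow>
           T \<in> zariski_topology n closure_of R3 n"
    and "(A, B, C) \<in> N3 n"
    and "jordan_nf A (replicate l (2, 0) @ replicate m (1, 0))"
  shows "(A, B, C) \<in> zariski_topology n closure_of R3 n"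
proof (cases "n = 2")
  \<comment> \<open>Here \<open>l = 1\<close> and \<open>m = 0\<close>: \<open>A\<close> is a single
    Jordan block, so the triple lies in \<open>R3 n\<close> itself.\<close>
  case True
  then have jnf: "jordan_nf A [(2, 0)]"
    using assms(1,2,5) by (cases l) (auto simp: numeral_2_eq_2)
  have "kernel_dim (char_matrix A e) \<le> 1" for e
    using dim_gen_eigenspace[OF jnf, of e 1] assms(4)
    by (auto simp: dim_gen_eigenspace_def N3_iff char_matrix_def split: if_splits)
  then have "one_regular A" by (simp add: one_regular_def)
  then have "(A, B, C) \<in> R3 n"
    using assms(4) triple_span_members(1)[of A n B C] unfolding R3_def by (auto simp: N3_iff)
  then show ?thesis using R3_subset_closure by blast
next
  case False
  let ?K = "zariski_topology n closure_of (R3 n :: 'a mat_triple set)" and ?J = "corner_mat n l :: 'a mat"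
  have A: "A \<in> carrier_mat n n" and B: "B \<in> carrier_mat n n" and C: "C \<in> carrier_mat n n"
    using assms(4) by (auto simp: N3_iff)
  have adm: "admissible n l ?K" using admissible_closure assms(3) by blast
  have "similar_mat A ?J"
    using assms(5) corner_mat_similar_jordan[OF assms(2)] similar_mat_trans unfolding jordan_nf_def by blast
  then obtain P Q where "similar_mat_wit A ?J P Q" unfolding similar_mat_def by blast
  note w = similar_mat_witD2[OF A this]
  have P: "P \<in> carrier_mat n n" and Q: "Q \<in> carrier_mat n n" and PQ: "P * Q = 1\<^sub>m n" and QP: "Q * P = 1\<^sub>m n"
    and AJ: "A = P * ?J * Q"
    by (fact w)+
  have cancel: "U * (V * M * U) * V = M"
    if U: "U \<in> carrier_mat n n" and V: "V \<in> carrier_mat n n" and UV: "U * V = 1\<^sub>m n" and M: "M \<in> carrier_mat n n" for U V M :: "'a mat"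
  proof -
    have "U * (V * M * U) * V = (U * V) * M * (U * V)"
      using U V M by (simp add: assoc_mult_mat[of _ n n _ n _ n])
    then show ?thesis unfolding UV using M by simp
  qed
  have "Q * A * P = ?J" using cancel[OF Q P QP, of ?J] AJ by simp
  then have "(?J, Q * B * P, Q * C * P) \<in> N3 n"
    using N3_similar[OF assms(4) Q P QP PQ] by simp
  \<comment> \<open>The corner result is applied to the preimage of the closure under conjugation by
    \<open>P\<close> and \<open>Q\<close>; undoing the conjugation returns the original
    triple.\<close>
  then have "(?J, Q * B * P, Q * C * P) \<in> {(A, B, C). (P * A * Q, P * B * Q, P * C * Q) \<in> ?K}"
    using corner_triple_in_admissible[OF admissible_similar[OF adm P Q PQ QP]] assms(1,2) False by simp
  then show ?thesis using cancel[OF P Q PQ B] cancel[OF P Q PQ C] AJ by simp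
qed

end
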